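(* Let $\mathcal{U}\subseteq\mathcal{B}(\mathcal{H}_1,\mathcal{H}_2)$ be a normalizing space of operators and let $\chi=\operatorname{Map}\mathcal{U}$. Then the semi-lattices $\mathcal{S}_1=\mathcal{S}_{1\chi}$ and $\mathcal{S}_2=\mathcal{S}_{2\chi}$ of $\chi$ are complete ortho-lattices and $\chi$ is a complete ortho-lattice isomorphism of $\mathcal{S}_1$ onto $\mathcal{S}_2$. Moreover, if $\mathcal{T}_1=\mathcal{S}_1|_{0_+^\perp\mathcal{H}_1}$ and $\mathcal{T}_2=\mathcal{S}_2|_{I_-\mathcal{H}_2}$, then $\mathcal{T}_1$ and $\mathcal{T}_2$ are the projection lattices of von Neumann algebras and: (i) with respect to the decomposition $\mathcal{H}_1=0_+^\perp\mathcal{H}_1\oplus 0_+\mathcal{H}_1$, $$\operatorname{Alg}\mathcal{S}_1=\left\{\begin{pmatrix}A&0\\C&D\end{pmatrix}: A\in\mathcal{T}_1',\ C\in\mathcal{B}(0_+^\perp\mathcal{H}_1,0_+\mathcal{H}_1),\ D\in\mathcal{B}(0_+\mathcal{H}_1,0_+\mathcal{H}_1)\right\}$$ and $$(\mathcal{U}^*\mathcal{U})''=\left\{\begin{pmatrix}A&0\\0&\lambda I\end{pmatrix}:A\in\mathcal{T}_1',\ \lambda\in\mathbb{C}\right\};$$ (ii) with respect to the decomposition $\mathcal{H}_2=I_-\mathcal{H}_2\oplus I_-^\perp\mathcal{H}_2$, $$\operatorname{Alg}\mathcal{S}_2=\left\{\begin{pmatrix}B&C\\0&D\end{pmatrix}: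 B\in\mathcal{T}_2',\ C\in\mathcal{B}(I_-^\perp\mathcal{H}_2,I_-\mathcal{H}_2),\ D\in\mathcal{B}(I_-^\perp\mathcal{H}_2,I_-^\perp\mathcal{H}_2)\right\}$$ and $$(\mathcal{U}\mathcal{U}^* )''=\left\{\begin{pmatrix}B&0\\0&\lambda I\end{pmatrix}:B\in\mathcal{T}_2',\ \lambda\in\mathbb{C}\right\};$$ (iii) $\operatorname{Lat}(\mathcal{U}^*\mathcal{U})=\{L\in\mathcal{P}_1:\chi(L)\perp\chi(L^\perp)\}=\{L_1\oplus L_2: L_1\in\mathcal{T}_1\}$, where the direct sums are with respect to $\mathcal{H}_1=0_+^\perp\mathcal{H}_1\oplus 0_+\mathcal{H}_1$ and $L_2$ ranges over all projections on $0_+\mathcal{H}_1$.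
   Context: $\mathcal{H}_1,\mathcal{H}_2$ are complex Hilbert spaces, $\mathcal{P}_i$ the lattice of all orthogonal projections on $\mathcal{H}_i$, $P^\perp=I-P$. A linear subspace $\mathcal{U}$ is normalizing if $AB^*C\in\mathcal{U}$ for all $A,B,C\in\mathcal{U}$. $\operatorname{Map}\mathcal{U}:\mathcal{P}_1\to\mathcal{P}_2$ sends $P$ to the projection onto the closed linear span of $\{Sx:S\in\mathcal{U},x\in P(\mathcal{H}_1)\}$. For $\chi:\mathcal{P}_1\to\mathcal{P}_2$ preserving $0$ and arbitrary suprema, $\mathcal{S}_{2\chi}=\chi(\mathcal{P}_1)$ and $\mathcal{S}_{1\chi}=\{\bigvee\{P\in\mathcal{P}_1:\chi(P)\le Q\}:Q\in\mathcal{P}_2\}$; for $\chi=\operatorname{Map}\mathcal{U}$ one has $\mathcal{S}_{1\chi}=\{\chi^*(Q)^\perp:Q\in\mathcal{P}_2\}$ with $\chi^*=\operatorname{Map}\mathcal{U}^*$. $I_-=\chi(I)\in\mathcal{P}_2$ and $0_+=\bigvee\{P\in\mathcal{P}_1:\chi(P)=0\}\in\mathcal{P}_1$. Every element of $\mathcal{S}_1$ dominates $0_+$ and every element of $\mathcal{S}_2$ is dominated by $I_-$; the orthocomplement of $L$ in $\mathcal{S}_1$ is $L^\perp\vee 0_+$ and that of $M$ in $\mathcal{S}_2$ is $M^\perp\wedge I_-$ (i.e. orthocomplements are relative to the least and greatest elements; suprema and infima are those of $\mathcal{P}_i$). $\mathcal{S}|_{\mathcal{K}}$ denotes the set of restrictions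 to the (reducing) subspace $\mathcal{K}$ of the elements of $\mathcal{S}$. $\mathcal{U}^*\mathcal{U}=\{S^*T:S,T\in\mathcal{U}\}$, $\mathcal{U}\mathcal{U}^*=\{ST^*:S,T\in\mathcal{U}\}$; $'$ and $''$ denote commutant and bicommutant ($\mathcal{T}_1'$ taken in $\mathcal{B}(0_+^\perp\mathcal{H}_1)$, $\mathcal{T}_2'$ in $\mathcal{B}(I_-\mathcal{H}_2)$). For a set $\mathcal{L}$ of projections, $\operatorname{Alg}\mathcal{L}=\{A:L^\perp AL=0\ \forall L\in\mathcal{L}\}$; for a set $\mathcal{X}$ of operators, $\operatorname{Lat}\mathcal{X}$ is the set of projections $L$ with $L^\perp XL=0$ for all $X\in\mathcal{X}$. *)

theory Defs
  imports "HOL-Analysis.Analysis" "HOL-Algebra.Complete_Lattice"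
begin

section \<open>Complex Hilbert spaces\<close>

class scaleC =
  fixes scaleC :: "complex \<Rightarrow> 'a \<Rightarrow> 'a"  (infixr \<open>*\<^sub>C\<close> 75)

text \<open>The inner product is linear in the first argument.  Completeness, and the fact that the
  norm induces the metric and the topology, come from the superclass \<^class>\<open>banach\<close>.\<close>

class complex_hilbert = banach + scaleC +
  fixes cinner :: "'a \<Rightarrow> 'a \<Rightarrow> complex"
  assumes scaleC_add_right: "a *\<^sub>C (x + y) = a *\<^sub>C x + a *\<^sub>C y"
    and scaleC_add_left: "(a + b) *\<^sub>C x = a *\<^sub>C x + b *\<^sub>C x"
    and scaleC_scaleC: "a *\<^sub>C (b *\<^sub>C x) = (a * b) *\<^sub>C x"
    and scaleR_scaleC: "r *\<^sub>R x = complex_of_real r *\<^sub>C x"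
    and cinner_commute: "cinner x y = cnj (cinner y x)"
    and cinner_add_left: "cinner (x + y) z = cinner x z + cinner y z"
    and cinner_scaleC_left: "cinner (a *\<^sub>C x) y = a * cinner x y"
    and cinner_self: "cinner x x = complex_of_real ((norm x)\<^sup>2)"

instantiation complex :: complex_hilbert
begin

definition scaleC_complex :: "complex \<Rightarrow> complex \<Rightarrow> complex"
  where "scaleC_complex a x = a * x"

definition cinner_complex :: "complex \<Rightarrow> complex \<Rightarrow> complex"
  where "cinner_complex x y = x * cnj y"

instance
proof
  show "r *\<^sub>R x = complex_of_real r *\<^sub>C x" for r and x :: complex
    by (simp add: scaleC_complex_def scaleR_conv_of_real)
  show "cinner x x = complex_of_real ((norm x)\<^sup>2)" for x :: complex
    unfolding cinner_complex_def by (simp only: complex_norm_square)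
qed (simp_all add: scaleC_complex_def cinner_complex_def algebra_simps)

end

global_interpretation complex_vector:
  vector_space "scaleC :: complex \<Rightarrow> 'a \<Rightarrow> 'a :: complex_hilbert"
proof
  show "1 *\<^sub>C x = x" for x :: 'a
    using scaleR_scaleC [of 1 x] by simp
qed (simp_all add: scaleC_add_right scaleC_add_left scaleC_scaleC)


section \<open>Bounded operators between closed subspaces\<close>

text \<open>Closed subspaces \<open>K\<close>, \<open>L\<close> are Hilbert spaces in their own right.  An operator from \<open>K\<close> to
  \<open>L\<close> is an extensional function (\<^const>\<open>undefined\<close> outside \<open>K\<close>), so that equality of operators
  is equality of functions and \<^const>\<open>restrict\<close> is the restriction of operators.  For
  \<open>K = UNIV\<close> the extensionality condition is void.\<close>

definition bop :: "'a::complex_hilbert set \<Rightarrow> 'b::complex_hilbert set \<Rightarrow> ('a \<Rightarrow> 'b) set"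
  where "bop K L = {T \<in> K \<rightarrow>\<^sub>E L.
    (\<forall>x\<in>K. \<forall>y\<in>K. T (x + y) = T x + T y) \<and>
    (\<forall>c. \<forall>x\<in>K. T (c *\<^sub>C x) = c *\<^sub>C T x) \<and>
    (\<exists>B. \<forall>x\<in>K. norm (T x) \<le> B * norm x)}"

definition adj :: "'a::complex_hilbert set \<Rightarrow> 'b::complex_hilbert set \<Rightarrow> ('a \<Rightarrow> 'b) \<Rightarrow> 'b \<Rightarrow> 'a"
  where "adj K L T = (THE S. S \<in> bop L K \<and> (\<forall>x\<in>K. \<forall>y\<in>L. cinner (T x) y = cinner x (S y)))"

abbreviation adjoint_op :: "('a::complex_hilbert \<Rightarrow> 'b::complex_hilbert) \<Rightarrow> 'b \<Rightarrow> 'a"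
  where "adjoint_op \<equiv> adj UNIV UNIV"

definition commutant :: "'a::complex_hilbert set \<Rightarrow> ('a \<Rightarrow> 'a) set \<Rightarrow> ('a \<Rightarrow> 'a) set"
  where "commutant K X = {A \<in> bop K K. \<forall>T\<in>X. \<forall>x\<in>K. A (T x) = T (A x)}"

text \<open>A von Neumann algebra on \<open>K\<close> is a self-adjoint set of operators equal to its bicommutant;
  being a commutant, it is then automatically a unital subalgebra of \<open>bop K K\<close>.\<close>

definition von_neumann_algebra :: "'a::complex_hilbert set \<Rightarrow> ('a \<Rightarrow> 'a) set \<Rightarrow> bool"
  where "von_neumann_algebra K M \<longleftrightarrow>
    M \<subseteq> bop K K \<and> (\<forall>A\<in>M. adj K K A \<in> M) \<and> commutant K (commutant K M) = M"

definition projections :: "'a::complex_hilbert set \<Rightarrow> ('a \<Rightarrow> 'a) set"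
  where "projections K = {P \<in> bop K K.
    (\<forall>x\<in>K. P (P x) = P x) \<and> (\<forall>x\<in>K. \<forall>y\<in>K. cinner (P x) y = cinner x (P y))}"

definition is_projection_lattice_of_vN :: "'a::complex_hilbert set \<Rightarrow> ('a \<Rightarrow> 'a) set \<Rightarrow> bool"
  where "is_projection_lattice_of_vN K S \<longleftrightarrow>
    (\<exists>M. von_neumann_algebra K M \<and> S = M \<inter> projections K)"


section \<open>Lattices of projections on the whole space\<close>

text \<open>\<^term>\<open>proj_order S\<close> is the set \<open>S\<close> of projections with the usual order of projections.
  Suprema and infima in it are taken within \<open>S\<close>; those of \<^term>\<open>proj_lattice\<close> are the
  ones in the lattice of all projections.\<close>

definition proj_order :: "('a::complex_hilbert \<Rightarrow> 'a) set \<Rightarrow> ('a \<Rightarrow> 'a) gorder"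
  where "proj_order S = \<lparr>carrier = S, eq = (=), le = (\<lambda>P Q. range P \<subseteq> range Q)\<rparr>"

abbreviation proj_lattice :: "('a::complex_hilbert \<Rightarrow> 'a) gorder"
  where "proj_lattice \<equiv> proj_order (projections UNIV)"

definition perp :: "('a::complex_hilbert \<Rightarrow> 'a) \<Rightarrow> 'a \<Rightarrow> 'a"
  where "perp P = (\<lambda>x. x - P x)"

definition proj_onto :: "'a::complex_hilbert set \<Rightarrow> 'a \<Rightarrow> 'a"
  where "proj_onto M = (THE P. P \<in> projections UNIV \<and> range P = M)"

definition Alg :: "('a::complex_hilbert \<Rightarrow> 'a) set \<Rightarrow> ('a \<Rightarrow> 'a) set"
  where "Alg S = {A \<in> bop UNIV UNIV. \<forall>L\<in>S. perp L \<circ> A \<circ> L = (\<lambda>_. 0)}"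

definition Lat :: "('a::complex_hilbert \<Rightarrow> 'a) set \<Rightarrow> ('a \<Rightarrow> 'a) set"
  where "Lat X = {L \<in> projections UNIV. \<forall>A\<in>X. perp L \<circ> A \<circ> L = (\<lambda>_. 0)}"

text \<open>\<open>block P A B C D\<close> is the operator with matrix \<open>(A B; C D)\<close> with respect to the
  decomposition \<open>range P \<oplus> range (perp P)\<close> of the whole space.\<close>

definition block :: "('a::complex_hilbert \<Rightarrow> 'a) \<Rightarrow>
    ('a \<Rightarrow> 'a) \<Rightarrow> ('a \<Rightarrow> 'a) \<Rightarrow> ('a \<Rightarrow> 'a) \<Rightarrow> ('a \<Rightarrow> 'a) \<Rightarrow> 'a \<Rightarrow> 'a"
  where "block P A B C D = (\<lambda>x. (A (P x) + B (perp P x)) + (C (P x) + D (perp P x)))"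

definition zero_on :: "'a::complex_hilbert set \<Rightarrow> 'a \<Rightarrow> 'a"
  where "zero_on K = (\<lambda>x\<in>K. 0)"

definition scalar_on :: "'a::complex_hilbert set \<Rightarrow> complex \<Rightarrow> 'a \<Rightarrow> 'a"
  where "scalar_on K c = (\<lambda>x\<in>K. c *\<^sub>C x)"


section \<open>Complete ortho-lattices\<close>

definition complete_ortholattice :: "'a gorder \<Rightarrow> ('a \<Rightarrow> 'a) \<Rightarrow> bool"
  where "complete_ortholattice L c \<longleftrightarrow> complete_lattice L \<and>
    (\<forall>x\<in>carrier L. c x \<in> carrier L \<and> c (c x) = x \<and>
       x \<sqinter>\<^bsub>L\<^esub> c x = \<bottom>\<^bsub>L\<^esub> \<and> x \<squnion>\<^bsub>L\<^esub> c x = \<top>\<^bsub>L\<^esub>) \<and>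
    (\<forall>x\<in>carrier L. \<forall>y\<in>carrier L. x \<sqsubseteq>\<^bsub>L\<^esub> y \<longrightarrow> c y \<sqsubseteq>\<^bsub>L\<^esub> c x)"

definition complete_ortholattice_iso ::
    "('a \<Rightarrow> 'b) \<Rightarrow> 'a gorder \<Rightarrow> ('a \<Rightarrow> 'a) \<Rightarrow> 'b gorder \<Rightarrow> ('b \<Rightarrow> 'b) \<Rightarrow> bool"
  where "complete_ortholattice_iso f L c M d \<longleftrightarrow>
    bij_betw f (carrier L) (carrier M) \<and>
    (\<forall>F. F \<subseteq> carrier L \<longrightarrow> f (\<Squnion>\<^bsub>L\<^esub> F) = \<Squnion>\<^bsub>M\<^esub> (f ` F)) \<and>
    (\<forall>F. F \<subseteq> carrier L \<longrightarrow> f (\<Sqinter>\<^bsub>L\<^esub> F) = \<Sqinter>\<^bsub>M\<^esub> (f ` F)) \<and>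
    (\<forall>x\<in>carrier L. f (c x) = d (f x))"


section \<open>Normalizing spaces and the maps they induce\<close>

definition operator_subspace :: "('a::complex_hilbert \<Rightarrow> 'b::complex_hilbert) set \<Rightarrow> bool"
  where "operator_subspace U \<longleftrightarrow> U \<subseteq> bop UNIV UNIV \<and> (\<lambda>_. 0) \<in> U \<and>
    (\<forall>S\<in>U. \<forall>T\<in>U. (\<lambda>x. S x + T x) \<in> U) \<and> (\<forall>c. \<forall>T\<in>U. (\<lambda>x. c *\<^sub>C T x) \<in> U)"

definition normalizing :: "('a::complex_hilbert \<Rightarrow> 'b::complex_hilbert) set \<Rightarrow> bool"
  where "normalizing U \<longleftrightarrow> operator_subspace U \<and>
    (\<forall>A\<in>U. \<forall>B\<in>U. \<forall>C\<in>U. A \<circ> adjoint_op B \<circ> C \<in> U)"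

definition op_Map :: "('a::complex_hilbert \<Rightarrow> 'b::complex_hilbert) set \<Rightarrow> ('a \<Rightarrow> 'a) \<Rightarrow> 'b \<Rightarrow> 'b"
  where "op_Map U P = proj_onto (closure (complex_vector.span {S x |S x. S \<in> U \<and> x \<in> range P}))"

definition semilattice1 ::
    "(('a::complex_hilbert \<Rightarrow> 'a) \<Rightarrow> 'b::complex_hilbert \<Rightarrow> 'b) \<Rightarrow> ('a \<Rightarrow> 'a) set"
  where "semilattice1 \<phi> =
    {\<Squnion>\<^bsub>proj_lattice\<^esub> {P \<in> projections UNIV. \<phi> P \<sqsubseteq>\<^bsub>proj_lattice\<^esub> Q} |Q. Q \<in> projections UNIV}"

definition semilattice2 ::
    "(('a::complex_hilbert \<Rightarrow> 'a) \<Rightarrow> 'b::complex_hilbert \<Rightarrow> 'b) \<Rightarrow> ('b \<Rightarrow> 'b) set"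
  where "semilattice2 \<phi> = \<phi> ` projections UNIV"

definition zero_plus :: "(('a::complex_hilbert \<Rightarrow> 'a) \<Rightarrow> 'b::complex_hilbert \<Rightarrow> 'b) \<Rightarrow> 'a \<Rightarrow> 'a"
  where "zero_plus \<phi> = \<Squnion>\<^bsub>proj_lattice\<^esub> {P \<in> projections UNIV. \<phi> P = (\<lambda>_. 0)}"

definition I_minus :: "(('a::complex_hilbert \<Rightarrow> 'a) \<Rightarrow> 'b::complex_hilbert \<Rightarrow> 'b) \<Rightarrow> 'b \<Rightarrow> 'b"
  where "I_minus \<phi> = \<phi> (\<lambda>x. x)"

text \<open>Orthocomplements relative to the least element \<^term>\<open>zero_plus \<phi>\<close> of \<^term>\<open>semilattice1 \<phi>\<close>
  and to the greatest element \<^term>\<open>I_minus \<phi>\<close> of \<^term>\<open>semilattice2 \<phi>\<close>.\<close>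

definition ocomp1 ::
    "(('a::complex_hilbert \<Rightarrow> 'a) \<Rightarrow> 'b::complex_hilbert \<Rightarrow> 'b) \<Rightarrow> ('a \<Rightarrow> 'a) \<Rightarrow> 'a \<Rightarrow> 'a"
  where "ocomp1 \<phi> L = perp L \<squnion>\<^bsub>proj_lattice\<^esub> zero_plus \<phi>"

definition ocomp2 ::
    "(('a::complex_hilbert \<Rightarrow> 'a) \<Rightarrow> 'b::complex_hilbert \<Rightarrow> 'b) \<Rightarrow> ('b \<Rightarrow> 'b) \<Rightarrow> 'b \<Rightarrow> 'b"
  where "ocomp2 \<phi> M = perp M \<sqinter>\<^bsub>proj_lattice\<^esub> I_minus \<phi>"

end

theory Submission
  imports Defs
begin

text \<open>
  Since \<open>U\<close> is normalizing, \<open>V S\<^sup>* T\<close> lies in \<open>U\<close> for all \<open>V, S, T\<close> in \<open>U\<close>.  Hence the largest subspace that \<open>U\<close>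
  maps into a given closed subspace is invariant under \<open>U\<^sup>* U\<close>, and the closed span of the vectors \<open>S x\<close>,
  with \<open>S\<close> in \<open>U\<close> and \<open>x\<close> in a given subspace, is invariant under \<open>U U\<^sup>*\<close>.  These two sets of operators are
  self-adjoint, so invariance of a subspace means that its projection commutes with the set.  Conversely,
  if \<open>L\<close> commutes with \<open>U\<^sup>* U\<close> and contains the common kernel \<open>0\<^sub>+\<close> of \<open>U\<close>, then \<open>L\<close> can be recovered from its
  image: a vector orthogonal to \<open>L\<close> is mapped orthogonally to the image of \<open>L\<close>, and if it is also mapped into
  that image, it lies in the common kernel.  So \<open>S\<^sub>1\<close> consists of the projections of \<open>(U\<^sup>* U)'\<close> above \<open>0\<^sub>+\<close>, \<open>S\<^sub>2\<close>
  of the projections of \<open>(U U\<^sup>*)'\<close> below \<open>I\<^sub>-\<close>, and \<open>\<chi>\<close> and the largest preimage are inverse, order preserving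
  bijections between them (\<open>preimage_psi\<close>, \<open>psi_preimage\<close>).  The same orthogonality shows that \<open>\<chi>\<close>
  respects complements (\<open>psi_complement\<close>).

  Everything else concerns an arbitrary self-adjoint set \<open>X\<close> and the projection \<open>P\<close> onto the orthogonal
  complement of its common kernel (locale \<open>selfadjoint_corner\<close>), and is applied to \<open>U\<^sup>* U\<close> and to \<open>U U\<^sup>*\<close>.  The
  projections of \<open>X'\<close> restrict to the projections of a von Neumann algebra on the range of \<open>P\<close>.  An operator that
  leaves invariant both a projection and its relative complement commutes with it; this gives the operator
  algebras of the two lattices (\<open>Alg_above\<close>, \<open>Alg_below\<close>).  An operator of \<open>X''\<close> is diagonal, a scalar on the
  common kernel, and commutes with the projections of \<open>X'\<close>.

  To see that conversely an operator \<open>A\<close> that commutes with all projections of \<open>X'\<close> lies in \<open>X''\<close>, one needs that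
  a von Neumann algebra is generated by its projections (\<open>commutant_generated_by_projections\<close>).  Instead of
  the spectral theorem, it suffices that a self-adjoint contraction \<open>T\<close> in \<open>X'\<close> has distance at most \<open>1/2\<close> from
  half a reflection \<open>(2 Q - 1) / 2\<close> with a projection \<open>Q\<close> in \<open>X'\<close> (\<open>near_half_reflection\<close>).  Then
  \<open>2 T - (2 Q - 1)\<close> is again a self-adjoint contraction in \<open>X'\<close>, and its commutator with \<open>A\<close> is twice that of \<open>T\<close>.
  As commutators of \<open>A\<close> with contractions are bounded by twice the norm of \<open>A\<close>, they all vanish.  The reflection comes
  from the polar decomposition of \<open>T\<close>, whose absolute value is obtained by a convergent iteration for the
  square root.
\<close>

section \<open>Geometry of complex Hilbert spaces\<close>

lemma cinner_add_right: "cinner x (y + z) = cinner x y + cinner x z"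
  for x :: "'a::complex_hilbert"
  by (metis cinner_commute cinner_add_left complex_cnj_add)

lemma cinner_scaleC_right: "cinner x (a *\<^sub>C y) = cnj a * cinner x y"
  for x :: "'a::complex_hilbert"
  by (metis cinner_commute cinner_scaleC_left complex_cnj_mult)

lemma scaleC_minus_one: "(-1) *\<^sub>C x = - x" for x :: "'a::complex_hilbert"
  by (metis complex_vector.scale_minus_left complex_vector.scale_one)

lemma cinner_minus_left: "cinner (- x) y = - cinner x y" for x :: "'a::complex_hilbert"
  using cinner_scaleC_left[of "-1" x y] by (simp add: scaleC_minus_one)

lemma cinner_minus_right: "cinner x (- y) = - cinner x y" for x :: "'a::complex_hilbert"
  using cinner_scaleC_right[of x "-1" y] by (simp add: scaleC_minus_one)

lemma cinner_diff_left: "cinner (x - y) z = cinner x z - cinner y z" for x :: "'a::complex_hilbert"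
  by (metis cinner_add_left cinner_minus_left diff_conv_add_uminus)

lemma cinner_diff_right: "cinner x (y - z) = cinner x y - cinner x z" for x :: "'a::complex_hilbert"
  by (metis cinner_add_right cinner_minus_right diff_conv_add_uminus)

lemma cinner_zero_left [simp]: "cinner 0 x = 0" for x :: "'a::complex_hilbert"
  using cinner_diff_left[of x x x] by simp

lemma cinner_zero_right [simp]: "cinner x 0 = 0" for x :: "'a::complex_hilbert"
  using cinner_diff_right[of x x x] by simp

lemma cinner_scaleR_left: "cinner (r *\<^sub>R x) y = of_real r * cinner x y" for x :: "'a::complex_hilbert"
  by (simp add: scaleR_scaleC cinner_scaleC_left)

lemma cinner_scaleR_right: "cinner x (r *\<^sub>R y) = of_real r * cinner x y" for x :: "'a::complex_hilbert"
  by (simp add: scaleR_scaleC cinner_scaleC_right)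

lemmas cinner_algebra = cinner_add_left cinner_add_right cinner_diff_left cinner_diff_right
  cinner_minus_left cinner_minus_right cinner_scaleC_left cinner_scaleC_right
  cinner_scaleR_left cinner_scaleR_right

lemma cinner_eq_zero_iff [simp]: "cinner x x = 0 \<longleftrightarrow> x = 0" for x :: "'a::complex_hilbert"
  by (simp add: cinner_self)

lemma cinner_eqI: "(\<And>z. cinner x z = cinner y z) \<Longrightarrow> x = y" for x :: "'a::complex_hilbert"
  by (metis cinner_diff_left cinner_eq_zero_iff eq_iff_diff_eq_0)

lemma cinner_zero_commute: "cinner x y = 0 \<longleftrightarrow> cinner y x = 0" for x :: "'a::complex_hilbert"
  by (metis cinner_commute complex_cnj_zero)

lemma norm_add_squared: "(norm (x + y))\<^sup>2 = (norm x)\<^sup>2 + (norm y)\<^sup>2 + 2 * Re (cinner x y)"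
  for x :: "'a::complex_hilbert"
proof -
  have "complex_of_real ((norm (x + y))\<^sup>2) =
      of_real ((norm x)\<^sup>2) + of_real ((norm y)\<^sup>2) + (cinner x y + cnj (cinner x y))"
    unfolding cinner_self[symmetric] cinner_add_left cinner_add_right cinner_commute[of y x]
    by (simp only: ac_simps)
  also have "\<dots> = of_real ((norm x)\<^sup>2 + (norm y)\<^sup>2 + 2 * Re (cinner x y))"
    by (simp add: complex_add_cnj)
  finally show ?thesis by (simp only: of_real_eq_iff)
qed

lemma norm_diff_squared: "(norm (x - y))\<^sup>2 = (norm x)\<^sup>2 + (norm y)\<^sup>2 - 2 * Re (cinner x y)"
  for x :: "'a::complex_hilbert"
  using norm_add_squared[of x "- y"] by (simp add: cinner_minus_right)

lemma norm_scaleC: "norm (a *\<^sub>C x) = cmod a * norm x" for x :: "'a::complex_hilbert"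
proof -
  have "complex_of_real ((norm (a *\<^sub>C x))\<^sup>2) = a * cnj a * of_real ((norm x)\<^sup>2)"
    unfolding cinner_self[symmetric] cinner_scaleC_left cinner_scaleC_right by (simp only: ac_simps)
  also have "\<dots> = of_real ((cmod a * norm x)\<^sup>2)"
    by (simp only: complex_norm_square[symmetric] of_real_mult[symmetric] power_mult_distrib)
  finally have "(norm (a *\<^sub>C x))\<^sup>2 = (cmod a * norm x)\<^sup>2"
    by (simp only: of_real_eq_iff)
  then show ?thesis by (simp add: power2_eq_iff_nonneg)
qed

text \<open>Removing from \<^term>\<open>x\<close> its component along \<^term>\<open>z\<close> shortens it; this gives both the
  Cauchy-Schwarz inequality and the orthogonality of the residual of a best approximation.\<close>

lemma norm_minus_component:
  fixes x z :: "'a::complex_hilbert"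
  assumes "z \<noteq> 0"
  shows "(norm (x - (cinner x z / of_real ((norm z)\<^sup>2)) *\<^sub>C z))\<^sup>2 =
    (norm x)\<^sup>2 - (cmod (cinner x z))\<^sup>2 / (norm z)\<^sup>2"
proof -
  define c where "c = cinner x z / of_real ((norm z)\<^sup>2)"
  have n: "(norm z)\<^sup>2 > 0" using assms by simp
  have "Re (cinner x (c *\<^sub>C z)) = (cmod (cinner x z))\<^sup>2 / (norm z)\<^sup>2"
  proof -
    have "cinner x (c *\<^sub>C z) = (cinner x z * cnj (cinner x z)) / of_real ((norm z)\<^sup>2)"
      by (simp add: c_def cinner_scaleC_right)
    also have "\<dots> = of_real ((cmod (cinner x z))\<^sup>2 / (norm z)\<^sup>2)"
      by (simp only: complex_norm_square[symmetric] of_real_divide)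
    finally show ?thesis by (simp only: Re_complex_of_real)
  qed
  moreover have "(norm (c *\<^sub>C z))\<^sup>2 = (cmod (cinner x z))\<^sup>2 / (norm z)\<^sup>2"
    unfolding norm_scaleC c_def norm_divide norm_of_real using n assms
    by (simp add: power_mult_distrib power_divide power2_eq_square power4_eq_xxxx)
  ultimately show ?thesis unfolding c_def[symmetric] norm_diff_squared by simp
qed

lemma norm_cinner_le: "cmod (cinner x y) \<le> norm x * norm y" for x :: "'a::complex_hilbert"
proof (cases "y = 0")
  case False
  have "0 \<le> (norm x)\<^sup>2 - (cmod (cinner x y))\<^sup>2 / (norm y)\<^sup>2"
    using norm_minus_component[OF False, of x] by (metis zero_le_power2)
  then have "(cmod (cinner x y))\<^sup>2 \<le> (norm x * norm y)\<^sup>2"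
    using False by (simp add: field_simps power_mult_distrib)
  then show ?thesis by (simp add: power2_le_iff_abs_le)
qed simp

lemma bounded_bilinear_cinner: "bounded_bilinear (cinner :: 'a::complex_hilbert \<Rightarrow> 'a \<Rightarrow> complex)"
  by unfold_locales
    (auto simp: cinner_algebra scaleR_conv_of_real intro!: exI[of _ 1] norm_cinner_le)

lemma bounded_linear_scaleC: "bounded_linear (\<lambda>x::'a::complex_hilbert. a *\<^sub>C x)"
  by (rule bounded_linear_intro[of _ "cmod a"])
    (simp_all add: scaleC_add_right scaleR_scaleC scaleC_scaleC norm_scaleC mult.commute)

subsection \<open>Closed subspaces and orthogonal projections\<close>

definition closed_subspace :: "'a::complex_hilbert set \<Rightarrow> bool"
  where "closed_subspace M \<longleftrightarrow> complex_vector.subspace M \<and> closed M"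

lemma closed_subspaceD:
  assumes "closed_subspace M"
  shows "0 \<in> M" "x \<in> M \<Longrightarrow> y \<in> M \<Longrightarrow> x + y \<in> M" "x \<in> M \<Longrightarrow> c *\<^sub>C x \<in> M"
    "x \<in> M \<Longrightarrow> y \<in> M \<Longrightarrow> x - y \<in> M" "x \<in> M \<Longrightarrow> r *\<^sub>R x \<in> M" "x \<in> M \<Longrightarrow> - x \<in> M"
  using assms unfolding closed_subspace_def
  by (auto simp: complex_vector.subspace_0 complex_vector.subspace_add complex_vector.subspace_scale
      complex_vector.subspace_diff scaleR_scaleC complex_vector.subspace_neg)

lemma closed_subspace_INT:
  "(\<And>i. i \<in> I \<Longrightarrow> closed_subspace (M i)) \<Longrightarrow> closed_subspace (\<Inter>i\<in>I. M i)"
  unfolding closed_subspace_def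
  by (auto simp: complex_vector.subspace_def)

lemma closed_subspace_UNIV: "closed_subspace UNIV"
  unfolding closed_subspace_def by (auto simp: complex_vector.subspace_def)

lemma closed_subspace_closure_span:
  "closed_subspace (closure (complex_vector.span M))"
  unfolding closed_subspace_def complex_vector.subspace_def
proof (intro conjI ballI allI)
  let ?S = "complex_vector.span M"
  show "0 \<in> closure ?S" by (rule subsetD[OF closure_subset complex_vector.span_zero])
  fix x assume x: "x \<in> closure ?S"
  then obtain f where f: "\<And>n. f n \<in> ?S" "f \<longlonglongrightarrow> x" unfolding closure_sequential by blast
  show "c *\<^sub>C x \<in> closure ?S" for c
    unfolding closure_sequential
    by (intro exI[of _ "\<lambda>n. c *\<^sub>C f n"] conjI allI complex_vector.span_scale f(1)
        bounded_linear.tendsto[OF bounded_linear_scaleC f(2)])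
  fix y assume "y \<in> closure ?S"
  then obtain g where g: "\<And>n. g n \<in> ?S" "g \<longlonglongrightarrow> y" unfolding closure_sequential by blast
  show "x + y \<in> closure ?S"
    unfolding closure_sequential
    by (intro exI[of _ "\<lambda>n. f n + g n"] conjI allI complex_vector.span_add f g tendsto_add)
qed simp

lemma closure_span_minimal:
  assumes "closed_subspace N" "M \<subseteq> N"
  shows "closure (complex_vector.span M) \<subseteq> N"
  using assms unfolding closed_subspace_def
  by (meson closure_minimal complex_vector.span_minimal)

lemma closure_span_superset: "M \<subseteq> closure (complex_vector.span M)"
  by (rule subset_trans[OF complex_vector.span_superset closure_subset])

definition ortho :: "'a::complex_hilbert set \<Rightarrow> 'a set"
  where "ortho M = {x. \<forall>y\<in>M. cinner x y = 0}"

lemma closed_subspace_ortho: "closed_subspace (ortho M)"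
proof -
  have *: "closed_subspace {x. cinner x y = 0}" for y :: 'a
  proof -
    have "closed {x. cinner x y = 0}"
      by (intro closed_Collect_eq continuous_intros
          bounded_linear.continuous_on[OF bounded_bilinear.bounded_linear_left[OF bounded_bilinear_cinner]])
    then show ?thesis
      unfolding closed_subspace_def complex_vector.subspace_def by (simp add: cinner_algebra)
  qed
  have "ortho M = (\<Inter>y\<in>M. {x. cinner x y = 0})" by (auto simp: ortho_def)
  then show ?thesis using * closed_subspace_INT by metis
qed

lemma ortho_closure_span: "ortho (closure (complex_vector.span M)) = ortho M"
proof
  show "ortho (closure (complex_vector.span M)) \<subseteq> ortho M"
    using closure_span_superset[of M] by (auto simp: ortho_def)
  have "M \<subseteq> ortho (ortho M)" by (auto simp: ortho_def cinner_zero_commute)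
  then have "closure (complex_vector.span M) \<subseteq> ortho (ortho M)"
    by (intro closure_span_minimal closed_subspace_ortho)
  then show "ortho M \<subseteq> ortho (closure (complex_vector.span M))"
    unfolding ortho_def using cinner_zero_commute by blast
qed

text \<open>A minimising sequence is Cauchy by the parallelogram law, and its limit leaves a residual
  that cannot be shortened, hence is orthogonal to the subspace.\<close>

lemma orthogonal_decomposition:
  fixes M :: "'a::complex_hilbert set"
  assumes M: "closed_subspace M"
  shows "\<exists>y\<in>M. x - y \<in> ortho M"
proof -
  define d where "d = (INF y\<in>M. (norm (x - y))\<^sup>2)"
  have ne: "M \<noteq> {}" using closed_subspaceD(1)[OF M] by auto
  have bdd: "bdd_below ((\<lambda>y. (norm (x - y))\<^sup>2) ` M)" by (rule bdd_belowI[of _ 0]) auto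
  have dle: "d \<le> (norm (x - y))\<^sup>2" if "y \<in> M" for y
    unfolding d_def by (rule cINF_lower[OF bdd that])
  have "\<exists>y\<in>M. (norm (x - y))\<^sup>2 < d + inverse (real (Suc n))" for n
  proof -
    have "(INF y\<in>M. (norm (x - y))\<^sup>2) < d + inverse (real (Suc n))" by (simp add: d_def)
    then show ?thesis by (simp only: cINF_less_iff[OF ne bdd])
  qed
  then have "\<forall>n. \<exists>y. y \<in> M \<and> (norm (x - y))\<^sup>2 < d + inverse (real (Suc n))" by blast
  from choice[OF this] obtain f where fM: "\<And>n. f n \<in> M"
    and f: "\<And>n. (norm (x - f n))\<^sup>2 < d + inverse (real (Suc n))" by auto
  have par: "(norm (f m - f n))\<^sup>2 \<le> 2 * inverse (real (Suc m)) + 2 * inverse (real (Suc n))" for m n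
  proof -
    have "(1/2) *\<^sub>R (f m + f n) \<in> M"
      by (intro closed_subspaceD(5)[OF M] closed_subspaceD(2)[OF M] fM)
    then have "d \<le> (norm (x - (1/2) *\<^sub>R (f m + f n)))\<^sup>2" by (rule dle)
    also have "x - (1/2) *\<^sub>R (f m + f n) = (1/2) *\<^sub>R ((x - f m) + (x - f n))"
      by (simp add: scaleR_add_right scaleR_diff_right flip: scaleR_add_left)
    finally have "4 * d \<le> (norm ((x - f m) + (x - f n)))\<^sup>2"
      by (simp add: power_mult_distrib power_divide)
    moreover have "(norm ((x - f n) - (x - f m)))\<^sup>2 + (norm ((x - f m) + (x - f n)))\<^sup>2
        = 2 * (norm (x - f m))\<^sup>2 + 2 * (norm (x - f n))\<^sup>2"
      unfolding norm_add_squared norm_diff_squared[of "x - f n"] cinner_commute[of "x - f n"] by simp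
    ultimately show ?thesis using f[of m] f[of n] by simp
  qed
  have "Cauchy f"
  proof (rule metric_CauchyI)
    fix e :: real assume e: "e > 0"
    obtain N where N: "inverse (real (Suc N)) < e\<^sup>2 / 4" using reals_Archimedean[of "e\<^sup>2/4"] e by auto
    have "dist (f m) (f n) < e" if "m \<ge> N" "n \<ge> N" for m n
    proof -
      have "inverse (real (Suc m)) \<le> inverse (real (Suc N))" "inverse (real (Suc n)) \<le> inverse (real (Suc N))"
        using that by (simp_all add: le_imp_inverse_le)
      then have "(norm (f m - f n))\<^sup>2 < e\<^sup>2" using par[of m n] N by linarith
      then show ?thesis using e by (simp add: dist_norm power_less_imp_less_base)
    qed
    then show "\<exists>N. \<forall>m\<ge>N. \<forall>n\<ge>N. dist (f m) (f n) < e" by (intro exI[of _ N] allI impI)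
  qed
  then have "convergent f" by (rule Cauchy_convergent)
  then obtain y where y: "f \<longlonglongrightarrow> y" by (auto simp: convergent_def)
  have yM: "y \<in> M"
    using M fM y closed_sequentially[of M f y] by (auto simp: closed_subspace_def)
  have "(\<lambda>n. (norm (x - f n))\<^sup>2) \<longlonglongrightarrow> (norm (x - y))\<^sup>2"
    by (intro tendsto_intros y)
  moreover have "(\<lambda>n. d + inverse (real (Suc n))) \<longlonglongrightarrow> d + 0"
    by (intro tendsto_add tendsto_const LIMSEQ_inverse_real_of_nat)
  ultimately have yd: "(norm (x - y))\<^sup>2 \<le> d + 0"
    by (rule LIMSEQ_le) (auto intro!: exI[of _ 0] less_imp_le[OF f] simp del: of_nat_Suc)
  have "cinner (x - y) z = 0" if z: "z \<in> M" for z
  proof (cases "z = 0")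
    case False
    define c where "c = cinner (x - y) z / of_real ((norm z)\<^sup>2)"
    define r where "r = (cmod (cinner (x - y) z))\<^sup>2"
    have "y + c *\<^sub>C z \<in> M" by (intro closed_subspaceD(2,3)[OF M] yM z)
    then have "d \<le> (norm (x - (y + c *\<^sub>C z)))\<^sup>2" by (rule dle)
    also have "x - (y + c *\<^sub>C z) = (x - y) - c *\<^sub>C z" by (rule diff_diff_eq[symmetric])
    also have "(norm \<dots>)\<^sup>2 = (norm (x - y))\<^sup>2 - r / (norm z)\<^sup>2"
      unfolding c_def r_def by (rule norm_minus_component[OF False])
    finally have "r / (norm z)\<^sup>2 \<le> 0" using yd by linarith
    then have "r \<le> 0" using False by (simp add: divide_le_0_iff not_le)
    then show ?thesis by (simp add: r_def)
  qed simp
  then have "x - y \<in> ortho M" by (simp add: ortho_def)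
  with yM show ?thesis by (rule rev_bexI)
qed

subsection \<open>Bounded operators\<close>

lemma bop_UNIV: "T \<in> bop UNIV UNIV \<longleftrightarrow>
    (\<forall>x y. T (x + y) = T x + T y) \<and> (\<forall>c x. T (c *\<^sub>C x) = c *\<^sub>C T x) \<and>
    (\<exists>B. \<forall>x. norm (T x) \<le> B * norm x)"
  by (simp add: bop_def)

lemma bopD:
  assumes "T \<in> bop K L"
  shows "x \<in> K \<Longrightarrow> T x \<in> L" "x \<in> K \<Longrightarrow> y \<in> K \<Longrightarrow> T (x + y) = T x + T y"
    "x \<in> K \<Longrightarrow> T (c *\<^sub>C x) = c *\<^sub>C T x" "x \<notin> K \<Longrightarrow> T x = undefined"
  using assms PiE_arb[of T K "\<lambda>_. L" x] unfolding bop_def by auto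

lemma bop_ext:
  assumes "S \<in> bop K L" "T \<in> bop K L'" "\<And>x. x \<in> K \<Longrightarrow> S x = T x"
  shows "S = T"
proof
  show "S x = T x" for x
    using assms(3) bopD(4)[OF assms(1)] bopD(4)[OF assms(2)] by (cases "x \<in> K") auto
qed

lemma bop_bounded_linear:
  assumes "T \<in> bop UNIV UNIV"
  shows "bounded_linear T"
proof -
  obtain B where "\<forall>x. norm (T x) \<le> B * norm x" using assms unfolding bop_UNIV by blast
  then show ?thesis
    using assms unfolding bop_UNIV
    by (intro bounded_linear_intro[of _ B]) (simp_all add: scaleR_scaleC mult.commute)
qed

lemma bop_UNIV_I:
  assumes "bounded_linear T" "\<And>c x. T (c *\<^sub>C x) = c *\<^sub>C T x"
  shows "T \<in> bop UNIV UNIV"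
  using bounded_linear.bounded[OF assms(1)] linear_add[OF bounded_linear.linear[OF assms(1)]] assms(2)
  unfolding bop_UNIV by (simp add: mult.commute)

lemma bop_algebra:
  assumes "T \<in> bop UNIV UNIV"
  shows "T 0 = 0" "T (x + y) = T x + T y" "T (x - y) = T x - T y" "T (c *\<^sub>C x) = c *\<^sub>C T x"
    "T (r *\<^sub>R x) = r *\<^sub>R T x" "T (- x) = - T x"
proof -
  note l = bounded_linear.linear[OF bop_bounded_linear[OF assms]]
  show "T 0 = 0" "T (x + y) = T x + T y" "T (x - y) = T x - T y" "T (r *\<^sub>R x) = r *\<^sub>R T x" "T (- x) = - T x"
    by (rule linear_0[OF l] linear_add[OF l] linear_diff[OF l] linear_scale[OF l] linear_neg[OF l])+
  show "T (c *\<^sub>C x) = c *\<^sub>C T x" using assms unfolding bop_UNIV by blast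
qed

lemma bop_id: "(\<lambda>x. x) \<in> bop UNIV UNIV"
  by (rule bop_UNIV_I) auto

lemma bop_zero: "(\<lambda>_. 0) \<in> bop UNIV UNIV"
  by (rule bop_UNIV_I) auto

lemma bop_comp:
  assumes S: "S \<in> bop UNIV UNIV" and T: "T \<in> bop UNIV UNIV"
  shows "(\<lambda>x. S (T x)) \<in> bop UNIV UNIV"
  by (rule bop_UNIV_I)
    (simp_all add: bounded_linear_compose[OF bop_bounded_linear[OF S] bop_bounded_linear[OF T]]
      bop_algebra[OF S] bop_algebra[OF T])

lemma bop_add:
  assumes S: "S \<in> bop UNIV UNIV" and T: "T \<in> bop UNIV UNIV"
  shows "(\<lambda>x. S x + T x) \<in> bop UNIV UNIV"
  by (rule bop_UNIV_I)
    (simp_all add: bounded_linear_add[OF bop_bounded_linear[OF S] bop_bounded_linear[OF T]]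
      bop_algebra[OF S] bop_algebra[OF T] scaleC_add_right)

lemma bop_scaleC:
  assumes T: "T \<in> bop UNIV UNIV"
  shows "(\<lambda>x. a *\<^sub>C T x) \<in> bop UNIV UNIV"
  by (rule bop_UNIV_I)
    (simp_all add: bounded_linear_compose[OF bounded_linear_scaleC bop_bounded_linear[OF T]]
      bop_algebra[OF T] scaleC_scaleC mult.commute)

lemma bop_diff:
  assumes S: "S \<in> bop UNIV UNIV" and T: "T \<in> bop UNIV UNIV"
  shows "(\<lambda>x. S x - T x) \<in> bop UNIV UNIV"
  using bop_add[OF S bop_scaleC[OF T, of "-1"]] by (simp add: scaleC_minus_one)

lemma closed_subspace_eq_set:
  assumes "S \<in> bop UNIV UNIV" "T \<in> bop UNIV UNIV"
  shows "closed_subspace {x. S x = T x}"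
proof -
  have "closed {x. S x = T x}"
    by (intro closed_Collect_eq bounded_linear.continuous_on[OF bop_bounded_linear[OF assms(1)]]
        bounded_linear.continuous_on[OF bop_bounded_linear[OF assms(2)]] continuous_on_id)
  then show ?thesis
    unfolding closed_subspace_def complex_vector.subspace_def
    by (simp add: bop_algebra[OF assms(1)] bop_algebra[OF assms(2)])
qed

lemma closed_subspace_vimage:
  assumes T: "T \<in> bop UNIV UNIV" and M: "closed_subspace M"
  shows "closed_subspace {x. T x \<in> M}"
proof -
  have "closed (T -` M)"
    using M bounded_linear.continuous_on[OF bop_bounded_linear[OF T] continuous_on_id]
    unfolding closed_subspace_def by (intro closed_vimage) auto
  then show ?thesis
    using M unfolding closed_subspace_def complex_vector.subspace_def
    by (simp add: bop_algebra[OF T] vimage_def)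
qed

subsection \<open>The projection onto a closed subspace\<close>

lemma projD:
  assumes "P \<in> projections UNIV"
  shows "P \<in> bop UNIV UNIV" "P (P x) = P x" "cinner (P x) y = cinner x (P y)"
  using assms by (simp_all add: projections_def)

lemma in_range_proj: "P \<in> projections UNIV \<Longrightarrow> x \<in> range P \<longleftrightarrow> P x = x"
  by (metis projD(2) rangeE rangeI)

lemma closed_subspace_range:
  assumes "P \<in> projections UNIV"
  shows "closed_subspace (range P)"
proof -
  have "range P = {x. P x = x}" using in_range_proj[OF assms] by auto
  then show ?thesis using closed_subspace_eq_set[OF projD(1)[OF assms] bop_id] by simp
qed

lemma perp_projection:
  assumes P: "P \<in> projections UNIV"
  shows "perp P \<in> projections UNIV"
  using bop_diff[OF bop_id projD(1)[OF P]]
  by (simp add: projections_def perp_def bop_algebra[OF projD(1)[OF P]] projD(2,3)[OF P] cinner_algebra)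

lemma perp_perp [simp]: "perp (perp P) = P"
  by (simp add: perp_def)

lemma in_range_perp: "P \<in> projections UNIV \<Longrightarrow> x \<in> range (perp P) \<longleftrightarrow> P x = 0"
  using in_range_proj[OF perp_projection] by (simp add: perp_def)

lemma range_perp:
  assumes P: "P \<in> projections UNIV"
  shows "range (perp P) = ortho (range P)"
proof (intro equalityI subsetI)
  fix x
  show "x \<in> ortho (range P)" if "x \<in> range (perp P)"
  proof -
    have "P x = 0" using that in_range_perp[OF P] by blast
    then show ?thesis by (simp add: ortho_def projD(3)[OF P, symmetric])
  qed
  assume "x \<in> ortho (range P)"
  then have "cinner (P x) y = 0" for y by (simp add: ortho_def projD(3)[OF P])
  then have "P x = 0" using cinner_eq_zero_iff by blast
  then show "x \<in> range (perp P)" using in_range_perp[OF P] by blast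
qed

lemma perp_in_ortho: "P \<in> projections UNIV \<Longrightarrow> perp P x \<in> ortho (range P)"
  by (subst range_perp[symmetric]) simp_all

text \<open>A projection is determined by its range, so that equalities of projections may be proved as
  equalities of closed subspaces.\<close>

lemma proj_cong:
  assumes P: "P \<in> projections UNIV" and Q: "Q \<in> projections UNIV" and eq: "range P = range Q"
  shows "P = Q"
proof
  fix x
  have "P (Q x) = Q x" using eq in_range_proj[OF P] by blast
  moreover have "P (perp Q x) = 0"
    using eq in_range_perp[OF P] range_perp[OF P] range_perp[OF Q] by auto
  ultimately show "P x = Q x" by (simp add: perp_def bop_algebra[OF projD(1)[OF P]])
qed

lemma projection_theorem:
  assumes M: "closed_subspace M"
  shows "\<exists>P\<in>projections UNIV. range P = M"
proof -
  have "\<forall>x. \<exists>y. y \<in> M \<and> x - y \<in> ortho M" using orthogonal_decomposition[OF M] by blast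
  from choice[OF this] obtain P where P: "\<And>x. P x \<in> M" "\<And>x. x - P x \<in> ortho M" by auto
  have uniq: "P x = y" if "y \<in> M" "x - y \<in> ortho M" for x y
  proof -
    have "P x - y \<in> M" by (intro closed_subspaceD(4)[OF M] P that)
    moreover have "P x - y \<in> ortho M"
    proof -
      have "(x - y) - (x - P x) \<in> ortho M" by (intro closed_subspaceD(4)[OF closed_subspace_ortho] P that)
      then show ?thesis by simp
    qed
    ultimately have "cinner (P x - y) (P x - y) = 0" by (auto simp: ortho_def)
    then show ?thesis by simp
  qed
  have add: "P (x + y) = P x + P y" for x y
  proof (rule uniq)
    show "P x + P y \<in> M" by (intro closed_subspaceD(2)[OF M] P)
    have "(x - P x) + (y - P y) \<in> ortho M" by (intro closed_subspaceD(2)[OF closed_subspace_ortho] P)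
    then show "x + y - (P x + P y) \<in> ortho M" by (simp add: algebra_simps)
  qed
  have scale: "P (c *\<^sub>C x) = c *\<^sub>C P x" for c x
  proof (rule uniq)
    show "c *\<^sub>C P x \<in> M" by (intro closed_subspaceD(3)[OF M] P)
    have "c *\<^sub>C (x - P x) \<in> ortho M" by (intro closed_subspaceD(3)[OF closed_subspace_ortho] P)
    then show "c *\<^sub>C x - c *\<^sub>C P x \<in> ortho M" by (simp add: complex_vector.scale_right_diff_distrib)
  qed
  have idem: "P y = y" if "y \<in> M" for y
    using that closed_subspaceD(1)[OF closed_subspace_ortho] by (intro uniq) auto
  have orth: "cinner (P x) (y - P y) = 0" "cinner (x - P x) (P y) = 0" for x y
    using P[of x] P[of y] by (auto simp: ortho_def cinner_zero_commute)
  have sa: "cinner (P x) y = cinner x (P y)" for x y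
    using orth[of x y] by (simp add: cinner_algebra)
  have "norm (P x) \<le> 1 * norm x" for x
  proof -
    have "(norm (P x + (x - P x)))\<^sup>2 = (norm (P x))\<^sup>2 + (norm (x - P x))\<^sup>2"
      unfolding norm_add_squared using orth by simp
    then have "(norm (P x))\<^sup>2 \<le> (norm x)\<^sup>2" by simp
    then show ?thesis by (simp add: power2_le_iff_abs_le)
  qed
  then have "P \<in> bop UNIV UNIV" unfolding bop_UNIV using add scale by blast
  moreover have "range P = M"
  proof
    show "range P \<subseteq> M" using P by auto
    show "M \<subseteq> range P" using idem by (metis rangeI subsetI)
  qed
  ultimately show ?thesis using sa idem[OF P(1)] by (intro bexI[of _ P]) (simp_all add: projections_def)
qed

lemma proj_onto:
  assumes "closed_subspace M"
  shows "proj_onto M \<in> projections UNIV" "range (proj_onto M) = M"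
proof -
  have "\<exists>!P. P \<in> projections UNIV \<and> range P = M"
  proof (rule ex_ex1I)
    show "\<exists>P. P \<in> projections UNIV \<and> range P = M" using projection_theorem[OF assms] by blast
  qed (simp add: proj_cong)
  from theI'[OF this] show "proj_onto M \<in> projections UNIV" "range (proj_onto M) = M"
    unfolding proj_onto_def by blast+
qed

lemma norm_proj_le:
  assumes "P \<in> projections UNIV"
  shows "norm (P x) \<le> norm x"
proof -
  have "cinner (P x) (perp P x) = 0"
    by (simp add: perp_def cinner_algebra projD(2,3)[OF assms])
  then have "(norm (P x + perp P x))\<^sup>2 = (norm (P x))\<^sup>2 + (norm (perp P x))\<^sup>2"
    unfolding norm_add_squared by simp
  then have "(norm (P x))\<^sup>2 \<le> (norm x)\<^sup>2" by (simp add: perp_def)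
  then show ?thesis by (simp add: power2_le_iff_abs_le)
qed

subsection \<open>Adjoints\<close>

text \<open>A vector orthogonal to the kernel of a nonzero functional represents it up to a scalar,
  because the kernel has codimension one.\<close>

lemma riesz_representation:
  fixes f :: "'a::complex_hilbert \<Rightarrow> complex"
  assumes f: "f \<in> bop UNIV UNIV"
  shows "\<exists>z. \<forall>x. f x = cinner x z"
proof (cases "\<forall>x. f x = 0")
  case False
  then obtain u where u: "f u \<noteq> 0" by blast
  let ?M = "{x. f x = 0}"
  have M: "closed_subspace ?M" using closed_subspace_eq_set[OF f bop_zero] .
  obtain y where y: "f y = 0" "u - y \<in> ortho ?M" using orthogonal_decomposition[OF M, of u] by auto
  define w where "w = u - y"
  have fw: "f w \<noteq> 0" using u y by (simp add: w_def bop_algebra[OF f])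
  have w0: "w \<noteq> 0" using fw bop_algebra(1)[OF f] by auto
  have "f x = cinner x ((cnj (f w) / of_real ((norm w)\<^sup>2)) *\<^sub>C w)" for x
  proof -
    have "f (x - (f x / f w) *\<^sub>C w) = 0" using fw by (simp add: bop_algebra[OF f] scaleC_complex_def)
    then have "cinner (x - (f x / f w) *\<^sub>C w) w = 0"
      using y by (auto simp: ortho_def w_def cinner_zero_commute)
    then have "cinner x w = f x / f w * of_real ((norm w)\<^sup>2)"
      by (simp add: cinner_algebra cinner_self[of w])
    then show ?thesis using fw w0 by (simp add: cinner_scaleC_right field_simps)
  qed
  then show ?thesis by blast
qed (auto intro: exI[of _ 0])

lemma adjoint_exists:
  fixes T :: "'a::complex_hilbert \<Rightarrow> 'b::complex_hilbert"
  assumes T: "T \<in> bop UNIV UNIV"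
  shows "\<exists>S\<in>bop UNIV UNIV. \<forall>x y. cinner (T x) y = cinner x (S y)"
proof -
  obtain B where B: "\<And>x. norm (T x) \<le> B * norm x" using T unfolding bop_UNIV by blast
  have B0: "norm (T x) \<le> \<bar>B\<bar> * norm x" for x
    by (rule order_trans[OF B]) (simp add: mult_right_mono)
  have "\<exists>z. \<forall>x. cinner (T x) y = cinner x z" for y
  proof (rule riesz_representation)
    have "bounded_linear (\<lambda>x. cinner (T x) y)"
      by (rule bounded_linear_compose[OF bounded_bilinear.bounded_linear_left[OF bounded_bilinear_cinner]
            bop_bounded_linear[OF T]])
    then show "(\<lambda>x. cinner (T x) y) \<in> bop UNIV UNIV"
      by (rule bop_UNIV_I) (simp add: bop_algebra[OF T] cinner_algebra scaleC_complex_def)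
  qed
  then obtain S where S: "\<And>x y. cinner (T x) y = cinner x (S y)" by metis
  have S': "cinner (S y) z = cnj (cinner (T z) y)" for y z
    by (simp only: S cinner_commute[of "S y" z])
  have 1: "S (x + y) = S x + S y" for x y
    by (rule cinner_eqI) (simp add: S' cinner_add_left cinner_add_right)
  have 2: "S (c *\<^sub>C x) = c *\<^sub>C S x" for c x
    by (rule cinner_eqI) (simp add: S' cinner_scaleC_left cinner_scaleC_right)
  have "norm (S y) \<le> \<bar>B\<bar> * norm y" for y
  proof (cases "S y = 0")
    case False
    have "(norm (S y))\<^sup>2 = cmod (cinner (T (S y)) y)" by (simp add: S cinner_self norm_power)
    also have "\<dots> \<le> norm (T (S y)) * norm y" by (rule norm_cinner_le)
    also have "\<dots> \<le> (\<bar>B\<bar> * norm (S y)) * norm y" by (intro mult_right_mono B0) simp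
    finally have "norm (S y) * norm (S y) \<le> norm (S y) * (\<bar>B\<bar> * norm y)"
      by (simp add: power2_eq_square mult_ac)
    then show ?thesis using False by simp
  qed simp
  then have "S \<in> bop UNIV UNIV" using 1 2 by (auto simp: bop_UNIV)
  then show ?thesis using S by blast
qed

lemma adj_eqI:
  assumes S: "S \<in> bop L K" and ad: "\<And>x y. x \<in> K \<Longrightarrow> y \<in> L \<Longrightarrow> cinner (T x) y = cinner x (S y)"
    and K: "closed_subspace K"
  shows "adj K L T = S"
  unfolding adj_def
proof (rule the_equality)
  show "S \<in> bop L K \<and> (\<forall>x\<in>K. \<forall>y\<in>L. cinner (T x) y = cinner x (S y))" using S ad by blast
  fix R assume R: "R \<in> bop L K \<and> (\<forall>x\<in>K. \<forall>y\<in>L. cinner (T x) y = cinner x (R y))"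
  have "R y = S y" if y: "y \<in> L" for y
  proof -
    have "R y - S y \<in> K" using R S y closed_subspaceD(4)[OF K] bopD(1) by metis
    then have "cinner (R y - S y) (R y - S y) = 0"
      using R ad[OF _ y] y by (simp add: cinner_diff_right)
    then show ?thesis by simp
  qed
  then show "R = S" using R S by (intro bop_ext) auto
qed

lemma adjoint_op:
  assumes "T \<in> bop UNIV UNIV"
  shows "adjoint_op T \<in> bop UNIV UNIV" "cinner (T x) y = cinner x (adjoint_op T y)"
    "cinner (adjoint_op T y) x = cinner y (T x)"
proof -
  obtain S where S: "S \<in> bop UNIV UNIV" "\<And>x y. cinner (T x) y = cinner x (S y)"
    using adjoint_exists[OF assms] by blast
  have "adjoint_op T = S" using S by (intro adj_eqI closed_subspace_UNIV) auto
  then show "adjoint_op T \<in> bop UNIV UNIV" "cinner (T x) y = cinner x (adjoint_op T y)" using S by auto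
  then show "cinner (adjoint_op T y) x = cinner y (T x)"
    unfolding cinner_commute[of "adjoint_op T y" x] cinner_commute[of y "T x"] by simp
qed

lemma ortho_iff: "x \<in> ortho M \<longleftrightarrow> (\<forall>y\<in>M. cinner x y = 0)"
  by (simp add: ortho_def)

text \<open>The subspace is reducing: its orthogonal complement is invariant under \<open>T\<close>, because the subspace
  itself is invariant under the adjoint \<open>S\<close>.\<close>

lemma commute_of_reducing:
  assumes P: "P \<in> projections UNIV" and T: "T \<in> bop UNIV UNIV"
    and ad: "\<And>x y. cinner (T x) y = cinner x (S y)"
    and inv: "\<And>x. x \<in> range P \<Longrightarrow> T x \<in> range P" "\<And>x. x \<in> range P \<Longrightarrow> S x \<in> range P"
  shows "T (P x) = P (T x)"
proof -
  have "T (perp P x) \<in> ortho (range P)"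
    unfolding ortho_iff ad
  proof
    fix y assume "y \<in> range P"
    then have "S y \<in> range P" by (rule inv(2))
    then show "cinner (perp P x) (S y) = 0"
      by (rule bspec[OF perp_in_ortho[OF P, unfolded ortho_iff]])
  qed
  then have "P (T (perp P x)) = 0" by (simp only: range_perp[OF P, symmetric] in_range_perp[OF P])
  then have "P (T x - T (P x)) = 0" by (simp only: perp_def bop_algebra(3)[OF T])
  moreover have "P (T (P x)) = T (P x)"
    using in_range_proj[OF P, of "T (P x)"] inv(1)[of "P x"] by simp
  ultimately show ?thesis by (simp add: bop_algebra(3)[OF projD(1)[OF P]])
qed

section \<open>Commutants are generated by their projections\<close>

text \<open>The scalar case of the iteration below, with \<open>a = 1\<close>; it increases to its fixed point \<open>1\<close>.\<close>

lemma sqrt_majorant_convergent: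
  fixes y :: "nat \<Rightarrow> real"
  assumes y0: "y 0 = 0" and y_Suc: "\<And>n. y (Suc n) = (1 + (y n)\<^sup>2) / 2"
  shows "Cauchy y" "0 \<le> y n" "y n \<le> 1"
proof -
  have b: "0 \<le> y n \<and> y n \<le> 1" for n
  proof (induction n)
    case (Suc n)
    then have "(y n)\<^sup>2 \<le> 1" by (simp add: power_le_one)
    then show ?case by (simp add: y_Suc)
  qed (simp add: y0)
  then show "0 \<le> y n" "y n \<le> 1" by blast+
  have "y n \<le> y (Suc n)" for n
  proof -
    have "0 \<le> (1 - y n)\<^sup>2" by simp
    then show ?thesis by (simp add: y_Suc power2_eq_square algebra_simps)
  qed
  then have "incseq y" by (simp add: incseq_Suc_iff)
  moreover have "\<forall>n. y n \<le> 1" using b by blast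
  ultimately obtain l where "y \<longlonglongrightarrow> l" by (rule incseq_convergent)
  then have "convergent y" by (auto simp: convergent_def)
  then show "Cauchy y" by (rule convergent_Cauchy)
qed

lemma blinfun_ext_iff: "f = g \<longleftrightarrow> (\<forall>x. blinfun_apply f x = blinfun_apply g x)"
  using blinfun_eqI by blast

text \<open>If \<open>W = (a + W\<^sup>2) / 2\<close> then \<open>(1 - W)\<^sup>2 = 1 - a\<close>, so the fixed point gives a square root.  All iterates
  are polynomials in \<open>a\<close> with nonnegative coefficients and therefore commute; consecutive differences
  are dominated in norm by those of the scalar iteration for \<open>a = 1\<close>, which makes the operator
  iteration Cauchy.  The last conjunct says that every closed property that holds at \<open>0\<close> and is
  preserved by the iteration passes to \<open>W\<close>; it replaces the functional calculus.\<close>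

lemma sqrt_iteration_limit:
  fixes a :: "'a::banach \<Rightarrow>\<^sub>L 'a"
  assumes a: "norm a \<le> 1"
  shows "\<exists>W. (1/2) *\<^sub>R (a + (W o\<^sub>L W)) = W \<and> norm W \<le> 1 \<and>
    (\<forall>C. closed C \<longrightarrow> 0 \<in> C \<longrightarrow> (\<forall>Z\<in>C. (1/2) *\<^sub>R (a + (Z o\<^sub>L Z)) \<in> C) \<longrightarrow> W \<in> C)"
proof -
  define f where "f Z = (1/2) *\<^sub>R (a + (Z o\<^sub>L Z))" for Z :: "'a \<Rightarrow>\<^sub>L 'a"
  define Y where "Y n = (f ^^ n) 0" for n
  define y where "y n = ((\<lambda>r::real. (1 + r\<^sup>2) / 2) ^^ n) 0" for n
  have Y0: "Y 0 = 0" and Y_Suc: "\<And>n. Y (Suc n) = f (Y n)" by (simp_all add: Y_def)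
  have y0: "y 0 = 0" and y_Suc: "\<And>n. y (Suc n) = (1 + (y n)\<^sup>2) / 2" by (simp_all add: y_def)
  note y = sqrt_majorant_convergent[of y, OF y0 y_Suc]
  have acomm: "a o\<^sub>L Y n = Y n o\<^sub>L a" for n
    by (induction n) (auto simp: Y0 Y_Suc f_def blinfun_ext_iff blinfun.bilinear_simps)
  have comm: "Y m o\<^sub>L Y n = Y n o\<^sub>L Y m" for m n
    using acomm[of m]
    by (induction n) (auto simp: Y0 Y_Suc f_def blinfun_ext_iff blinfun.bilinear_simps)
  have nY: "norm (Y n) \<le> y n" for n
  proof (induction n)
    case (Suc n)
    have "norm (Y n o\<^sub>L Y n) \<le> norm (Y n) * norm (Y n)" by (rule norm_blinfun_compose)
    also have "\<dots> \<le> y n * y n" by (intro mult_mono Suc) (simp_all add: y)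
    finally have "norm (a + (Y n o\<^sub>L Y n)) \<le> 1 + y n * y n" using a norm_triangle_mono by blast
    then show ?case by (simp add: Y_Suc f_def y_Suc power2_eq_square)
  qed (simp add: Y0 y0)
  have step: "norm (Y (Suc n) - Y n) \<le> y (Suc n) - y n" for n
  proof (induction n)
    case 0
    then show ?case using a by (simp add: Y0 Y_Suc y0 y_Suc f_def)
  next
    case (Suc n)
    have "Y (Suc (Suc n)) - Y (Suc n) = (1/2) *\<^sub>R ((Y (Suc n) + Y n) o\<^sub>L (Y (Suc n) - Y n))"
    proof -
      have "Y (Suc (Suc n)) - Y (Suc n) = f (Y (Suc n)) - f (Y n)" by (simp only: Y_Suc)
      also have "\<dots> = (1/2) *\<^sub>R ((Y (Suc n) + Y n) o\<^sub>L (Y (Suc n) - Y n))"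
        using comm[of "Suc n" n]
        by (simp add: f_def blinfun_ext_iff blinfun.bilinear_simps flip: scaleR_right_diff_distrib)
      finally show ?thesis .
    qed
    then have "norm (Y (Suc (Suc n)) - Y (Suc n)) = 1/2 * norm ((Y (Suc n) + Y n) o\<^sub>L (Y (Suc n) - Y n))"
      by simp
    also have "\<dots> \<le> 1/2 * (norm (Y (Suc n) + Y n) * norm (Y (Suc n) - Y n))"
      by (intro mult_left_mono norm_blinfun_compose) simp
    also have "\<dots> \<le> 1/2 * ((y (Suc n) + y n) * (y (Suc n) - y n))"
      by (intro mult_left_mono mult_mono norm_triangle_mono nY Suc) (simp_all add: y)
    also have "\<dots> = y (Suc (Suc n)) - y (Suc n)"
      by (simp only: y_Suc) (simp add: field_simps power2_eq_square)
    finally show ?case .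
  qed
  have diff: "norm (Y (n + k) - Y n) \<le> y (n + k) - y n" for n k
  proof (induction k)
    case (Suc k)
    then show ?case using step[of "n + k"] norm_triangle_ineq[of "Y (Suc (n + k)) - Y (n + k)" "Y (n + k) - Y n"]
      by simp
  qed simp
  have "Cauchy Y"
  proof (rule metric_CauchyI)
    fix e :: real assume "e > 0"
    then obtain N where N: "\<And>m n. m \<ge> N \<Longrightarrow> n \<ge> N \<Longrightarrow> dist (y m) (y n) < e"
      using metric_CauchyD[OF y(1)] by blast
    have *: "dist (Y (n + k)) (Y n) < e" if "n \<ge> N" for n k
      using diff[of n k] N[of "n + k" n] that by (simp add: dist_norm)
    have "dist (Y m) (Y n) < e" if "m \<ge> N" "n \<ge> N" for m n
    proof (cases "m \<le> n")
      case True
      then show ?thesis using *[of m "n - m"] that by (simp add: dist_commute)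
    next
      case False
      then show ?thesis using *[of n "m - n"] that by simp
    qed
    then show "\<exists>N. \<forall>m\<ge>N. \<forall>n\<ge>N. dist (Y m) (Y n) < e" by (intro exI[of _ N] allI impI)
  qed
  then have "convergent Y" by (rule Cauchy_convergent)
  then obtain W where W: "Y \<longlonglongrightarrow> W" by (auto simp: convergent_def)
  have "(\<lambda>n. f (Y n)) \<longlonglongrightarrow> f W"
    unfolding f_def by (intro tendsto_intros bounded_bilinear.tendsto[OF bounded_bilinear_blinfun_compose] W)
  moreover have "(\<lambda>n. f (Y n)) \<longlonglongrightarrow> W" using LIMSEQ_Suc[OF W] by (simp add: Y_Suc)
  ultimately have "f W = W" by (rule LIMSEQ_unique)
  moreover have "norm W \<le> 1"
    by (rule LIMSEQ_le_const2[OF tendsto_norm[OF W]]) (meson nY order_trans y(3))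
  moreover have "W \<in> C" if "closed C" "0 \<in> C" "\<forall>Z\<in>C. f Z \<in> C" for C
  proof -
    have "Y n \<in> C" for n by (induction n) (use that in \<open>simp_all add: Y0 Y_Suc\<close>)
    then show ?thesis using closed_sequentially[OF that(1) _ W] by blast
  qed
  ultimately show ?thesis unfolding f_def by blast
qed

text \<open>The operator \<open>S\<close> is the absolute value of the self-adjoint contraction \<open>T\<close>: the iteration is run
  with \<open>a = 1 - T\<^sup>2\<close>, and \<open>S = 1 - W\<close> is positive because \<open>W\<close> is a contraction.  Commutation is stated for
  real-linear \<open>B\<close>, so that taking \<open>B\<close> to be a complex scalar shows that \<open>S\<close> is complex linear.\<close>

lemma sqrt_of_square:
  fixes T :: "'a::complex_hilbert \<Rightarrow> 'a"
  assumes T: "T \<in> bop UNIV UNIV" and sa: "\<And>x y. cinner (T x) y = cinner x (T y)"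
    and contr: "\<And>x. norm (T x) \<le> norm x"
  obtains S where "bounded_linear S" "\<And>x y. cinner (S x) y = cinner x (S y)"
    "\<And>x. S (S x) = T (T x)" "\<And>x. 0 \<le> Re (cinner (S x) x)"
    "\<And>B x. bounded_linear B \<Longrightarrow> (\<And>x. B (T x) = T (B x)) \<Longrightarrow> B (S x) = S (B x)"
proof -
  have blA: "bounded_linear (\<lambda>x. x - T (T x))"
    by (rule bounded_linear_sub[OF bounded_linear_ident bop_bounded_linear[OF bop_comp[OF T T]]])
  define a where "a = Blinfun (\<lambda>x. x - T (T x))"
  have a: "blinfun_apply a x = x - T (T x)" for x
    unfolding a_def by (simp add: bounded_linear_Blinfun_apply[OF blA])
  have "norm (blinfun_apply a x) \<le> 1 * norm x" for x
  proof -
    have "cinner x (T (T x)) = cinner (T x) (T x)" by (simp only: sa)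
    then have "(norm (x - T (T x)))\<^sup>2 = (norm x)\<^sup>2 + (norm (T (T x)))\<^sup>2 - 2 * (norm (T x))\<^sup>2"
      unfolding norm_diff_squared by (simp add: cinner_self)
    also have "\<dots> \<le> (norm x)\<^sup>2"
      using power_mono[OF contr[of "T x"] norm_ge_zero, of 2] zero_le_power2[of "norm (T x)"] by linarith
    finally show ?thesis by (simp add: a power2_le_iff_abs_le)
  qed
  then have "norm a \<le> 1" by (intro norm_blinfun_bound) simp_all
  from sqrt_iteration_limit[OF this] obtain W where W: "(1/2) *\<^sub>R (a + (W o\<^sub>L W)) = W" "norm W \<le> 1"
    and inC: "\<And>C. closed C \<Longrightarrow> 0 \<in> C \<Longrightarrow> (\<forall>Z\<in>C. (1/2) *\<^sub>R (a + (Z o\<^sub>L Z)) \<in> C) \<Longrightarrow> W \<in> C"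
    by auto
  have Wcomm: "B (blinfun_apply W x) = blinfun_apply W (B x)"
    if B: "bounded_linear B" "\<And>x. B (T x) = T (B x)" for B x
  proof -
    note lin = bounded_linear.linear[OF B(1)]
    have "W \<in> {Z. \<forall>x. B (blinfun_apply Z x) = blinfun_apply Z (B x)}"
    proof (rule inC)
      have "closed {Z::'a \<Rightarrow>\<^sub>L 'a. B (blinfun_apply Z x) = blinfun_apply Z (B x)}" for x
        by (intro closed_Collect_eq bounded_linear.continuous_on[OF B(1)] continuous_intros)
      then show "closed {Z::'a \<Rightarrow>\<^sub>L 'a. \<forall>x. B (blinfun_apply Z x) = blinfun_apply Z (B x)}"
        by (rule closed_Collect_all)
    qed (auto simp: a blinfun.bilinear_simps linear_0[OF lin] linear_scale[OF lin] linear_add[OF lin]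
        linear_diff[OF lin] B(2))
    then show ?thesis by blast
  qed
  have Wsa: "cinner (blinfun_apply W x) y = cinner x (blinfun_apply W y)" for x y
  proof -
    have "W \<in> {Z. \<forall>x y. cinner (blinfun_apply Z x) y = cinner x (blinfun_apply Z y)}"
    proof (rule inC)
      have "closed {Z::'a \<Rightarrow>\<^sub>L 'a. cinner (blinfun_apply Z x) y = cinner x (blinfun_apply Z y)}" for x y
        by (intro closed_Collect_eq
            bounded_linear.continuous_on[OF bounded_bilinear.bounded_linear_left[OF bounded_bilinear_cinner]]
            bounded_linear.continuous_on[OF bounded_bilinear.bounded_linear_right[OF bounded_bilinear_cinner]]
            continuous_intros)
      then show "closed {Z::'a \<Rightarrow>\<^sub>L 'a. \<forall>x y. cinner (blinfun_apply Z x) y = cinner x (blinfun_apply Z y)}"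
        by (intro closed_Collect_all)
    qed (auto simp: a blinfun.bilinear_simps cinner_algebra sa)
    then show ?thesis by blast
  qed
  define S where "S x = x - blinfun_apply W x" for x
  show thesis
  proof
    show blS: "bounded_linear S"
      unfolding S_def by (rule bounded_linear_sub[OF bounded_linear_ident blinfun.bounded_linear_right])
    show "cinner (S x) y = cinner x (S y)" for x y by (simp add: S_def cinner_algebra Wsa)
    show "B (S x) = S (B x)" if B: "bounded_linear B" "\<And>x. B (T x) = T (B x)" for B x
      by (simp add: S_def linear_diff[OF bounded_linear.linear[OF B(1)]] Wcomm[OF B])
    show "S (S x) = T (T x)" for x
    proof -
      have "blinfun_apply W x = (1/2) *\<^sub>R (x - T (T x) + blinfun_apply W (blinfun_apply W x))"
        by (subst W(1)[symmetric]) (simp add: a blinfun.bilinear_simps)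
      moreover have "2 *\<^sub>R u = v" if "u = (1/2) *\<^sub>R v" for u v :: 'a using that by simp
      ultimately have "2 *\<^sub>R blinfun_apply W x = x - T (T x) + blinfun_apply W (blinfun_apply W x)" by blast
      then show ?thesis by (simp add: S_def blinfun.bilinear_simps scaleR_2 algebra_simps)
    qed
    show "0 \<le> Re (cinner (S x) x)" for x
    proof -
      have "Re (cinner (blinfun_apply W x) x) \<le> cmod (cinner (blinfun_apply W x) x)"
        by (rule complex_Re_le_cmod)
      also have "\<dots> \<le> norm (blinfun_apply W x) * norm x" by (rule norm_cinner_le)
      also have "\<dots> \<le> (1 * norm x) * norm x"
        by (intro mult_right_mono order_trans[OF norm_blinfun] W(2)) simp_all
      finally show ?thesis by (simp add: S_def cinner_diff_left cinner_self power2_eq_square)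
    qed
  qed
qed

text \<open>With \<open>S = \<bar>T\<bar>\<close>, let \<open>Q\<close> be the projection onto the kernel of \<open>S - T\<close>.  There \<open>T = S\<close>, and on the
  orthogonal complement \<open>T = - S\<close>, because \<open>S + T\<close> maps into the kernel of \<open>S - T\<close>.  Hence
  \<open>T = S (2 Q - 1)\<close>, and \<open>T - (2 Q - 1) / 2\<close> is \<open>S - 1/2\<close> composed with a reflection; its norm is at most
  \<open>1/2\<close> because \<open>0 \<le> S \<le> 1\<close>.\<close>

lemma near_half_reflection:
  fixes T :: "'a::complex_hilbert \<Rightarrow> 'a"
  assumes T: "T \<in> bop UNIV UNIV" and sa: "\<And>x y. cinner (T x) y = cinner x (T y)"
    and contr: "\<And>x. norm (T x) \<le> norm x"
  obtains Q where "Q \<in> projections UNIV"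
    "\<And>x. norm (T x - Q x + (1/2) *\<^sub>R x) \<le> 1/2 * norm x"
    "\<And>B x. B \<in> bop UNIV UNIV \<Longrightarrow> (\<And>x. B (T x) = T (B x)) \<Longrightarrow>
      (\<And>x. adjoint_op B (T x) = T (adjoint_op B x)) \<Longrightarrow> B (Q x) = Q (B x)"
proof -
  obtain S where S: "bounded_linear S" and Ssa: "\<And>x y. cinner (S x) y = cinner x (S y)"
    and SS: "\<And>x. S (S x) = T (T x)" and Spos: "\<And>x. 0 \<le> Re (cinner (S x) x)"
    and Scomm: "\<And>B x. bounded_linear B \<Longrightarrow> (\<And>x. B (T x) = T (B x)) \<Longrightarrow> B (S x) = S (B x)"
    using sqrt_of_square[OF T sa contr] by blast
  have Sb: "S \<in> bop UNIV UNIV"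
    using S by (rule bop_UNIV_I) (rule Scomm[OF bounded_linear_scaleC, symmetric], simp add: bop_algebra[OF T])
  note Salg = bop_algebra[OF Sb] and Talg = bop_algebra[OF T]
  have TS: "T (S x) = S (T x)" for x by (rule Scomm[OF bop_bounded_linear[OF T]]) simp
  have M: "closed_subspace {x. S x = T x}" by (rule closed_subspace_eq_set[OF Sb T])
  define Q where "Q = proj_onto {x. S x = T x}"
  have Q: "Q \<in> projections UNIV" and rQ: "range Q = {x. S x = T x}"
    unfolding Q_def by (rule proj_onto[OF M])+
  have onQ: "S (Q x) = T (Q x)" for x using rQ by blast
  have onperp: "T (perp Q x) = - S (perp Q x)" for x
  proof -
    have "S y + T y \<in> range Q" for y unfolding rQ by (simp add: Salg Talg TS SS add.commute)
    moreover have "perp Q x \<in> ortho (range Q)" by (rule perp_in_ortho[OF Q])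
    ultimately have "cinner (perp Q x) (S y + T y) = 0" for y unfolding ortho_def by blast
    then have "cinner (S (perp Q x) + T (perp Q x)) y = 0" for y
      by (simp add: cinner_algebra Ssa sa)
    then have "S (perp Q x) + T (perp Q x) = 0" using cinner_eq_zero_iff by blast
    then show ?thesis by (simp add: add_eq_0_iff)
  qed
  have Scontr: "norm (S x) \<le> norm x" for x
  proof -
    have "cinner (S x) (S x) = cinner (T x) (T x)" by (simp only: Ssa SS sa)
    then have "(norm (S x))\<^sup>2 = (norm (T x))\<^sup>2" unfolding cinner_self of_real_eq_iff .
    then show ?thesis using contr[of x] by (simp add: power2_eq_iff_nonneg)
  qed
  have sq_le: "(norm (S x))\<^sup>2 \<le> Re (cinner (S x) x)" for x
  proof -
    have "Re (cinner (S (S x)) (S x)) \<le> norm (S (S x)) * norm (S x)"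
      by (rule order_trans[OF complex_Re_le_cmod norm_cinner_le])
    also have "\<dots> \<le> norm (S x) * norm (S x)" by (intro mult_right_mono Scontr) simp
    finally have 1: "Re (cinner (S (S x)) (S x)) \<le> (norm (S x))\<^sup>2" by (simp add: power2_eq_square)
    have "cinner (S (x - S x)) (x - S x) =
        cinner (S x) x - cinner (S x) (S x) - cinner (S x) (S x) + cinner (S (S x)) (S x)"
      by (simp add: Salg cinner_algebra Ssa[of "S x" x])
    then have "Re (cinner (S (x - S x)) (x - S x)) =
        Re (cinner (S x) x) - 2 * (norm (S x))\<^sup>2 + Re (cinner (S (S x)) (S x))"
      by (simp add: cinner_self)
    then show ?thesis using Spos[of "x - S x"] 1 by linarith
  qed
  show thesis
  proof
    show "Q \<in> projections UNIV" by (rule Q)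
    show "norm (T x - Q x + (1/2) *\<^sub>R x) \<le> 1/2 * norm x" for x
    proof -
      \<comment> \<open>the reflection of \<open>x\<close>; it turns \<open>T\<close> into \<open>S\<close>\<close>
      define z where "z = Q x - perp Q x"
      have "T x = T (Q x) + T (perp Q x)" by (simp add: perp_def Talg)
      then have Tx: "T x = S z" unfolding onperp onQ[symmetric] by (simp add: z_def Salg)
      have half: "Q x - (1/2) *\<^sub>R x = (1/2) *\<^sub>R z"
      proof -
        have "Q x = (1/2) *\<^sub>R (Q x + Q x)" by simp
        then show ?thesis by (simp add: z_def perp_def scaleR_add_right scaleR_diff_right)
      qed
      have orth: "cinner (Q x) (perp Q x) = 0"
        by (simp add: perp_def cinner_algebra projD(2,3)[OF Q])
      have "(norm (Q x - perp Q x))\<^sup>2 = (norm (Q x + perp Q x))\<^sup>2"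
        unfolding norm_diff_squared norm_add_squared orth by simp
      then have nz: "norm z = norm x" by (simp add: z_def perp_def power2_eq_iff_nonneg)
      have "T x - Q x + (1/2) *\<^sub>R x = S z - (1/2) *\<^sub>R z" unfolding Tx half[symmetric] by simp
      also have "(norm \<dots>)\<^sup>2 = (norm (S z))\<^sup>2 - Re (cinner (S z) z) + (1/2 * norm z)\<^sup>2"
        unfolding norm_diff_squared by (simp add: cinner_scaleR_right)
      also have "\<dots> \<le> (1/2 * norm x)\<^sup>2" using sq_le[of z] by (simp add: nz)
      finally show ?thesis by (rule power2_le_imp_le) simp
    qed
    fix B x assume B: "B \<in> bop UNIV UNIV" "\<And>x. B (T x) = T (B x)"
      "\<And>x. adjoint_op B (T x) = T (adjoint_op B x)"
    show "B (Q x) = Q (B x)"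
    proof (rule commute_of_reducing[OF Q B(1) adjoint_op(2)[OF B(1)]])
      fix x assume "x \<in> range Q"
      then have x: "S x = T x" using rQ by blast
      have "S (B x) = B (S x)" by (rule Scomm[OF bop_bounded_linear[OF B(1)] B(2), symmetric])
      then show "B x \<in> range Q" unfolding rQ by (simp add: x B(2))
      have "S (adjoint_op B x) = adjoint_op B (S x)"
        by (rule Scomm[OF bop_bounded_linear[OF adjoint_op(1)[OF B(1)]] B(3), symmetric])
      then show "adjoint_op B x \<in> range Q" unfolding rQ by (simp add: x B(3))
    qed
  qed
qed

lemma commutant_UNIV:
  "A \<in> commutant UNIV X \<longleftrightarrow> A \<in> bop UNIV UNIV \<and> (\<forall>T\<in>X. \<forall>x. A (T x) = T (A x))"
  by (simp add: commutant_def)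

definition selfadjoint_set :: "('a::complex_hilbert \<Rightarrow> 'a) set \<Rightarrow> bool"
  where "selfadjoint_set X \<longleftrightarrow> X \<subseteq> bop UNIV UNIV \<and> (\<forall>T\<in>X. adjoint_op T \<in> X)"

lemma adjoint_commutant:
  assumes X: "selfadjoint_set X" and A: "A \<in> commutant UNIV X"
  shows "adjoint_op A \<in> commutant UNIV X"
proof -
  have Ab: "A \<in> bop UNIV UNIV" using A by (simp add: commutant_UNIV)
  have "adjoint_op A (T x) = T (adjoint_op A x)" if T: "T \<in> X" for T x
  proof (rule cinner_eqI)
    fix z
    have Tb: "T \<in> bop UNIV UNIV" and T': "adjoint_op T \<in> X" using X T by (auto simp: selfadjoint_set_def)
    have "A (adjoint_op T z) = adjoint_op T (A z)" using A T' unfolding commutant_UNIV by blast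
    then show "cinner (adjoint_op A (T x)) z = cinner (T (adjoint_op A x)) z"
      by (simp add: adjoint_op(3)[OF Ab] adjoint_op(2)[OF Tb])
  qed
  then show ?thesis using adjoint_op(1)[OF Ab] by (simp add: commutant_UNIV)
qed

lemma bop_bound:
  assumes "T \<in> bop UNIV UNIV"
  obtains b where "b \<ge> 0" "\<And>x. norm (T x) \<le> b * norm x"
proof -
  obtain b where "b \<ge> 0" "\<forall>x. norm (T x) \<le> norm x * b"
    using bounded_linear.nonneg_bounded[OF bop_bounded_linear[OF assms]] by auto
  then show thesis by (intro that[of b]) (simp_all add: mult.commute)
qed

text \<open>If \<open>T\<close> is a self-adjoint contraction in the commutant, so is \<open>2 T - (2 Q - 1)\<close> for a suitable
  projection \<open>Q\<close> in the commutant, and the commutator of \<open>A\<close> with it is twice the commutator with \<open>T\<close>.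
  Since commutators with contractions are uniformly bounded, repeated doubling forces them to vanish.\<close>

lemma commutes_with_selfadjoint_contraction:
  assumes X: "selfadjoint_set X" and A: "A \<in> bop UNIV UNIV"
    and AL: "\<And>L x. L \<in> projections UNIV \<inter> commutant UNIV X \<Longrightarrow> A (L x) = L (A x)"
    and T: "T \<in> commutant UNIV X" and sa: "\<And>x y. cinner (T x) y = cinner x (T y)"
    and contr: "\<And>x. norm (T x) \<le> norm x"
  shows "A (T x) = T (A x)"
proof -
  obtain b where b: "b \<ge> 0" "\<And>x. norm (A x) \<le> b * norm x" by (rule bop_bound[OF A]) (rule that)
  note Aalg = bop_algebra[OF A]
  have bound: "norm (A (T x) - T (A x)) \<le> 2 * b / 2 ^ n * norm x"
    if "T \<in> commutant UNIV X" "\<And>x y. cinner (T x) y = cinner x (T y)" "\<And>x. norm (T x) \<le> norm x"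
    for n T x
    using that
  proof (induction n arbitrary: T)
    case 0
    have "norm (A (T x) - T (A x)) \<le> norm (A (T x)) + norm (T (A x))" by (rule norm_triangle_ineq4)
    also have "\<dots> \<le> b * norm x + b * norm x"
      by (intro add_mono order_trans[OF b(2)] order_trans[OF 0(3)] mult_left_mono b 0(3))
    finally show ?case by simp
  next
    case (Suc n)
    have Tb: "T \<in> bop UNIV UNIV" using Suc.prems(1) by (simp add: commutant_UNIV)
    obtain Q where Q: "Q \<in> projections UNIV"
      and near: "\<And>x. norm (T x - Q x + (1/2) *\<^sub>R x) \<le> 1/2 * norm x"
      and Qcomm: "\<And>B x. B \<in> bop UNIV UNIV \<Longrightarrow> (\<And>x. B (T x) = T (B x)) \<Longrightarrow>
        (\<And>x. adjoint_op B (T x) = T (adjoint_op B x)) \<Longrightarrow> B (Q x) = Q (B x)"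
      using near_half_reflection[OF Tb Suc.prems(2,3)] by blast
    have Qb: "Q \<in> bop UNIV UNIV" by (rule projD(1)[OF Q])
    have QX: "R (Q x) = Q (R x)" if R: "R \<in> X" for R x
    proof (rule Qcomm)
      show "R \<in> bop UNIV UNIV" using X R by (auto simp: selfadjoint_set_def)
      have "adjoint_op R \<in> X" using X R by (auto simp: selfadjoint_set_def)
      then show "R (T x) = T (R x)" "adjoint_op R (T x) = T (adjoint_op R x)" for x
        using Suc.prems(1) R by (simp_all add: commutant_UNIV)
    qed
    then have QC: "Q \<in> projections UNIV \<inter> commutant UNIV X" using Q Qb by (simp add: commutant_UNIV)
    \<comment> \<open>\<open>2 T - (2 Q - 1)\<close>, a self-adjoint contraction in the commutant again\<close>
    define T' where "T' x = 2 *\<^sub>R (T x - Q x) + x" for x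
    have T'b: "T' \<in> bop UNIV UNIV"
      using bop_add[OF bop_scaleC[OF bop_diff[OF Tb Qb], of "complex_of_real 2"] bop_id]
      by (simp only: T'_def[abs_def] scaleR_scaleC)
    have T'C: "T' \<in> commutant UNIV X"
      unfolding commutant_UNIV
    proof (intro conjI T'b ballI allI)
      fix R x assume R: "R \<in> X"
      have "R \<in> bop UNIV UNIV" using X R by (auto simp: selfadjoint_set_def)
      note Ralg = bop_algebra[OF this]
      have "T (R x) = R (T x)" using Suc.prems(1) R by (simp add: commutant_UNIV)
      then show "T' (R x) = R (T' x)" by (simp add: T'_def Ralg QX[OF R])
    qed
    have "norm (A (T' x) - T' (A x)) \<le> 2 * b / 2 ^ n * norm x"
    proof (rule Suc.IH[OF T'C])
      show "cinner (T' x) y = cinner x (T' y)" for x y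
        by (simp add: T'_def cinner_algebra Suc.prems(2) projD(3)[OF Q])
      show "norm (T' x) \<le> norm x" for x
      proof -
        have "T' x = 2 *\<^sub>R (T x - Q x + (1/2) *\<^sub>R x)" by (simp add: T'_def scaleR_add_right)
        then have "norm (T' x) = 2 * norm (T x - Q x + (1/2) *\<^sub>R x)" by simp
        then show ?thesis using near[of x] by simp
      qed
    qed
    also have "A (T' x) - T' (A x) = 2 *\<^sub>R (A (T x) - T (A x))"
      by (simp add: T'_def Aalg AL[OF QC] scaleR_diff_right)
    finally show ?case by simp
  qed
  have "norm (A (T x) - T (A x)) \<le> 0"
  proof (rule LIMSEQ_le_const)
    have "(\<lambda>n. 2 * b * norm x * (1/2) ^ n) \<longlonglongrightarrow> 2 * b * norm x * 0"
      by (intro tendsto_mult tendsto_const LIMSEQ_power_zero) simp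
    then show "(\<lambda>n. 2 * b / 2 ^ n * norm x) \<longlonglongrightarrow> 0" by (simp add: power_divide)
    show "\<exists>N. \<forall>n\<ge>N. norm (A (T x) - T (A x)) \<le> 2 * b / 2 ^ n * norm x"
      using bound[OF T sa contr] by blast
  qed
  then show ?thesis by simp
qed

text \<open>The commutant of a self-adjoint set is spanned by its self-adjoint contractions: up to a real
  factor, \<open>T\<close> is a combination of \<open>T + T\<^sup>*\<close> and \<open>\<i> (T - T\<^sup>*)\<close>.\<close>

theorem commutant_generated_by_projections:
  fixes X :: "('a::complex_hilbert \<Rightarrow> 'a) set"
  assumes X: "selfadjoint_set X" and A: "A \<in> bop UNIV UNIV"
    and AL: "\<And>L x. L \<in> projections UNIV \<inter> commutant UNIV X \<Longrightarrow> A (L x) = L (A x)"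
  shows "A \<in> commutant UNIV (commutant UNIV X)"
  unfolding commutant_UNIV
proof (intro conjI A ballI allI)
  fix T x assume T: "T \<in> commutant UNIV X"
  let ?T' = "adjoint_op T"
  have T': "?T' \<in> commutant UNIV X" by (rule adjoint_commutant[OF X T])
  have Tb: "T \<in> bop UNIV UNIV" "?T' \<in> bop UNIV UNIV" using T T' by (simp_all add: commutant_UNIV)
  obtain b1 where b1: "b1 \<ge> 0" "\<And>x. norm (T x) \<le> b1 * norm x" by (rule bop_bound[OF Tb(1)]) (rule that)
  obtain b2 where b2: "b2 \<ge> 0" "\<And>x. norm (?T' x) \<le> b2 * norm x" by (rule bop_bound[OF Tb(2)]) (rule that)
  \<comment> \<open>scales the real and imaginary parts to contractions; the summand \<open>1\<close> avoids division by zero\<close>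
  define c where "c = 1 / (b1 + b2 + 1)"
  have c: "c > 0" "c * (b1 + b2) \<le> 1" using b1(1) b2(1) by (simp_all add: c_def)
  have in_commutant: "(\<lambda>x. a *\<^sub>C T x + a' *\<^sub>C ?T' x) \<in> commutant UNIV X" for a a'
    unfolding commutant_UNIV
  proof (intro conjI ballI allI)
    show "(\<lambda>x. a *\<^sub>C T x + a' *\<^sub>C ?T' x) \<in> bop UNIV UNIV" by (rule bop_add[OF bop_scaleC[OF Tb(1)] bop_scaleC[OF Tb(2)]])
    fix R x assume R: "R \<in> X"
    then have "R \<in> bop UNIV UNIV" using X by (auto simp: selfadjoint_set_def)
    moreover have "T (R x) = R (T x)" "?T' (R x) = R (?T' x)"
      using T T' R unfolding commutant_UNIV by blast+
    ultimately show "a *\<^sub>C T (R x) + a' *\<^sub>C ?T' (R x) = R (a *\<^sub>C T x + a' *\<^sub>C ?T' x)"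
      by (simp add: bop_UNIV)
  qed
  have small: "norm (of_real c *\<^sub>C v) \<le> norm y" if "norm v \<le> norm (T y) + norm (?T' y)" for v y :: 'a
  proof -
    have "c * norm v \<le> c * (b1 * norm y + b2 * norm y)"
      using that b1(2)[of y] b2(2)[of y] c by (intro mult_left_mono) linarith+
    also have "\<dots> = c * (b1 + b2) * norm y" by (simp add: algebra_simps)
    also have "\<dots> \<le> 1 * norm y" by (intro mult_right_mono c) simp
    finally show ?thesis using c by (simp add: norm_scaleC)
  qed
  have H: "A (of_real c *\<^sub>C (T x + ?T' x)) = of_real c *\<^sub>C (T (A x) + ?T' (A x))"
  proof (rule commutes_with_selfadjoint_contraction[OF X A AL])
    show "(\<lambda>x. of_real c *\<^sub>C (T x + ?T' x)) \<in> commutant UNIV X"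
      using in_commutant[of "of_real c" "of_real c"] by (simp add: scaleC_add_right)
    show "cinner (of_real c *\<^sub>C (T x + ?T' x)) y = cinner x (of_real c *\<^sub>C (T y + ?T' y))" for x y
      by (simp add: cinner_algebra adjoint_op[OF Tb(1)])
    show "norm (of_real c *\<^sub>C (T x + ?T' x)) \<le> norm x" for x
      by (intro small norm_triangle_ineq)
  qed
  have K: "A (of_real c *\<^sub>C (\<i> *\<^sub>C (T x - ?T' x))) = of_real c *\<^sub>C (\<i> *\<^sub>C (T (A x) - ?T' (A x)))"
  proof (rule commutes_with_selfadjoint_contraction[OF X A AL])
    show "(\<lambda>x. of_real c *\<^sub>C (\<i> *\<^sub>C (T x - ?T' x))) \<in> commutant UNIV X"
      using in_commutant[of "of_real c * \<i>" "- (of_real c * \<i>)"]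
      by (simp add: complex_vector.scale_right_diff_distrib)
    show "cinner (of_real c *\<^sub>C (\<i> *\<^sub>C (T x - ?T' x))) y = cinner x (of_real c *\<^sub>C (\<i> *\<^sub>C (T y - ?T' y)))" for x y
      by (simp add: cinner_algebra adjoint_op[OF Tb(1)] algebra_simps)
    show "norm (of_real c *\<^sub>C (\<i> *\<^sub>C (T x - ?T' x))) \<le> norm x" for x
      by (intro small) (simp add: norm_scaleC norm_triangle_ineq4)
  qed
  note Aalg = bop_algebra[OF A]
  have c0: "complex_of_real c \<noteq> 0" using c by simp
  have "A (T x) + A (?T' x) = T (A x) + ?T' (A x)"
    using H c0 by (simp add: Aalg)
  moreover have "A (T x) - A (?T' x) = T (A x) - ?T' (A x)"
    using K c0 by (simp add: Aalg)
  ultimately have "(A (T x) + A (?T' x)) + (A (T x) - A (?T' x)) =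
      (T (A x) + ?T' (A x)) + (T (A x) - ?T' (A x))" by simp
  then have "2 *\<^sub>R A (T x) = 2 *\<^sub>R T (A x)" by (simp add: scaleR_2)
  then show "A (T x) = T (A x)" by simp
qed

section \<open>Operators on a reducing subspace\<close>

lemma proj_algebra:
  assumes P: "P \<in> projections UNIV"
  shows "P 0 = 0" "P (x + y) = P x + P y" "P (x - y) = P x - P y" "P (c *\<^sub>C x) = c *\<^sub>C P x"
    "P (P x) = P x"
  by (rule bop_algebra[OF projD(1)[OF P]] projD(2)[OF P])+

lemma proj_perp_zero: "P \<in> projections UNIV \<Longrightarrow> P (perp P x) = 0"
  by (simp add: perp_def proj_algebra)

lemma proj_add_perp: "P x + perp P x = x"
  by (simp add: perp_def)

text \<open>Passage between operators on a closed subspace, which are extensional functions, and operators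
  on the whole space that vanish on the orthogonal complement.\<close>

lemma bop_restrict:
  assumes T: "T \<in> bop UNIV UNIV" and K: "closed_subspace K" and TK: "\<And>x. x \<in> K \<Longrightarrow> T x \<in> L"
  shows "restrict T K \<in> bop K L"
proof -
  obtain b where "\<And>x. norm (T x) \<le> b * norm x" by (rule bop_bound[OF T]) (rule that)
  then have "\<exists>B. \<forall>x\<in>K. norm (T x) \<le> B * norm x" by blast
  then show ?thesis
    using TK closed_subspaceD(2,3)[OF K] unfolding bop_def by (simp add: bop_algebra[OF T])
qed

lemma bop_extend:
  assumes A: "A \<in> bop (range P) L" and P: "P \<in> projections UNIV"
  shows "(\<lambda>x. A (P x)) \<in> bop UNIV UNIV"
proof -
  obtain B where B: "\<And>x. x \<in> range P \<Longrightarrow> norm (A x) \<le> B * norm x" using A unfolding bop_def by blast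
  have "norm (A (P x)) \<le> \<bar>B\<bar> * norm x" for x
  proof -
    have "norm (A (P x)) \<le> B * norm (P x)" by (intro B rangeI)
    also have "\<dots> \<le> \<bar>B\<bar> * norm x" by (intro mult_mono norm_proj_le[OF P]) simp_all
    finally show ?thesis .
  qed
  moreover have "A (P (x + y)) = A (P x) + A (P y)" for x y
    by (simp add: proj_algebra[OF P] bopD(2)[OF A rangeI rangeI])
  moreover have "A (P (c *\<^sub>C x)) = c *\<^sub>C A (P x)" for c x
    by (simp add: proj_algebra[OF P] bopD(3)[OF A rangeI])
  ultimately show ?thesis unfolding bop_UNIV by blast
qed

lemma zero_on_bop: "closed_subspace K \<Longrightarrow> closed_subspace L \<Longrightarrow> zero_on K \<in> bop K L"
  using bop_restrict[OF bop_zero, of K L] closed_subspaceD(1)[of L] by (simp add: zero_on_def)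

lemma scalar_on_bop:
  assumes "closed_subspace K"
  shows "scalar_on K c \<in> bop K K"
  using bop_restrict[OF bop_scaleC[OF bop_id] assms, of c K] closed_subspaceD(3)[OF assms]
  by (simp add: scalar_on_def)

subsection \<open>Block matrices\<close>

lemma block_bop:
  assumes P: "P \<in> projections UNIV"
    and "A \<in> bop (range P) L" "B \<in> bop (range (perp P)) L'"
      "C \<in> bop (range P) M" "D \<in> bop (range (perp P)) M'"
  shows "block P A B C D \<in> bop UNIV UNIV"
  unfolding block_def
  using assms perp_projection[OF P] by (intro bop_add) (rule bop_extend; assumption)+

lemma block_decomposition:
  assumes P: "P \<in> projections UNIV" and Y: "Y \<in> bop UNIV UNIV"
  shows "Y = block P (restrict (\<lambda>x. P (Y x)) (range P)) (restrict (\<lambda>x. P (Y x)) (range (perp P)))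
    (restrict (\<lambda>x. perp P (Y x)) (range P)) (restrict (\<lambda>x. perp P (Y x)) (range (perp P)))"
proof
  fix x
  have "Y x = Y (P x) + Y (perp P x)" by (simp add: bop_algebra(2)[OF Y, symmetric] proj_add_perp)
  then show "Y x = block P (restrict (\<lambda>x. P (Y x)) (range P)) (restrict (\<lambda>x. P (Y x)) (range (perp P)))
    (restrict (\<lambda>x. perp P (Y x)) (range P)) (restrict (\<lambda>x. perp P (Y x)) (range (perp P))) x"
    by (simp add: block_def perp_def)
qed

lemma corner_bop:
  assumes P: "P \<in> projections UNIV" and R: "R \<in> projections UNIV" and Y: "Y \<in> bop UNIV UNIV"
  shows "restrict (\<lambda>x. R (Y x)) (range P) \<in> bop (range P) (range R)"
  by (intro bop_restrict bop_comp[OF projD(1)[OF R] Y] closed_subspace_range[OF P]) simp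

lemma restrict_eq_zero_on: "(\<And>x. x \<in> K \<Longrightarrow> f x = 0) \<Longrightarrow> restrict f K = zero_on K"
  by (auto simp: zero_on_def restrict_def)

subsection \<open>Commutants on a closed subspace are von Neumann algebras\<close>

text \<open>The adjoint on a closed subspace is the compression of the adjoint of the extension by zero.\<close>

lemma adj_exists_on:
  assumes K: "closed_subspace K" and A: "A \<in> bop K K"
  shows "adj K K A \<in> bop K K" "x \<in> K \<Longrightarrow> y \<in> K \<Longrightarrow> cinner (A x) y = cinner x (adj K K A y)"
proof -
  define P where "P = proj_onto K"
  have P: "P \<in> projections UNIV" and rP: "range P = K" unfolding P_def by (rule proj_onto[OF K])+
  have PK: "P x = x" if "x \<in> K" for x using in_range_proj[OF P] rP that by blast
  have A': "(\<lambda>x. A (P x)) \<in> bop UNIV UNIV" using bop_extend[OF _ P] A rP by metis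
  let ?S = "adjoint_op (\<lambda>x. A (P x))"
  let ?R = "restrict (\<lambda>y. P (?S y)) K"
  have R: "?R \<in> bop K K" using corner_bop[OF P P adjoint_op(1)[OF A']] unfolding rP .
  have ad: "cinner (A x) y = cinner x (?R y)" if "x \<in> K" "y \<in> K" for x y
    using adjoint_op(2)[OF A', of x y] that by (simp add: projD(3)[OF P, symmetric] PK)
  have "adj K K A = ?R" by (rule adj_eqI[OF R ad K])
  then show "adj K K A \<in> bop K K" "x \<in> K \<Longrightarrow> y \<in> K \<Longrightarrow> cinner (A x) y = cinner x (adj K K A y)"
    using R ad by simp_all
qed

lemma commutant_iff:
  "A \<in> commutant K X \<longleftrightarrow> A \<in> bop K K \<and> (\<forall>T\<in>X. \<forall>x\<in>K. A (T x) = T (A x))"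
  by (simp add: commutant_def)

text \<open>The triple commutant of any set is its commutant, and the commutant inherits self-adjointness.\<close>

lemma von_neumann_algebra_commutant:
  assumes K: "closed_subspace K" and Y: "Y \<subseteq> bop K K"
    and adY: "\<And>T. T \<in> Y \<Longrightarrow> \<exists>T'\<in>Y. \<forall>x\<in>K. \<forall>y\<in>K. cinner (T x) y = cinner x (T' y)"
  shows "von_neumann_algebra K (commutant K Y)"
  unfolding von_neumann_algebra_def
proof (intro conjI ballI)
  show sub: "commutant K Y \<subseteq> bop K K" by (auto simp: commutant_iff)
  show "adj K K A \<in> commutant K Y" if A: "A \<in> commutant K Y" for A
    unfolding commutant_iff
  proof (intro conjI ballI)
    have Ab: "A \<in> bop K K" using A by (simp add: commutant_iff)
    note ad = adj_exists_on[OF K Ab]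
    show "adj K K A \<in> bop K K" by (rule ad)
    fix T x assume T: "T \<in> Y" and x: "x \<in> K"
    obtain T' where T': "T' \<in> Y" "\<And>x y. x \<in> K \<Longrightarrow> y \<in> K \<Longrightarrow> cinner (T x) y = cinner x (T' y)"
      using adY[OF T] by blast
    have TK: "T y \<in> K" if "y \<in> K" for y using T Y bopD(1)[of T K K y] that by blast
    have TK': "T' y \<in> K" if "y \<in> K" for y using T' Y bopD(1)[of T' K K y] that by blast
    have AK: "A y \<in> K" if "y \<in> K" for y by (rule bopD(1)[OF Ab that])
    have A'K: "adj K K A y \<in> K" if "y \<in> K" for y by (rule bopD(1)[OF ad(1) that])
    let ?d = "adj K K A (T x) - T (adj K K A x)"
    have d: "?d \<in> K" by (intro closed_subspaceD(4)[OF K] A'K TK x)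
    have ad': "cinner (adj K K A u) v = cinner u (A v)" if "u \<in> K" "v \<in> K" for u v
      using ad(2)[OF that(2,1)] cinner_commute[of "adj K K A u" v] cinner_commute[of u "A v"] by simp
    have "A (T' ?d) = T' (A ?d)" using A T'(1) d unfolding commutant_iff by blast
    then have "cinner (adj K K A (T x)) ?d = cinner (T (adj K K A x)) ?d"
      by (simp add: ad' T'(2) TK A'K AK TK' x d)
    then have "cinner ?d ?d = 0" by (simp only: cinner_diff_left[of _ _ ?d] right_minus_eq)
    then show "adj K K A (T x) = T (adj K K A x)" by simp
  qed
  show "commutant K (commutant K (commutant K Y)) = commutant K Y"
  proof
    show "commutant K (commutant K (commutant K Y)) \<subseteq> commutant K Y"
    proof
      fix A assume A: "A \<in> commutant K (commutant K (commutant K Y))"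
      have "T \<in> commutant K (commutant K Y)" if "T \<in> Y" for T
        using that Y unfolding commutant_def by auto
      then show "A \<in> commutant K Y" using A unfolding commutant_iff[of A] by blast
    qed
    show "commutant K Y \<subseteq> commutant K (commutant K (commutant K Y))"
      unfolding commutant_def by auto
  qed
qed

section \<open>The lattices of a self-adjoint set of operators\<close>

text \<open>The operators of a self-adjoint set \<open>X\<close> vanish on their common kernel \<open>N\<close> and, taking adjoints,
  have their ranges in its orthogonal complement \<open>K\<close>.  The set thus lives on \<open>K\<close>, and its commutant splits into
  a commutant on \<open>K\<close> and all operators on \<open>N\<close>.  Both \<open>U\<^sup>* U\<close> and \<open>U U\<^sup>*\<close> are of this kind.\<close>

locale selfadjoint_corner =
  fixes X :: "('a::complex_hilbert \<Rightarrow> 'a) set" and P :: "'a \<Rightarrow> 'a"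
  assumes X: "selfadjoint_set X" and P: "P \<in> projections UNIV"
    and kernel: "\<And>x. P x = 0 \<longleftrightarrow> (\<forall>T\<in>X. T x = 0)"
begin

abbreviation "K \<equiv> range P"
abbreviation "N \<equiv> range (perp P)"

definition "commuting_projections = projections UNIV \<inter> commutant UNIV X"
definition "corner_projections = (\<lambda>L. restrict L K) ` commuting_projections"

lemmas Palg = proj_algebra[OF P]
lemmas PN = perp_projection[OF P]

lemma K_iff: "x \<in> K \<longleftrightarrow> P x = x" by (rule in_range_proj[OF P])
lemma N_iff: "x \<in> N \<longleftrightarrow> P x = 0" by (rule in_range_perp[OF P])
lemma K_closed: "closed_subspace K" by (rule closed_subspace_range[OF P])
lemma N_closed: "closed_subspace N" by (rule closed_subspace_range[OF PN])
lemma P_perp: "P (perp P x) = 0" by (rule proj_perp_zero[OF P])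

lemma X_bop: "T \<in> X \<Longrightarrow> T \<in> bop UNIV UNIV"
  using X by (auto simp: selfadjoint_set_def)

lemma X_adjoint: "T \<in> X \<Longrightarrow> adjoint_op T \<in> X"
  using X by (auto simp: selfadjoint_set_def)

lemma X_perp: "T \<in> X \<Longrightarrow> T (perp P x) = 0"
  using kernel P_perp by blast

lemma X_P: "T (P x) = T x" if T: "T \<in> X"
  using X_perp[OF T, of x] by (simp add: perp_def bop_algebra[OF X_bop[OF T]])

lemma P_X: "P (T x) = T x" if T: "T \<in> X"
proof -
  have "perp P (T x) = 0"
  proof (rule cinner_eqI)
    fix y
    have "cinner (perp P (T x)) y = cinner x (adjoint_op T (perp P y))"
      by (simp add: projD(3)[OF PN] adjoint_op(2)[OF X_bop[OF T]])
    then show "cinner (perp P (T x)) y = cinner 0 y" using X_perp[OF X_adjoint[OF T]] by simp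
  qed
  then show ?thesis by (simp add: perp_def)
qed

lemma commuting_iff:
  "L \<in> commuting_projections \<longleftrightarrow> L \<in> projections UNIV \<and> (\<forall>T\<in>X. \<forall>x. L (T x) = T (L x))"
  by (auto simp: commuting_projections_def commutant_UNIV projD(1))

lemma P_commuting: "P \<in> commuting_projections"
  using P by (simp add: commuting_iff X_P P_X)

text \<open>The common kernel is invariant under the commutant, which is self-adjoint.\<close>

lemma commutant_P:
  assumes B: "B \<in> commutant UNIV X"
  shows "B (P x) = P (B x)"
proof -
  have Bb: "B \<in> bop UNIV UNIV" using B by (simp add: commutant_UNIV)
  have inv: "C x \<in> N" if C: "C \<in> commutant UNIV X" and x: "x \<in> N" for C x
  proof -
    have C': "C \<in> bop UNIV UNIV" "\<And>T. T \<in> X \<Longrightarrow> T (C x) = C (T x)"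
      using C by (simp_all add: commutant_UNIV)
    have "T (C x) = 0" if T: "T \<in> X" for T
    proof -
      have "T x = 0" using x kernel T unfolding N_iff by blast
      then show ?thesis unfolding C'(2)[OF T] by (simp only: bop_algebra(1)[OF C'(1)])
    qed
    then show ?thesis unfolding N_iff using kernel by blast
  qed
  have "B (perp P x) = perp P (B x)"
    by (rule commute_of_reducing[OF PN Bb adjoint_op(2)[OF Bb]])
      (rule inv[OF B] inv[OF adjoint_commutant[OF X B]]; assumption)+
  then show ?thesis by (simp add: perp_def bop_algebra[OF Bb])
qed

lemma commuting_P: "L \<in> commuting_projections \<Longrightarrow> L (P x) = P (L x)"
  by (rule commutant_P) (simp add: commuting_projections_def)

lemma commuting_projection: "L \<in> commuting_projections \<Longrightarrow> L \<in> projections UNIV"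
  by (simp add: commuting_projections_def)

lemma commuting_perp:
  assumes L: "L \<in> commuting_projections"
  shows "perp L \<in> commuting_projections"
proof -
  have "perp L (T x) = T (perp L x)" if T: "T \<in> X" for T x
    using L T unfolding commuting_iff by (simp add: perp_def bop_algebra[OF X_bop[OF T]])
  then show ?thesis using perp_projection[OF commuting_projection[OF L]] unfolding commuting_iff by blast
qed

lemma commuting_cut:
  assumes L: "L \<in> commuting_projections"
  shows "(\<lambda>x. L (P x)) \<in> commuting_projections"
proof -
  note Lp = commuting_projection[OF L]
  have "(\<lambda>x. L (P x)) \<in> projections UNIV"
    using bop_comp[OF projD(1)[OF Lp] projD(1)[OF P]]
    by (simp add: projections_def commuting_P[OF L] Palg proj_algebra[OF Lp] projD(3)[OF P] projD(3)[OF Lp])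
  moreover have "L (P (T x)) = T (L (P x))" if T: "T \<in> X" for T x
  proof -
    have "L (P (T x)) = T (L x)" using L T unfolding commuting_iff by (simp add: P_X[OF T])
    then show ?thesis by (simp only: commuting_P[OF L] X_P[OF T])
  qed
  ultimately show ?thesis by (simp add: commuting_iff)
qed

lemma commuting_K:
  assumes L: "L \<in> commuting_projections" and x: "x \<in> K"
  shows "L x \<in> K"
proof -
  have "P x = x" using x by (simp only: K_iff)
  then have "P (L x) = L x" using commuting_P[OF L, of x] by simp
  then show ?thesis by (simp only: K_iff)
qed

lemma restrict_corner_bop:
  assumes L: "L \<in> commuting_projections"
  shows "restrict L K \<in> bop K K"
  by (rule bop_restrict[OF projD(1)[OF commuting_projection[OF L]] K_closed commuting_K[OF L]])

text \<open>A projection on \<open>K\<close> that commutes with the restrictions extends by zero to a projection in the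
  commutant of the whole space.\<close>

lemma corner_projections_eq:
  "corner_projections = commutant K ((\<lambda>T. restrict T K) ` X) \<inter> projections K"
proof (intro equalityI subsetI)
  fix p assume "p \<in> corner_projections"
  then obtain L where L: "L \<in> commuting_projections" and p: "p = restrict L K"
    by (auto simp: corner_projections_def)
  note Lp = commuting_projection[OF L]
  have LK: "L x \<in> K" if "x \<in> K" for x by (rule commuting_K[OF L that])
  have TK: "T x \<in> K" if "T \<in> X" for T x using P_X[OF that] by (simp add: K_iff)
  show "p \<in> commutant K ((\<lambda>T. restrict T K) ` X) \<inter> projections K"
    using restrict_corner_bop[OF L] L TK
    by (auto simp: p commutant_iff projections_def LK proj_algebra[OF Lp] projD(3)[OF Lp] commuting_iff
        simp del: image_iff rangeI)
next
  fix p assume "p \<in> commutant K ((\<lambda>T. restrict T K) ` X) \<inter> projections K"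
  then have pb: "p \<in> bop K K" and pX: "\<And>T x. T \<in> X \<Longrightarrow> x \<in> K \<Longrightarrow> p (restrict T K x) = restrict T K (p x)"
    and pp: "\<And>x. x \<in> K \<Longrightarrow> p (p x) = p x"
    and psa: "\<And>x y. x \<in> K \<Longrightarrow> y \<in> K \<Longrightarrow> cinner (p x) y = cinner x (p y)"
    by (auto simp: commutant_iff projections_def)
  have pK: "p (P x) \<in> K" for x by (rule bopD(1)[OF pb rangeI])
  then have PpP: "P (p (P x)) = p (P x)" for x by (simp only: K_iff)
  define L where "L x = p (P x)" for x
  have "L \<in> projections UNIV"
  proof -
    have "cinner (p (P x)) y = cinner x (p (P y))" for x y
    proof -
      have "cinner (p (P x)) y = cinner (P (p (P x))) y" by (simp add: PpP)
      also have "\<dots> = cinner (p (P x)) (P y)" by (rule projD(3)[OF P])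
      also have "\<dots> = cinner (P x) (p (P y))" by (rule psa) simp_all
      also have "\<dots> = cinner x (P (p (P y)))" by (rule projD(3)[OF P])
      finally show ?thesis by (simp add: PpP)
    qed
    then show ?thesis
      using bop_extend[OF pb P] pp[OF rangeI] by (simp add: projections_def L_def[abs_def] PpP)
  qed
  moreover have "L (T x) = T (L x)" if T: "T \<in> X" for T x
    using pX[OF T, of "P x"] pK[of x] by (simp add: L_def X_P[OF T] P_X[OF T])
  ultimately have "L \<in> commuting_projections" by (simp add: commuting_iff)
  moreover have "p = restrict L K"
  proof
    fix x
    show "p x = restrict L K x"
    proof (cases "x \<in> K")
      case True
      then have "P x = x" by (simp only: K_iff)
      with True show ?thesis by (simp add: L_def)
    next
      case False
      then show ?thesis using bopD(4)[OF pb] by simp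
    qed
  qed
  ultimately show "p \<in> corner_projections" by (auto simp: corner_projections_def)
qed

lemma corner_projections_vN: "is_projection_lattice_of_vN K corner_projections"
proof -
  have TK: "T x \<in> K" if "T \<in> X" for T x using P_X[OF that] by (simp only: K_iff)
  have "von_neumann_algebra K (commutant K ((\<lambda>T. restrict T K) ` X))"
  proof (rule von_neumann_algebra_commutant[OF K_closed])
    show "(\<lambda>T. restrict T K) ` X \<subseteq> bop K K"
      using bop_restrict[OF X_bop K_closed] TK by blast
    fix S assume "S \<in> (\<lambda>T. restrict T K) ` X"
    then obtain T where T: "T \<in> X" "S = restrict T K" by blast
    show "\<exists>T'\<in>(\<lambda>T. restrict T K) ` X. \<forall>x\<in>K. \<forall>y\<in>K. cinner (S x) y = cinner x (T' y)"
      by (rule bexI[OF _ imageI[OF X_adjoint[OF T(1)]]]) (simp add: T(2) adjoint_op(2)[OF X_bop[OF T(1)]])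
  qed
  then show ?thesis unfolding is_projection_lattice_of_vN_def corner_projections_eq by blast
qed

lemma commutant_corner_iff:
  "A \<in> commutant K corner_projections \<longleftrightarrow>
    A \<in> bop K K \<and> (\<forall>L\<in>commuting_projections. \<forall>x. A (L (P x)) = L (A (P x)))"
proof -
  have "(\<forall>x\<in>K. A (restrict L K x) = restrict L K (A x)) \<longleftrightarrow> (\<forall>x. A (L (P x)) = L (A (P x)))"
    if "A \<in> bop K K" for L
    using bopD(1)[OF that rangeI] by simp
  then show ?thesis unfolding commutant_iff corner_projections_def by blast
qed

subsection \<open>The bicommutant\<close>

text \<open>An operator in the bicommutant commutes with \<open>P\<close>, hence is diagonal; on \<open>K\<close> it commutes with the
  projections of the commutant, and on \<open>N\<close> it commutes with everything, hence is a scalar.\<close>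

lemma bicommutant_subset:
  assumes Y: "Y \<in> commutant UNIV (commutant UNIV X)"
  shows "\<exists>A c. Y = block P A (zero_on N) (zero_on K) (scalar_on N c) \<and> A \<in> commutant K corner_projections"
proof -
  have Yb: "Y \<in> bop UNIV UNIV" and Yc: "\<And>B x. B \<in> commutant UNIV X \<Longrightarrow> Y (B x) = B (Y x)"
    using Y by (simp_all add: commutant_UNIV)
  note Yalg = bop_algebra[OF Yb]
  have YP: "Y (P x) = P (Y x)" for x
    by (rule Yc) (use P_commuting in \<open>simp add: commuting_projections_def\<close>)
  have "\<exists>c. \<forall>x\<in>N. Y x = c *\<^sub>C x"
  proof (cases "N = {0}")
    case True
    then show ?thesis by (simp add: Yalg)
  next
    case False
    then obtain u where u: "u \<in> N" "u \<noteq> 0" using closed_subspaceD(1)[OF N_closed] by blast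
    have "Y v = (cinner (Y u) u / cinner u u) *\<^sub>C v" if v: "v \<in> N" for v
    proof -
      \<comment> \<open>\<open>D\<close> maps \<open>u\<close> to \<open>v\<close> and lies in the commutant, because it is concentrated on \<open>N\<close>\<close>
      define D where "D x = (cinner x u / cinner u u) *\<^sub>C v" for x
      have Db: "D \<in> bop UNIV UNIV"
      proof (rule bop_UNIV_I)
        have "bounded_linear (\<lambda>x. cinner x u)"
          by (rule bounded_bilinear.bounded_linear_left[OF bounded_bilinear_cinner])
        then have 1: "bounded_linear (\<lambda>x. cinner x u / cinner u u)"
          by (rule bounded_linear_compose[OF bounded_linear_divide])
        have 2: "bounded_linear (\<lambda>a. a *\<^sub>C v)"
        proof (rule bounded_linear_intro[of _ "norm v"])
          show "(r *\<^sub>R a) *\<^sub>C v = r *\<^sub>R (a *\<^sub>C v)" for r a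
            by (simp only: scaleR_conv_of_real[of r a] scaleR_scaleC[of r "a *\<^sub>C v"] scaleC_scaleC)
        qed (simp_all add: scaleC_add_left norm_scaleC)
        show "bounded_linear D" unfolding D_def[abs_def] by (rule bounded_linear_compose[OF 2 1])
      qed (simp add: D_def cinner_scaleC_left scaleC_scaleC)
      have "D (T x) = T (D x)" if T: "T \<in> X" for T x
      proof -
        have "cinner (T x) u = cinner (P (T x)) u" by (simp add: P_X[OF T])
        also have "\<dots> = 0" using u by (simp add: projD(3)[OF P] N_iff)
        finally have "D (T x) = 0" by (simp add: D_def)
        moreover have "T v = 0" using v kernel T unfolding N_iff by blast
        ultimately show ?thesis by (simp add: D_def bop_algebra[OF X_bop[OF T]])
      qed
      then have "D \<in> commutant UNIV X" using Db by (simp add: commutant_UNIV)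
      then have "Y (D u) = D (Y u)" by (rule Yc)
      then show ?thesis using u by (simp add: D_def)
    qed
    then show ?thesis by blast
  qed
  then obtain c where c: "\<And>x. x \<in> N \<Longrightarrow> Y x = c *\<^sub>C x" by blast
  define A where "A = restrict (\<lambda>x. P (Y x)) K"
  have "A \<in> commutant K corner_projections"
    unfolding commutant_corner_iff
  proof (intro conjI ballI allI)
    show "A \<in> bop K K" unfolding A_def by (rule corner_bop[OF P P Yb])
    fix L x assume L: "L \<in> commuting_projections"
    have LK: "L (P x) \<in> K" using commuting_P[OF L] by simp
    have "Y (L (P x)) = L (Y (P x))" by (rule Yc) (use L in \<open>simp add: commuting_projections_def\<close>)
    then show "A (L (P x)) = L (A (P x))" using LK by (simp add: A_def commuting_P[OF L])
  qed
  moreover have "Y = block P A (zero_on N) (zero_on K) (scalar_on N c)"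
  proof -
    have "restrict (\<lambda>x. P (Y x)) N = zero_on N"
      by (rule restrict_eq_zero_on) (simp only: YP[symmetric] N_iff Yalg)
    moreover have "restrict (\<lambda>x. perp P (Y x)) K = zero_on K"
      by (rule restrict_eq_zero_on) (simp only: perp_def YP[symmetric] K_iff diff_self)
    moreover have "restrict (\<lambda>x. perp P (Y x)) N = scalar_on N c"
      unfolding scalar_on_def
    proof (rule restrict_ext)
      fix x assume x: "x \<in> N"
      then have "P (Y x) = 0" by (simp only: YP[symmetric] N_iff Yalg)
      then show "perp P (Y x) = c *\<^sub>C x" using c[OF x] by (simp add: perp_def)
    qed
    ultimately show ?thesis using block_decomposition[OF P Yb] by (simp add: A_def)
  qed
  ultimately show ?thesis by blast
qed

text \<open>For the converse inclusion an operator is only known to commute with the projections of the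
  commutant; that this suffices is where the generation of commutants by projections is used.\<close>

theorem bicommutant_eq:
  "commutant UNIV (commutant UNIV X) =
    {block P A (zero_on N) (zero_on K) (scalar_on N c) |A c. A \<in> commutant K corner_projections}"
proof (intro equalityI subsetI)
  fix Y assume "Y \<in> commutant UNIV (commutant UNIV X)"
  then show "Y \<in> {block P A (zero_on N) (zero_on K) (scalar_on N c) |A c. A \<in> commutant K corner_projections}"
    using bicommutant_subset by blast
next
  fix Y assume "Y \<in> {block P A (zero_on N) (zero_on K) (scalar_on N c) |A c. A \<in> commutant K corner_projections}"
  then obtain A c where Y: "Y = block P A (zero_on N) (zero_on K) (scalar_on N c)"
    and A: "A \<in> commutant K corner_projections" by blast
  have Ab: "A \<in> bop K K" and AL: "\<And>L x. L \<in> commuting_projections \<Longrightarrow> A (L (P x)) = L (A (P x))"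
    using A unfolding commutant_corner_iff by blast+
  have Yx: "Y x = A (P x) + c *\<^sub>C perp P x" for x
    by (simp add: Y block_def zero_on_def scalar_on_def)
  have Yb: "Y \<in> bop UNIV UNIV"
    unfolding Y by (rule block_bop[OF P Ab zero_on_bop[OF N_closed K_closed] zero_on_bop[OF K_closed N_closed]
          scalar_on_bop[OF N_closed]])
  show "Y \<in> commutant UNIV (commutant UNIV X)"
  proof (rule commutant_generated_by_projections[OF X Yb])
    fix L x assume "L \<in> projections UNIV \<inter> commutant UNIV X"
    then have L: "L \<in> commuting_projections" by (simp add: commuting_projections_def)
    note Lalg = proj_algebra[OF commuting_projection[OF L]]
    have "A (P (L x)) = L (A (P x))" using AL[OF L, of x] by (simp add: commuting_P[OF L])
    then show "Y (L x) = L (Y x)" by (simp add: Yx Lalg perp_def commuting_P[OF L])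
  qed
qed

subsection \<open>Invariant subspace lattices and their operator algebras\<close>

lemma invariant_iff: "perp L \<circ> A \<circ> L = (\<lambda>_. 0) \<longleftrightarrow> (\<forall>x. L (A (L x)) = A (L x))"
  by (auto simp: fun_eq_iff perp_def)

text \<open>The two ways to lift the projections of the commutant on \<open>K\<close> to the whole space: by adding \<open>N\<close>,
  and by extending with zero.  The first is the form of \<open>S\<^sub>1\<close>, the second that of \<open>S\<^sub>2\<close>.\<close>

definition "lattice_above_kernel = {L \<in> commuting_projections. N \<subseteq> range L}"
definition "lattice_below_support = {L \<in> commuting_projections. range L \<subseteq> K}"

lemma above_iff: "L \<in> lattice_above_kernel \<longleftrightarrow> L \<in> commuting_projections \<and> (\<forall>x. P x = 0 \<longrightarrow> L x = x)"
proof -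
  have "N \<subseteq> range L \<longleftrightarrow> (\<forall>x. P x = 0 \<longrightarrow> L x = x)" if "L \<in> commuting_projections"
    unfolding subset_iff N_iff in_range_proj[OF commuting_projection[OF that]] ..
  then show ?thesis by (auto simp: lattice_above_kernel_def)
qed

lemma below_iff: "L \<in> lattice_below_support \<longleftrightarrow> L \<in> commuting_projections \<and> (\<forall>x. L x = x \<longrightarrow> P x = x)"
proof -
  have "range L \<subseteq> K \<longleftrightarrow> (\<forall>x. L x = x \<longrightarrow> P x = x)" if "L \<in> commuting_projections"
    unfolding subset_iff K_iff in_range_proj[OF commuting_projection[OF that]] ..
  then show ?thesis by (auto simp: lattice_below_support_def)
qed

lemma cut_below: "(\<lambda>x. L (P x)) \<in> lattice_below_support" if L: "L \<in> commuting_projections"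
  unfolding below_iff
proof (intro conjI allI impI commuting_cut[OF L])
  fix x assume x: "L (P x) = x"
  have "P (L (P x)) = L (P x)" by (simp only: commuting_P[OF L, symmetric] Palg(5))
  then show "P x = x" by (simp only: x)
qed

text \<open>\<^term>\<open>perp (\<lambda>x. perp L (P x))\<close> is the join of \<^term>\<open>\<lambda>x. L (P x)\<close> with the projection onto
  the common kernel.\<close>

lemma join_above: "perp (\<lambda>x. perp L (P x)) \<in> lattice_above_kernel" if L: "L \<in> commuting_projections"
  unfolding above_iff using commuting_perp[OF commuting_cut[OF commuting_perp[OF L]]]
  by (simp add: perp_def proj_algebra[OF commuting_projection[OF L]])

lemma corner_projections_above: "(\<lambda>L. restrict L K) ` lattice_above_kernel = corner_projections"
proof
  show "(\<lambda>L. restrict L K) ` lattice_above_kernel \<subseteq> corner_projections"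
    by (auto simp: corner_projections_def above_iff)
  show "corner_projections \<subseteq> (\<lambda>L. restrict L K) ` lattice_above_kernel"
  proof
    fix p assume "p \<in> corner_projections"
    then obtain L where L: "L \<in> commuting_projections" and p: "p = restrict L K"
      by (auto simp: corner_projections_def)
    have "p = restrict (perp (\<lambda>x. perp L (P x))) K"
      unfolding p by (rule restrict_ext) (simp add: K_iff perp_def)
    then show "p \<in> (\<lambda>L. restrict L K) ` lattice_above_kernel" using join_above[OF L] by blast
  qed
qed

lemma corner_projections_below: "(\<lambda>L. restrict L K) ` lattice_below_support = corner_projections"
proof
  show "(\<lambda>L. restrict L K) ` lattice_below_support \<subseteq> corner_projections"
    by (auto simp: corner_projections_def below_iff)
  show "corner_projections \<subseteq> (\<lambda>L. restrict L K) ` lattice_below_support"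
  proof
    fix p assume "p \<in> corner_projections"
    then obtain L where L: "L \<in> commuting_projections" and p: "p = restrict L K"
      by (auto simp: corner_projections_def)
    have "p = restrict (\<lambda>x. L (P x)) K"
      unfolding p by (rule restrict_ext) (simp add: K_iff)
    then show "p \<in> (\<lambda>L. restrict L K) ` lattice_below_support" using cut_below[OF L] by blast
  qed
qed

lemma Alg_iff:
  "Y \<in> Alg S \<longleftrightarrow> Y \<in> bop UNIV UNIV \<and> (\<forall>L\<in>S. \<forall>x. L (Y (L x)) = Y (L x))"
  by (simp add: Alg_def invariant_iff)

text \<open>Invariance under the projections of the commutant includes invariance under their
  complements, which turns invariance into commutation.\<close>

lemma compression_in_commutant:
  assumes Y: "Y \<in> bop UNIV UNIV"
    and inv: "\<And>L x. L \<in> commuting_projections \<Longrightarrow> P x = x \<Longrightarrow> L x = x \<Longrightarrow> L (P (Y x)) = P (Y x)"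
  shows "restrict (\<lambda>x. P (Y x)) K \<in> commutant K corner_projections"
  unfolding commutant_corner_iff
proof (intro conjI ballI allI)
  show "restrict (\<lambda>x. P (Y x)) K \<in> bop K K" by (rule corner_bop[OF P P Y])
  fix L x assume L: "L \<in> commuting_projections"
  note Lalg = proj_algebra[OF commuting_projection[OF L]]
  have LK: "P (L (P x)) = L (P x)" by (simp add: commuting_P[OF L, symmetric] Palg)
  have 1: "L (P (Y (L (P x)))) = P (Y (L (P x)))" by (rule inv[OF L LK]) (simp add: Lalg)
  have "perp L (P (Y (P x - L (P x)))) = P (Y (P x - L (P x)))"
    by (rule inv[OF commuting_perp[OF L]]) (simp_all add: Palg LK perp_def Lalg)
  then have "L (P (Y (P x - L (P x)))) = 0" by (simp add: perp_def)
  then have "L (P (Y (P x))) = P (Y (L (P x)))" by (simp add: bop_algebra[OF Y] Palg Lalg 1)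
  moreover have "L (P x) \<in> K" by (simp only: K_iff LK)
  ultimately show "restrict (\<lambda>x. P (Y x)) K (L (P x)) = L (restrict (\<lambda>x. P (Y x)) K (P x))" by simp
qed

text \<open>The lattice contains the projection onto \<open>N\<close>, so \<open>N\<close> is invariant and the upper right corner
  vanishes; since every element of the lattice contains \<open>N\<close>, the lower row is arbitrary.\<close>

theorem Alg_above:
  "Alg lattice_above_kernel = {block P A (zero_on N) C D |A C D.
     A \<in> commutant K corner_projections \<and> C \<in> bop K N \<and> D \<in> bop N N}"
proof (intro equalityI subsetI)
  fix Y assume "Y \<in> Alg lattice_above_kernel"
  then have Y: "Y \<in> bop UNIV UNIV"
    and inv: "\<And>L x. L \<in> lattice_above_kernel \<Longrightarrow> L (Y (L x)) = Y (L x)" by (auto simp: Alg_iff)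
  have "perp P \<in> lattice_above_kernel"
    using commuting_perp[OF P_commuting] by (simp add: above_iff perp_def)
  then have "P (Y x) = 0" if "P x = 0" for x using inv[of "perp P" x] that by (simp add: perp_def)
  then have "restrict (\<lambda>x. P (Y x)) N = zero_on N"
    by (intro restrict_eq_zero_on) (simp only: N_iff)
  moreover have "restrict (\<lambda>x. P (Y x)) K \<in> commutant K corner_projections"
  proof (rule compression_in_commutant[OF Y])
    fix L x assume L: "L \<in> commuting_projections" and x: "P x = x" "L x = x"
    \<comment> \<open>the join of \<open>L P\<close> and \<open>N\<close> is an element of the lattice that fixes \<open>x\<close>\<close>
    from inv[OF join_above[OF L], of x] have "P (Y x) = L (P (Y x))" by (simp add: perp_def x)
    then show "L (P (Y x)) = P (Y x)" ..
  qed
  ultimately show "Y \<in> {block P A (zero_on N) C D |A C D.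
     A \<in> commutant K corner_projections \<and> C \<in> bop K N \<and> D \<in> bop N N}"
    using block_decomposition[OF P Y] corner_bop[OF P PN Y] corner_bop[OF PN PN Y]
    by (intro CollectI exI conjI) simp_all
next
  fix Y assume "Y \<in> {block P A (zero_on N) C D |A C D.
     A \<in> commutant K corner_projections \<and> C \<in> bop K N \<and> D \<in> bop N N}"
  then obtain A C D where Y: "Y = block P A (zero_on N) C D" and A: "A \<in> commutant K corner_projections"
    and C: "C \<in> bop K N" and D: "D \<in> bop N N" by blast
  have Ab: "A \<in> bop K K" using A by (simp only: commutant_corner_iff)
  have Yb: "Y \<in> bop UNIV UNIV"
    unfolding Y by (rule block_bop[OF P Ab zero_on_bop[OF N_closed K_closed] C D])
  have Yx: "Y x = A (P x) + (C (P x) + D (perp P x))" for x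
    by (simp add: Y block_def zero_on_def)
  have "L (Y (L x)) = Y (L x)" if L: "L \<in> lattice_above_kernel" for L x
  proof -
    have Lc: "L \<in> commuting_projections" and LN: "\<And>x. x \<in> N \<Longrightarrow> L x = x"
      using L by (auto simp: above_iff N_iff)
    note Lalg = proj_algebra[OF commuting_projection[OF Lc]]
    have "C (P (L x)) \<in> N" by (rule bopD(1)[OF C rangeI])
    moreover have "D (perp P (L x)) \<in> N" by (rule bopD(1)[OF D rangeI])
    moreover have "A (L (P x)) = L (A (P x))" using A Lc unfolding commutant_corner_iff by blast
    ultimately show ?thesis by (simp add: Yx Lalg LN commuting_P[OF Lc, symmetric])
  qed
  then show "Y \<in> Alg lattice_above_kernel" using Yb by (simp add: Alg_iff)
qed

text \<open>Here \<open>K\<close> belongs to the lattice and contains its other elements, so that the lower left corner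
  vanishes and the second column is arbitrary.\<close>

theorem Alg_below:
  "Alg lattice_below_support = {block P B C (zero_on K) D |B C D.
     B \<in> commutant K corner_projections \<and> C \<in> bop N K \<and> D \<in> bop N N}"
proof (intro equalityI subsetI)
  fix Y assume "Y \<in> Alg lattice_below_support"
  then have Y: "Y \<in> bop UNIV UNIV"
    and inv: "\<And>L x. L \<in> lattice_below_support \<Longrightarrow> L (Y (L x)) = Y (L x)" by (auto simp: Alg_iff)
  have "P \<in> lattice_below_support"
    using P_commuting by (simp add: below_iff)
  then have "P (Y x) = Y x" if "P x = x" for x using inv[of P x] that by simp
  then have "restrict (\<lambda>x. perp P (Y x)) K = zero_on K"
    by (intro restrict_eq_zero_on) (simp only: perp_def K_iff diff_self)
  moreover have "restrict (\<lambda>x. P (Y x)) K \<in> commutant K corner_projections"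
  proof (rule compression_in_commutant[OF Y])
    fix L x assume L: "L \<in> commuting_projections" and x: "P x = x" "L x = x"
    from inv[OF cut_below[OF L], of x] have *: "L (P (Y x)) = Y x" by (simp add: x)
    have "P (L (P (Y x))) = L (P (Y x))" by (simp only: commuting_P[OF L, symmetric] Palg(5))
    with * show "L (P (Y x)) = P (Y x)" by simp
  qed
  ultimately show "Y \<in> {block P B C (zero_on K) D |B C D.
     B \<in> commutant K corner_projections \<and> C \<in> bop N K \<and> D \<in> bop N N}"
    using block_decomposition[OF P Y] corner_bop[OF PN P Y] corner_bop[OF PN PN Y]
    by (intro CollectI exI conjI) simp_all
next
  fix Y assume "Y \<in> {block P B C (zero_on K) D |B C D.
     B \<in> commutant K corner_projections \<and> C \<in> bop N K \<and> D \<in> bop N N}"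
  then obtain B C D where Y: "Y = block P B C (zero_on K) D" and B: "B \<in> commutant K corner_projections"
    and C: "C \<in> bop N K" and D: "D \<in> bop N N" by blast
  have Bb: "B \<in> bop K K" using B by (simp only: commutant_corner_iff)
  have Yb: "Y \<in> bop UNIV UNIV"
    unfolding Y by (rule block_bop[OF P Bb C zero_on_bop[OF K_closed N_closed] D])
  have Yx: "Y x = B x" if x: "P x = x" for x
  proof -
    have "perp P x = 0" by (simp add: perp_def x)
    moreover have "x \<in> K" by (simp only: K_iff x)
    moreover have "C 0 = 0" "D 0 = 0"
      using bop_algebra(1)[OF bop_extend[OF C PN]] bop_algebra(1)[OF bop_extend[OF D PN]]
      by (simp_all add: proj_algebra(1)[OF PN])
    ultimately show ?thesis by (simp add: Y block_def zero_on_def x)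
  qed
  have "L (Y (L x)) = Y (L x)" if L: "L \<in> lattice_below_support" for L x
  proof -
    have Lc: "L \<in> commuting_projections" and LK: "\<And>x. L x = x \<Longrightarrow> P x = x"
      using L by (auto simp: below_iff)
    note Lalg = proj_algebra[OF commuting_projection[OF Lc]]
    have PL: "P (L x) = L x" by (rule LK) (simp add: Lalg)
    have "B (L (P (L x))) = L (B (P (L x)))" using B Lc unfolding commutant_corner_iff by blast
    then show ?thesis by (simp add: Yx[OF PL] PL Lalg)
  qed
  then show "Y \<in> Alg lattice_below_support" using Yb by (simp add: Alg_iff)
qed

lemma Lat_eq_commuting: "Lat X = commuting_projections"
proof (intro equalityI subsetI)
  fix L assume "L \<in> Lat X"
  then have L: "L \<in> projections UNIV" and inv: "\<And>T x. T \<in> X \<Longrightarrow> L (T (L x)) = T (L x)"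
    by (auto simp: Lat_def invariant_iff)
  have stable: "T x \<in> range L" if "T \<in> X" "x \<in> range L" for T x
    using inv[OF that(1), of x] that(2) by (simp add: in_range_proj[OF L])
  have "T (L x) = L (T x)" if T: "T \<in> X" for T x
    by (rule commute_of_reducing[OF L X_bop[OF T] adjoint_op(2)[OF X_bop[OF T]]])
      (rule stable[OF T] stable[OF X_adjoint[OF T]]; assumption)+
  then show "L \<in> commuting_projections" using L by (simp add: commuting_iff)
next
  fix L assume L: "L \<in> commuting_projections"
  then show "L \<in> Lat X"
    using proj_algebra(5)[OF commuting_projection[OF L]] unfolding commuting_iff by (simp add: Lat_def invariant_iff)
qed

theorem commuting_projections_blocks:
  "commuting_projections = {block P L1 (zero_on N) (zero_on K) L2 |L1 L2.
     L1 \<in> corner_projections \<and> L2 \<in> projections N}"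
proof (intro equalityI subsetI)
  fix L assume L: "L \<in> commuting_projections"
  note Lp = commuting_projection[OF L]
  note Lalg = proj_algebra[OF Lp]
  have LN: "L x \<in> N" if "x \<in> N" for x
    using that by (simp only: N_iff commuting_P[OF L, symmetric] Lalg)
  have "restrict L K \<in> corner_projections" using L by (auto simp: corner_projections_def)
  moreover have "restrict L N \<in> projections N"
    using bop_restrict[OF projD(1)[OF Lp] N_closed LN] LN
    by (simp add: projections_def Lalg projD(3)[OF Lp] del: image_iff)
  moreover have "L = block P (restrict L K) (zero_on N) (zero_on K) (restrict L N)"
  proof
    fix x
    have "L x = L (P x) + L (perp P x)" by (simp add: Lalg(2)[symmetric] proj_add_perp)
    then show "L x = block P (restrict L K) (zero_on N) (zero_on K) (restrict L N) x"
      by (simp add: block_def zero_on_def)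
  qed
  ultimately show "L \<in> {block P L1 (zero_on N) (zero_on K) L2 |L1 L2.
     L1 \<in> corner_projections \<and> L2 \<in> projections N}" by blast
next
  fix Y assume "Y \<in> {block P L1 (zero_on N) (zero_on K) L2 |L1 L2.
     L1 \<in> corner_projections \<and> L2 \<in> projections N}"
  then obtain L L2 where Y: "Y = block P (restrict L K) (zero_on N) (zero_on K) L2"
    and L: "L \<in> commuting_projections" and L2: "L2 \<in> projections N" by (auto simp: corner_projections_def)
  note Lp = commuting_projection[OF L]
  note Lalg = proj_algebra[OF Lp]
  have L2b: "L2 \<in> bop N N" and L2i: "\<And>x. x \<in> N \<Longrightarrow> L2 (L2 x) = L2 x"
    and L2s: "\<And>x y. x \<in> N \<Longrightarrow> y \<in> N \<Longrightarrow> cinner (L2 x) y = cinner x (L2 y)"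
    using L2 by (auto simp: projections_def)
  have L2N: "P (L2 (perp P x)) = 0" for x using bopD(1)[OF L2b rangeI] by (simp only: N_iff)
  then have L2N': "perp P (L2 (perp P x)) = L2 (perp P x)" for x by (simp add: perp_def)
  have L20: "L2 0 = 0" using bop_algebra(1)[OF bop_extend[OF L2b PN]] by (simp add: proj_algebra(1)[OF PN])
  have Yx: "Y x = L (P x) + L2 (perp P x)" for x
    by (simp add: Y block_def zero_on_def)
  have Yb: "Y \<in> bop UNIV UNIV"
    unfolding Y by (rule block_bop[OF P restrict_corner_bop[OF L] zero_on_bop[OF N_closed K_closed]
          zero_on_bop[OF K_closed N_closed] L2b])
  have PY: "P (Y x) = L (P x)" for x by (simp add: Yx Palg L2N commuting_P[OF L])
  then have pY: "perp P (Y x) = L2 (perp P x)" for x by (simp add: perp_def Yx)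
  have "Y (Y x) = Y x" for x
    by (subst Yx) (simp add: PY pY Lalg L2i, simp add: Yx)
  moreover have "cinner (Y x) y = cinner x (Y y)" for x y
  proof -
    have "cinner (L2 (perp P x)) y = cinner (perp P (L2 (perp P x))) y" by (simp only: L2N')
    also have "\<dots> = cinner (L2 (perp P x)) (perp P y)" by (rule projD(3)[OF PN])
    also have "\<dots> = cinner (perp P x) (L2 (perp P y))" by (rule L2s) simp_all
    also have "\<dots> = cinner x (perp P (L2 (perp P y)))" by (rule projD(3)[OF PN])
    also have "\<dots> = cinner x (L2 (perp P y))" by (simp only: L2N')
    finally have "cinner (L2 (perp P x)) y = cinner x (L2 (perp P y))" .
    moreover have "cinner (L (P x)) y = cinner x (L (P y))"
      by (simp add: projD(3)[OF commuting_projection[OF commuting_cut[OF L]]])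
    ultimately show ?thesis by (simp add: Yx cinner_algebra)
  qed
  ultimately have "Y \<in> projections UNIV" using Yb by (simp add: projections_def)
  moreover have "Y (T x) = T (Y x)" if T: "T \<in> X" for T x
  proof -
    have "Y (T x) = L (T x)" by (simp add: Yx P_X[OF T] perp_def L20)
    also have "\<dots> = T (L x)" using L T unfolding commuting_iff by blast
    also have "\<dots> = T (P (Y x))" by (simp add: PY commuting_P[OF L] X_P[OF T])
    finally show ?thesis by (simp add: X_P[OF T])
  qed
  ultimately show "Y \<in> commuting_projections" by (simp add: commuting_iff)
qed

end

section \<open>Suprema and infima in lattices of projections\<close>

lemma proj_order_simps [simp]:
  "carrier (proj_order S) = S" "x \<sqsubseteq>\<^bsub>proj_order S\<^esub> y \<longleftrightarrow> range x \<subseteq> range y"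
  "x .=\<^bsub>proj_order S\<^esub> y \<longleftrightarrow> x = y"
  by (simp_all add: proj_order_def)

lemma proj_order_partial_order:
  assumes S: "S \<subseteq> projections UNIV"
  shows "partial_order (proj_order S)"
proof
  show "(.=\<^bsub>proj_order S\<^esub>) = (=)" by (simp add: proj_order_def)
  fix x y assume "x \<in> carrier (proj_order S)" "y \<in> carrier (proj_order S)"
    and le: "x \<sqsubseteq>\<^bsub>proj_order S\<^esub> y" "y \<sqsubseteq>\<^bsub>proj_order S\<^esub> x"
  then have "x \<in> projections UNIV" "y \<in> projections UNIV" using S by auto
  moreover have "range x = range y" using le unfolding proj_order_simps by (rule equalityI)
  ultimately show "x .=\<^bsub>proj_order S\<^esub> y" unfolding proj_order_simps by (rule proj_cong)
qed (unfold proj_order_simps, blast+)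

text \<open>Least upper and greatest lower bounds in terms of ranges; with them, suprema in different
  lattices of projections can be compared without unfolding their definition by choice.\<close>

definition proj_lub :: "('a::complex_hilbert \<Rightarrow> 'a) set \<Rightarrow> ('a \<Rightarrow> 'a) set \<Rightarrow> ('a \<Rightarrow> 'a) \<Rightarrow> bool"
  where "proj_lub S F x \<longleftrightarrow> x \<in> S \<and> (\<forall>y\<in>F. range y \<subseteq> range x) \<and>
    (\<forall>z\<in>S. (\<forall>y\<in>F. range y \<subseteq> range z) \<longrightarrow> range x \<subseteq> range z)"

definition proj_glb :: "('a::complex_hilbert \<Rightarrow> 'a) set \<Rightarrow> ('a \<Rightarrow> 'a) set \<Rightarrow> ('a \<Rightarrow> 'a) \<Rightarrow> bool"
  where "proj_glb S F x \<longleftrightarrow> x \<in> S \<and> (\<forall>y\<in>F. range x \<subseteq> range y) \<and>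
    (\<forall>z\<in>S. (\<forall>y\<in>F. range z \<subseteq> range y) \<longrightarrow> range z \<subseteq> range x)"

lemma is_lub_iff:
  fixes L (structure)
  shows "F \<subseteq> carrier L \<Longrightarrow> is_lub L x F \<longleftrightarrow>
    x \<in> carrier L \<and> (\<forall>y\<in>F. y \<sqsubseteq> x) \<and> (\<forall>z\<in>carrier L. (\<forall>y\<in>F. y \<sqsubseteq> z) \<longrightarrow> x \<sqsubseteq> z)"
  unfolding least_def Upper_def by (simp add: Int_absorb2) blast

lemma is_glb_iff:
  fixes L (structure)
  shows "F \<subseteq> carrier L \<Longrightarrow> is_glb L x F \<longleftrightarrow>
    x \<in> carrier L \<and> (\<forall>y\<in>F. x \<sqsubseteq> y) \<and> (\<forall>z\<in>carrier L. (\<forall>y\<in>F. z \<sqsubseteq> y) \<longrightarrow> z \<sqsubseteq> x)"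
  unfolding greatest_def Lower_def by (simp add: Int_absorb2) blast

lemma is_lub_proj_order: "F \<subseteq> S \<Longrightarrow> is_lub (proj_order S) x F \<longleftrightarrow> proj_lub S F x"
  unfolding proj_lub_def using is_lub_iff[of F "proj_order S" x] by (simp only: proj_order_simps)

lemma is_glb_proj_order: "F \<subseteq> S \<Longrightarrow> is_glb (proj_order S) x F \<longleftrightarrow> proj_glb S F x"
  unfolding proj_glb_def using is_glb_iff[of F "proj_order S" x] by (simp only: proj_order_simps)

lemma proj_lub_upper:
  assumes "proj_lub S F x"
  shows "x \<in> S" "\<forall>y\<in>F. range y \<subseteq> range x"
proof -
  show "x \<in> S" using assms unfolding proj_lub_def by (elim conjE)
  show "\<forall>y\<in>F. range y \<subseteq> range x" using assms unfolding proj_lub_def by (elim conjE)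
qed

lemma proj_glb_lower:
  assumes "proj_glb S F x"
  shows "x \<in> S" "\<forall>y\<in>F. range x \<subseteq> range y"
proof -
  show "x \<in> S" using assms unfolding proj_glb_def by (elim conjE)
  show "\<forall>y\<in>F. range x \<subseteq> range y" using assms unfolding proj_glb_def by (elim conjE)
qed

lemma proj_lub_least:
  assumes x: "proj_lub S F x" and z: "z \<in> S" "\<forall>y\<in>F. range y \<subseteq> range z"
  shows "range x \<subseteq> range z"
proof -
  have "\<forall>z\<in>S. (\<forall>y\<in>F. range y \<subseteq> range z) \<longrightarrow> range x \<subseteq> range z"
    using x unfolding proj_lub_def by (elim conjE)
  then have "(\<forall>y\<in>F. range y \<subseteq> range z) \<longrightarrow> range x \<subseteq> range z" using z(1) by (rule bspec)
  then show ?thesis using z(2) by (rule mp)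
qed

lemma proj_glb_greatest:
  assumes x: "proj_glb S F x" and z: "z \<in> S" "\<forall>y\<in>F. range z \<subseteq> range y"
  shows "range z \<subseteq> range x"
proof -
  have "\<forall>z\<in>S. (\<forall>y\<in>F. range z \<subseteq> range y) \<longrightarrow> range z \<subseteq> range x"
    using x unfolding proj_glb_def by (elim conjE)
  then have "(\<forall>y\<in>F. range z \<subseteq> range y) \<longrightarrow> range z \<subseteq> range x" using z(1) by (rule bspec)
  then show ?thesis using z(2) by (rule mp)
qed

lemma proj_lub_unique:
  assumes S: "S \<subseteq> projections UNIV" and x: "proj_lub S F x" and y: "proj_lub S F y"
  shows "x = y"
proof -
  note x' = proj_lub_upper[OF x] and y' = proj_lub_upper[OF y]
  show ?thesis
    by (rule proj_cong[OF subsetD[OF S x'(1)] subsetD[OF S y'(1)]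
        equalityI[OF proj_lub_least[OF x y'] proj_lub_least[OF y x']]])
qed

lemma proj_glb_unique:
  assumes S: "S \<subseteq> projections UNIV" and x: "proj_glb S F x" and y: "proj_glb S F y"
  shows "x = y"
proof -
  note x' = proj_glb_lower[OF x] and y' = proj_glb_lower[OF y]
  show ?thesis
    by (rule proj_cong[OF subsetD[OF S x'(1)] subsetD[OF S y'(1)]
        equalityI[OF proj_glb_greatest[OF y x'] proj_glb_greatest[OF x y']]])
qed

lemma sup_proj_order:
  assumes S: "S \<subseteq> projections UNIV" and F: "F \<subseteq> S" and x: "proj_lub S F x"
  shows "\<Squnion>\<^bsub>proj_order S\<^esub> F = x"
  unfolding Lattice.sup_def is_lub_proj_order[OF F]
  by (rule some_equality[of "proj_lub S F", OF x proj_lub_unique[OF S _ x]])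

lemma inf_proj_order:
  assumes S: "S \<subseteq> projections UNIV" and F: "F \<subseteq> S" and x: "proj_glb S F x"
  shows "\<Sqinter>\<^bsub>proj_order S\<^esub> F = x"
  unfolding Lattice.inf_def is_glb_proj_order[OF F]
  by (rule some_equality[of "proj_glb S F", OF x proj_glb_unique[OF S _ x]])

lemma bottom_proj_order:
  assumes S: "S \<subseteq> projections UNIV" and x: "x \<in> S" "\<And>y. y \<in> S \<Longrightarrow> range x \<subseteq> range y"
  shows "\<bottom>\<^bsub>proj_order S\<^esub> = x"
proof -
  have "is_lub (proj_order S) y {} \<longleftrightarrow> least (proj_order S) y (carrier (proj_order S))" for y by simp
  then have "\<bottom>\<^bsub>proj_order S\<^esub> = \<Squnion>\<^bsub>proj_order S\<^esub> {}" by (simp add: bottom_def Lattice.sup_def)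
  also have "\<dots> = x" by (rule sup_proj_order[OF S]) (use x in \<open>simp_all add: proj_lub_def\<close>)
  finally show ?thesis .
qed

lemma top_proj_order:
  assumes S: "S \<subseteq> projections UNIV" and x: "x \<in> S" "\<And>y. y \<in> S \<Longrightarrow> range y \<subseteq> range x"
  shows "\<top>\<^bsub>proj_order S\<^esub> = x"
proof -
  have "is_glb (proj_order S) y {} \<longleftrightarrow> greatest (proj_order S) y (carrier (proj_order S))" for y by simp
  then have "\<top>\<^bsub>proj_order S\<^esub> = \<Sqinter>\<^bsub>proj_order S\<^esub> {}" by (simp add: top_def Lattice.inf_def)
  also have "\<dots> = x" by (rule inf_proj_order[OF S]) (use x in \<open>simp_all add: proj_glb_def\<close>)
  finally show ?thesis .
qed

definition join_proj :: "('a::complex_hilbert \<Rightarrow> 'a) set \<Rightarrow> 'a \<Rightarrow> 'a"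
  where "join_proj F = proj_onto (closure (complex_vector.span (\<Union>L\<in>F. range L)))"

definition meet_proj :: "('a::complex_hilbert \<Rightarrow> 'a) set \<Rightarrow> 'a \<Rightarrow> 'a"
  where "meet_proj F = proj_onto (\<Inter>L\<in>F. range L)"

lemma join_proj:
  shows "join_proj F \<in> projections UNIV"
    "range (join_proj F) = closure (complex_vector.span (\<Union>L\<in>F. range L))"
  unfolding join_proj_def by (rule proj_onto[OF closed_subspace_closure_span])+

lemma join_proj_upper: "L \<in> F \<Longrightarrow> range L \<subseteq> range (join_proj F)"
  unfolding join_proj(2) by (rule subset_trans[OF _ closure_span_superset]) blast

lemma join_proj_least:
  "M \<in> projections UNIV \<Longrightarrow> (\<And>L. L \<in> F \<Longrightarrow> range L \<subseteq> range M) \<Longrightarrow> range (join_proj F) \<subseteq> range M"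
  unfolding join_proj(2) by (intro closure_span_minimal closed_subspace_range UN_least)

lemma meet_proj:
  assumes "F \<subseteq> projections UNIV"
  shows "meet_proj F \<in> projections UNIV" "range (meet_proj F) = (\<Inter>L\<in>F. range L)"
proof -
  have "closed_subspace (\<Inter>L\<in>F. range L)"
    using assms by (intro closed_subspace_INT closed_subspace_range) blast
  from proj_onto[OF this] show "meet_proj F \<in> projections UNIV" "range (meet_proj F) = (\<Inter>L\<in>F. range L)"
    unfolding meet_proj_def .
qed

lemma proj_lub_join:
  assumes "S \<subseteq> projections UNIV" "join_proj F \<in> S"
  shows "proj_lub S F (join_proj F)"
  unfolding proj_lub_def
proof (intro conjI ballI impI assms(2) join_proj_upper)
  fix z assume z: "z \<in> S" "\<forall>y\<in>F. range y \<subseteq> range z"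
  show "range (join_proj F) \<subseteq> range z"
    by (rule join_proj_least[OF subsetD[OF assms(1) z(1)] bspec[OF z(2)]])
qed

lemma proj_glb_meet:
  fixes F :: "('a::complex_hilbert \<Rightarrow> 'a) set"
  assumes "F \<subseteq> projections UNIV" "meet_proj F \<in> S"
  shows "proj_glb S F (meet_proj F)"
  unfolding proj_glb_def meet_proj(2)[OF assms(1)]
proof (intro conjI ballI impI assms(2))
  show "(\<Inter>L\<in>F. range L) \<subseteq> range y" if "y \<in> F" for y by (rule INT_lower[OF that])
  fix z :: "'a \<Rightarrow> 'a" assume z: "\<forall>y\<in>F. range z \<subseteq> range y"
  show "range z \<subseteq> (\<Inter>L\<in>F. range L)" by (rule INT_greatest) (rule bspec[OF z])
qed

lemma sup_proj_lattice: "F \<subseteq> projections UNIV \<Longrightarrow> \<Squnion>\<^bsub>proj_lattice\<^esub> F = join_proj F"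
  by (intro sup_proj_order proj_lub_join join_proj subset_refl)

lemma inf_proj_lattice: "F \<subseteq> projections UNIV \<Longrightarrow> \<Sqinter>\<^bsub>proj_lattice\<^esub> F = meet_proj F"
  by (intro inf_proj_order proj_glb_meet meet_proj subset_refl)

lemma complete_lattice_proj_order:
  assumes S: "S \<subseteq> projections UNIV"
    and "\<And>F. F \<subseteq> S \<Longrightarrow> \<exists>x. proj_lub S F x" "\<And>F. F \<subseteq> S \<Longrightarrow> \<exists>x. proj_glb S F x"
  shows "complete_lattice (proj_order S)"
proof -
  interpret partial_order "proj_order S" by (rule proj_order_partial_order[OF S])
  show ?thesis
    using assms(2,3) by (intro complete_latticeI) (simp_all add: is_lub_proj_order is_glb_proj_order)
qed

lemma proj_le_absorb:
  assumes L: "L \<in> projections UNIV" and M: "M \<in> projections UNIV" and le: "range L \<subseteq> range M"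
  shows "M (L x) = L x" "L (M x) = L x"
proof -
  show 1: "M (L x) = L x" for x using le in_range_proj[OF M] by blast
  show "L (M x) = L x"
    by (rule cinner_eqI) (simp only: projD(3)[OF L] projD(3)[OF M] 1)
qed

lemma order_iso_sup_inf:
  assumes S: "S \<subseteq> projections UNIV" and S': "S' \<subseteq> projections UNIV"
    and clS: "complete_lattice (proj_order S)"
    and f: "bij_betw f S S'"
    and ord: "\<And>x y. x \<in> S \<Longrightarrow> y \<in> S \<Longrightarrow> range (f x) \<subseteq> range (f y) \<longleftrightarrow> range x \<subseteq> range y"
    and F: "F \<subseteq> S"
  shows "f (\<Squnion>\<^bsub>proj_order S\<^esub> F) = \<Squnion>\<^bsub>proj_order S'\<^esub> (f ` F)"
    "f (\<Sqinter>\<^bsub>proj_order S\<^esub> F) = \<Sqinter>\<^bsub>proj_order S'\<^esub> (f ` F)"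
proof -
  have fS: "f ` S = S'" using f by (simp add: bij_betw_def)
  then have fF: "f ` F \<subseteq> S'" using F by blast
  interpret complete_lattice "proj_order S" by (rule clS)
  obtain u where u: "proj_lub S F u" using sup_exists[of F] F is_lub_proj_order[OF F] by auto
  obtain l where l: "proj_glb S F l" using inf_exists[of F] F is_glb_proj_order[OF F] by auto
  have "proj_lub S' (f ` F) (f u)"
    unfolding proj_lub_def
  proof (intro conjI ballI impI)
    note u' = proj_lub_upper[OF u]
    show "f u \<in> S'" using u'(1) fS by blast
    show "range y \<subseteq> range (f u)" if y: "y \<in> f ` F" for y
    proof -
      obtain w where w: "w \<in> F" "y = f w" using y by blast
      show ?thesis unfolding w(2) by (rule iffD2[OF ord[OF subsetD[OF F w(1)] u'(1)] bspec[OF u'(2) w(1)]])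
    qed
    fix z assume "z \<in> S'" and z: "\<forall>y\<in>f ` F. range y \<subseteq> range z"
    then obtain w where w: "w \<in> S" "z = f w" using fS by blast
    have "\<forall>y\<in>F. range y \<subseteq> range w"
    proof
      fix y assume y: "y \<in> F"
      show "range y \<subseteq> range w"
        by (rule iffD1[OF ord[OF subsetD[OF F y] w(1)] bspec[OF z imageI[OF y], unfolded w(2)]])
    qed
    with w(1) have "range u \<subseteq> range w" by (rule proj_lub_least[OF u])
    then show "range (f u) \<subseteq> range z" unfolding w(2) by (rule iffD2[OF ord[OF u'(1) w(1)]])
  qed
  moreover have "proj_glb S' (f ` F) (f l)"
    unfolding proj_glb_def
  proof (intro conjI ballI impI)
    note l' = proj_glb_lower[OF l]
    show "f l \<in> S'" using l'(1) fS by blast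
    show "range (f l) \<subseteq> range y" if y: "y \<in> f ` F" for y
    proof -
      obtain w where w: "w \<in> F" "y = f w" using y by blast
      show ?thesis unfolding w(2) by (rule iffD2[OF ord[OF l'(1) subsetD[OF F w(1)]] bspec[OF l'(2) w(1)]])
    qed
    fix z assume "z \<in> S'" and z: "\<forall>y\<in>f ` F. range z \<subseteq> range y"
    then obtain w where w: "w \<in> S" "z = f w" using fS by blast
    have "\<forall>y\<in>F. range w \<subseteq> range y"
    proof
      fix y assume y: "y \<in> F"
      show "range w \<subseteq> range y"
        by (rule iffD1[OF ord[OF w(1) subsetD[OF F y]] bspec[OF z imageI[OF y], unfolded w(2)]])
    qed
    with w(1) have "range w \<subseteq> range l" by (rule proj_glb_greatest[OF l])
    then show "range z \<subseteq> range (f l)" unfolding w(2) by (rule iffD2[OF ord[OF w(1) l'(1)]])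
  qed
  ultimately show "f (\<Squnion>\<^bsub>proj_order S\<^esub> F) = \<Squnion>\<^bsub>proj_order S'\<^esub> (f ` F)"
    "f (\<Sqinter>\<^bsub>proj_order S\<^esub> F) = \<Sqinter>\<^bsub>proj_order S'\<^esub> (f ` F)"
    using sup_proj_order[OF S F u] inf_proj_order[OF S F l] sup_proj_order[OF S' fF] inf_proj_order[OF S' fF]
    by simp_all
qed

section \<open>The ortho-lattices of a self-adjoint set\<close>

context selfadjoint_corner
begin

lemma commuting_of_invariant:
  assumes L: "L \<in> projections UNIV" and inv: "\<And>T x. T \<in> X \<Longrightarrow> x \<in> range L \<Longrightarrow> T x \<in> range L"
  shows "L \<in> commuting_projections"
proof -
  have "L (T x) = T (L x)" if T: "T \<in> X" for T x
    by (rule commute_of_reducing[OF L X_bop[OF T] adjoint_op(2)[OF X_bop[OF T]], symmetric])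
      (rule inv[OF T] inv[OF X_adjoint[OF T]]; assumption)+
  then show ?thesis using L by (simp add: commuting_iff)
qed

lemma commuting_invariant:
  assumes L: "L \<in> commuting_projections" and T: "T \<in> X" and x: "x \<in> range L"
  shows "T x \<in> range L"
proof -
  note iff = in_range_proj[OF commuting_projection[OF L]]
  have "L (T x) = T (L x)" using L T unfolding commuting_iff by blast
  also have "L x = x" using x by (simp only: iff)
  finally show ?thesis by (simp only: iff)
qed

lemma commuting_meet:
  assumes F: "F \<subseteq> commuting_projections"
  shows "meet_proj F \<in> commuting_projections"
proof -
  have Fp: "F \<subseteq> projections UNIV" using F commuting_projection by blast
  show ?thesis
  proof (rule commuting_of_invariant[OF meet_proj(1)[OF Fp]], unfold meet_proj(2)[OF Fp], rule INT_I)
    fix T x L assume T: "T \<in> X" and x: "x \<in> (\<Inter>L\<in>F. range L)" and L: "L \<in> F"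
    show "T x \<in> range L" by (rule commuting_invariant[OF subsetD[OF F L] T INT_D[OF x L]])
  qed
qed

lemma commuting_join:
  assumes F: "F \<subseteq> commuting_projections"
  shows "join_proj F \<in> commuting_projections"
proof (rule commuting_of_invariant[OF join_proj(1)])
  fix T x assume T: "T \<in> X" and x: "x \<in> range (join_proj F)"
  have "range (join_proj F) \<subseteq> {x. T x \<in> range (join_proj F)}"
    unfolding join_proj(2)[of F]
  proof (rule closure_span_minimal[OF closed_subspace_vimage[OF X_bop[OF T] closed_subspace_closure_span]],
      fold join_proj(2)[of F], rule subsetI)
    fix y assume "y \<in> (\<Union>L\<in>F. range L)"
    then obtain L where L: "L \<in> F" "y \<in> range L" by blast
    have "T y \<in> range L" by (rule commuting_invariant[OF subsetD[OF F L(1)] T L(2)])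
    then show "y \<in> {x. T x \<in> range (join_proj F)}" using join_proj_upper[OF L(1)] by blast
  qed
  then show "T x \<in> range (join_proj F)" using x by blast
qed

lemma id_commuting: "(\<lambda>x. x) \<in> commuting_projections"
  by (simp add: commuting_iff projections_def bop_id)

lemma zero_commuting: "(\<lambda>_. 0) \<in> commuting_projections"
  using commuting_perp[OF id_commuting] by (simp add: perp_def)

lemma above_projections: "lattice_above_kernel \<subseteq> projections UNIV"
  using commuting_projection by (auto simp: above_iff)

lemma below_projections: "lattice_below_support \<subseteq> projections UNIV"
  using commuting_projection by (auto simp: below_iff)

lemma above_meet:
  assumes F: "F \<subseteq> lattice_above_kernel"
  shows "meet_proj F \<in> lattice_above_kernel"
proof -
  have Fp: "F \<subseteq> projections UNIV" using F above_projections by blast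
  have "meet_proj F \<in> commuting_projections"
    using F by (intro commuting_meet) (auto simp: lattice_above_kernel_def)
  moreover have "N \<subseteq> range (meet_proj F)"
    unfolding meet_proj(2)[OF Fp] by (rule INT_greatest) (use F in \<open>unfold lattice_above_kernel_def, blast\<close>)
  ultimately show ?thesis by (simp add: lattice_above_kernel_def)
qed

lemma above_join:
  assumes F: "F \<subseteq> lattice_above_kernel" and ne: "F \<noteq> {}"
  shows "join_proj F \<in> lattice_above_kernel"
proof -
  obtain L where L: "L \<in> F" using ne by blast
  have "join_proj F \<in> commuting_projections"
    using F by (intro commuting_join) (auto simp: lattice_above_kernel_def)
  moreover have "N \<subseteq> range L" using F L unfolding lattice_above_kernel_def by blast
  then have "N \<subseteq> range (join_proj F)" using join_proj_upper[OF L] by (rule subset_trans)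
  ultimately show ?thesis by (simp add: lattice_above_kernel_def)
qed

lemma kernel_above: "perp P \<in> lattice_above_kernel"
  using commuting_perp[OF P_commuting] by (simp add: lattice_above_kernel_def)

lemma id_above: "(\<lambda>x. x) \<in> lattice_above_kernel"
  using id_commuting by (simp add: lattice_above_kernel_def)

lemma below_join:
  assumes F: "F \<subseteq> lattice_below_support"
  shows "join_proj F \<in> lattice_below_support"
proof -
  have "join_proj F \<in> commuting_projections"
    using F by (intro commuting_join) (auto simp: lattice_below_support_def)
  moreover have "range (join_proj F) \<subseteq> K"
    by (rule join_proj_least[OF P]) (use F in \<open>unfold lattice_below_support_def, blast\<close>)
  ultimately show ?thesis by (simp add: lattice_below_support_def)
qed

lemma below_meet:
  assumes F: "F \<subseteq> lattice_below_support" and ne: "F \<noteq> {}"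
  shows "meet_proj F \<in> lattice_below_support"
proof -
  have Fp: "F \<subseteq> projections UNIV" using F below_projections by blast
  obtain L where L: "L \<in> F" using ne by blast
  have "meet_proj F \<in> commuting_projections"
    using F by (intro commuting_meet) (auto simp: lattice_below_support_def)
  moreover have "range L \<subseteq> K" using F L unfolding lattice_below_support_def by blast
  then have "range (meet_proj F) \<subseteq> K"
    unfolding meet_proj(2)[OF Fp] using L by blast
  ultimately show ?thesis by (simp add: lattice_below_support_def)
qed

lemma support_below: "P \<in> lattice_below_support"
  using P_commuting by (simp add: lattice_below_support_def)

lemma zero_below: "(\<lambda>_. 0) \<in> lattice_below_support"
  using zero_commuting closed_subspaceD(1)[OF K_closed] by (auto simp: lattice_below_support_def simp del: image_iff)

lemma above_lub_exists:
  assumes F: "F \<subseteq> lattice_above_kernel"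
  shows "\<exists>x. proj_lub lattice_above_kernel F x"
proof (cases "F = {}")
  case True
  have "proj_lub lattice_above_kernel F (perp P)"
    using kernel_above unfolding proj_lub_def True by (simp add: lattice_above_kernel_def)
  then show ?thesis by blast
next
  case False
  then show ?thesis using proj_lub_join[OF above_projections above_join[OF F]] by blast
qed

lemma above_glb: "F \<subseteq> lattice_above_kernel \<Longrightarrow> proj_glb lattice_above_kernel F (meet_proj F)"
  using above_projections by (intro proj_glb_meet above_meet) blast+

lemma below_lub: "F \<subseteq> lattice_below_support \<Longrightarrow> proj_lub lattice_below_support F (join_proj F)"
  by (intro proj_lub_join below_projections below_join)

lemma below_glb_exists:
  assumes F: "F \<subseteq> lattice_below_support"
  shows "\<exists>x. proj_glb lattice_below_support F x"
proof (cases "F = {}")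
  case True
  have "proj_glb lattice_below_support F P"
    using support_below unfolding proj_glb_def True by (simp add: lattice_below_support_def)
  then show ?thesis by blast
next
  case False
  then have "meet_proj F \<in> lattice_below_support" by (rule below_meet[OF F])
  then show ?thesis using proj_glb_meet[of F] F below_projections by blast
qed

lemma above_complete_lattice: "complete_lattice (proj_order lattice_above_kernel)"
  using above_glb by (intro complete_lattice_proj_order above_projections above_lub_exists) blast+

lemma below_complete_lattice: "complete_lattice (proj_order lattice_below_support)"
  using below_lub by (intro complete_lattice_proj_order below_projections below_glb_exists) blast+

subsection \<open>Orthocomplements\<close>

text \<open>For \<open>L\<close> in the lattice, the relative complement is \<open>1 - L P\<close>: vectors of \<open>K\<close> orthogonal to \<open>L\<close>,
  together with \<open>N\<close>.\<close>

lemma above_complement: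
  assumes L: "L \<in> lattice_above_kernel"
  shows "perp L \<squnion>\<^bsub>proj_lattice\<^esub> perp P = perp (\<lambda>x. L (P x))"
    and "perp (\<lambda>x. L (P x)) \<in> lattice_above_kernel"
proof -
  have Lc: "L \<in> commuting_projections" and LN: "\<And>x. P x = 0 \<Longrightarrow> L x = x" using L by (simp_all add: above_iff)
  note Lp = commuting_projection[OF Lc]
  note Lalg = proj_algebra[OF Lp]
  note cut = commuting_cut[OF Lc]
  have range_iff: "x \<in> range (perp (\<lambda>x. L (P x))) \<longleftrightarrow> L (P x) = 0" for x
    by (rule in_range_perp[OF commuting_projection[OF cut]])
  show "perp (\<lambda>x. L (P x)) \<in> lattice_above_kernel"
    using commuting_perp[OF cut] by (simp add: above_iff perp_def Lalg)
  show "perp L \<squnion>\<^bsub>proj_lattice\<^esub> perp P = perp (\<lambda>x. L (P x))"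
    unfolding join_def
  proof (rule sup_proj_order)
    show "{perp L, perp P} \<subseteq> projections UNIV" using perp_projection[OF Lp] PN by blast
    have "range (perp (\<lambda>x. L (P x))) \<subseteq> range z"
      if z: "z \<in> projections UNIV" "range (perp L) \<subseteq> range z" "range (perp P) \<subseteq> range z" for z
    proof
      fix x assume "x \<in> range (perp (\<lambda>x. L (P x)))"
      then have "L (P x) = 0" by (simp only: range_iff)
      then have "P x \<in> range (perp L)" by (simp only: in_range_perp[OF Lp])
      then have "P x + perp P x \<in> range z"
        using z by (intro closed_subspaceD(2)[OF closed_subspace_range]) blast+
      then show "x \<in> range z" by (simp add: proj_add_perp)
    qed
    moreover have "range (perp L) \<subseteq> range (perp (\<lambda>x. L (P x)))"
    proof
      fix x assume "x \<in> range (perp L)"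
      then have "L x = 0" by (simp only: in_range_perp[OF Lp])
      then have "L (P x) = 0" by (simp only: commuting_P[OF Lc] Palg)
      then show "x \<in> range (perp (\<lambda>x. L (P x)))" by (simp only: range_iff)
    qed
    moreover have "range (perp P) \<subseteq> range (perp (\<lambda>x. L (P x)))"
      by (rule subsetI) (simp only: range_iff N_iff Lalg)
    ultimately show "proj_lub (projections UNIV) {perp L, perp P} (perp (\<lambda>x. L (P x)))"
      using perp_projection[OF commuting_projection[OF cut]] by (simp add: proj_lub_def)
  qed simp
qed

theorem above_ortholattice:
  "complete_ortholattice (proj_order lattice_above_kernel) (\<lambda>L. perp L \<squnion>\<^bsub>proj_lattice\<^esub> perp P)"
  unfolding complete_ortholattice_def proj_order_simps
proof (intro conjI ballI impI above_complete_lattice)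
  let ?S = lattice_above_kernel
  let ?c = "\<lambda>L. perp L \<squnion>\<^bsub>proj_lattice\<^esub> perp P"
  have bot: "\<bottom>\<^bsub>proj_order ?S\<^esub> = perp P"
    by (rule bottom_proj_order[OF above_projections kernel_above]) (simp add: lattice_above_kernel_def)
  have top: "\<top>\<^bsub>proj_order ?S\<^esub> = (\<lambda>x. x)"
    by (rule top_proj_order[OF above_projections id_above]) simp
  fix L assume L: "L \<in> ?S"
  have Lc: "L \<in> commuting_projections" and LN: "\<And>x. P x = 0 \<Longrightarrow> L x = x" using L by (simp_all add: above_iff)
  note Lp = commuting_projection[OF Lc]
  note Lalg = proj_algebra[OF Lp]
  note c = above_complement[OF L]
  have range_iff: "x \<in> range (?c L) \<longleftrightarrow> L (P x) = 0" for x
    unfolding c(1) by (rule in_range_perp[OF commuting_projection[OF commuting_cut[OF Lc]]])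
  show cS: "?c L \<in> ?S" unfolding c(1) by (rule c(2))
  have "x - (P x - L (P x)) = L x" for x
  proof -
    have "L x - L (P x) = x - P x" using LN[OF P_perp, of x] by (simp add: perp_def Lalg)
    moreover have "x - (P x - L (P x)) = (x - P x) + L (P x)" by simp
    ultimately show ?thesis by (metis diff_add_cancel)
  qed
  then show "?c (?c L) = L"
    unfolding c(1) above_complement(1)[OF c(2)] by (simp add: perp_def fun_eq_iff Palg)
  have "proj_glb ?S {L, ?c L} (perp P)"
    unfolding proj_glb_def
  proof (intro conjI ballI impI kernel_above)
    show "range (perp P) \<subseteq> range y" if "y \<in> {L, ?c L}" for y
      using that L cS by (auto simp: lattice_above_kernel_def simp del: image_iff)
    fix z assume z: "z \<in> ?S" "\<forall>y\<in>{L, ?c L}. range z \<subseteq> range y"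
    show "range z \<subseteq> range (perp P)"
    proof
      fix x assume "x \<in> range z"
      then have "x \<in> range L" "x \<in> range (?c L)" using z by blast+
      then have "L x = x" "L (P x) = 0" by (simp_all only: in_range_proj[OF Lp] range_iff)
      then have "P x = 0" by (simp add: commuting_P[OF Lc])
      then show "x \<in> range (perp P)" by (simp only: N_iff)
    qed
  qed
  then show "L \<sqinter>\<^bsub>proj_order ?S\<^esub> ?c L = \<bottom>\<^bsub>proj_order ?S\<^esub>"
    unfolding meet_def[of "proj_order ?S" L "?c L"] bot
    by (rule inf_proj_order[OF above_projections insert_subsetI[OF L insert_subsetI[OF cS empty_subsetI]]])
  have "proj_lub ?S {L, ?c L} (\<lambda>x. x)"
    unfolding proj_lub_def
  proof (intro conjI ballI impI id_above)
    fix z assume z: "z \<in> ?S" "\<forall>y\<in>{L, ?c L}. range y \<subseteq> range z"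
    have "x \<in> range z" for x
    proof -
      have "P (L (P x)) = L (P x)" by (simp only: commuting_P[OF Lc, symmetric] Palg)
      then have "x - L (P x) \<in> range (?c L)" unfolding range_iff by (simp add: Palg Lalg)
      then have "L (P x) + (x - L (P x)) \<in> range z"
        using z above_projections by (intro closed_subspaceD(2)[OF closed_subspace_range]) blast+
      then show ?thesis by simp
    qed
    then show "range (\<lambda>x. x) \<subseteq> range z" by blast
  qed simp
  then show "L \<squnion>\<^bsub>proj_order ?S\<^esub> ?c L = \<top>\<^bsub>proj_order ?S\<^esub>"
    unfolding join_def[of "proj_order ?S" L "?c L"] top
    by (rule sup_proj_order[OF above_projections insert_subsetI[OF L insert_subsetI[OF cS empty_subsetI]]])
  fix M assume M: "M \<in> ?S" and le: "range L \<subseteq> range M"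
  have Mc: "M \<in> commuting_projections" using M by (simp add: above_iff)
  note absorb = proj_le_absorb[OF Lp commuting_projection[OF Mc] le]
  show "range (?c M) \<subseteq> range (?c L)"
  proof
    fix x assume "x \<in> range (?c M)"
    then have "M (P x) = 0"
      unfolding above_complement(1)[OF M] in_range_perp[OF commuting_projection[OF commuting_cut[OF Mc]]] .
    then have "L (P x) = 0" using absorb(2)[of "P x"] by (simp add: Lalg)
    then show "x \<in> range (?c L)" by (simp only: range_iff)
  qed
qed

lemma below_complement:
  assumes L: "L \<in> lattice_below_support"
  shows "perp L \<sqinter>\<^bsub>proj_lattice\<^esub> P = (\<lambda>x. perp L (P x))"
    and "(\<lambda>x. perp L (P x)) \<in> lattice_below_support"
    and "x \<in> range (\<lambda>x. perp L (P x)) \<longleftrightarrow> L x = 0 \<and> P x = x"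
proof -
  have Lc: "L \<in> commuting_projections" and LK: "\<And>x. L x = x \<Longrightarrow> P x = x" using L by (simp_all add: below_iff)
  note Lp = commuting_projection[OF Lc]
  note Lalg = proj_algebra[OF Lp]
  note cut = cut_below[OF commuting_perp[OF Lc]]
  have PL: "P (L x) = L x" for x by (rule LK) (simp add: Lalg)
  have LP: "L (P x) = L x" for x by (simp add: commuting_P[OF Lc] PL)
  have cp: "(\<lambda>x. perp L (P x)) \<in> projections UNIV" using cut below_projections by blast
  have range_iff: "x \<in> range (\<lambda>x. perp L (P x)) \<longleftrightarrow> L x = 0 \<and> P x = x" for x
    unfolding in_range_proj[OF cp]
  proof
    assume a: "perp L (P x) = x"
    have "L (perp L (P x)) = 0" "P (perp L (P x)) = perp L (P x)"
      by (simp_all add: perp_def Lalg Palg PL LP)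
    then show "L x = 0 \<and> P x = x" unfolding a by simp
  qed (simp add: perp_def)
  show "(\<lambda>x. perp L (P x)) \<in> lattice_below_support" by (rule cut)
  show "x \<in> range (\<lambda>x. perp L (P x)) \<longleftrightarrow> L x = 0 \<and> P x = x" by (rule range_iff)
  have "range (\<lambda>x. perp L (P x)) = range (perp L) \<inter> range P"
    by (intro equalityI subsetI) (simp_all only: Int_iff range_iff in_range_perp[OF Lp] K_iff)
  then have "proj_glb (projections UNIV) {perp L, P} (\<lambda>x. perp L (P x))"
    using cp by (simp add: proj_glb_def)
  then show "perp L \<sqinter>\<^bsub>proj_lattice\<^esub> P = (\<lambda>x. perp L (P x))"
    unfolding meet_def using perp_projection[OF Lp] P by (intro inf_proj_order) simp_all
qed

theorem below_ortholattice:
  "complete_ortholattice (proj_order lattice_below_support) (\<lambda>L. perp L \<sqinter>\<^bsub>proj_lattice\<^esub> P)"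
  unfolding complete_ortholattice_def proj_order_simps
proof (intro conjI ballI impI below_complete_lattice)
  let ?S = lattice_below_support
  let ?c = "\<lambda>L. perp L \<sqinter>\<^bsub>proj_lattice\<^esub> P"
  have bot: "\<bottom>\<^bsub>proj_order ?S\<^esub> = (\<lambda>_. 0)"
    using closed_subspaceD(1)[OF closed_subspace_range] below_projections
    by (intro bottom_proj_order[OF below_projections zero_below]) blast
  have top: "\<top>\<^bsub>proj_order ?S\<^esub> = P"
    by (rule top_proj_order[OF below_projections support_below]) (simp add: lattice_below_support_def)
  fix L assume L: "L \<in> ?S"
  have Lc: "L \<in> commuting_projections" and LK: "\<And>x. L x = x \<Longrightarrow> P x = x" using L by (simp_all add: below_iff)
  note Lp = commuting_projection[OF Lc]
  note Lalg = proj_algebra[OF Lp]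
  note c = below_complement[OF L]
  have PL: "P (L x) = L x" for x by (rule LK) (simp add: Lalg)
  have LP: "L (P x) = L x" for x by (simp add: commuting_P[OF Lc] PL)
  show cS: "?c L \<in> ?S" unfolding c(1) by (rule c(2))
  show "?c (?c L) = L"
    unfolding c(1) below_complement(1)[OF c(2)] by (simp add: perp_def fun_eq_iff Palg LP)
  have "proj_glb ?S {L, ?c L} (\<lambda>_. 0)"
    unfolding proj_glb_def
  proof (intro conjI ballI impI zero_below)
    show "range (\<lambda>_. 0) \<subseteq> range y" if "y \<in> {L, ?c L}" for y
    proof -
      have "y \<in> projections UNIV" using that L cS below_projections by blast
      then show ?thesis using closed_subspaceD(1)[OF closed_subspace_range[of y]] by blast
    qed
    fix z assume z: "z \<in> ?S" "\<forall>y\<in>{L, ?c L}. range z \<subseteq> range y"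
    show "range z \<subseteq> range (\<lambda>_. 0)"
    proof
      fix x assume "x \<in> range z"
      then have "x \<in> range L" "x \<in> range (?c L)" using z by blast+
      then have "L x = x" "L x = 0" unfolding c(1) c(3) in_range_proj[OF Lp] by simp_all
      then show "x \<in> range (\<lambda>_. 0)" by simp
    qed
  qed
  then show "L \<sqinter>\<^bsub>proj_order ?S\<^esub> ?c L = \<bottom>\<^bsub>proj_order ?S\<^esub>"
    unfolding meet_def[of "proj_order ?S" L "?c L"] bot
    by (rule inf_proj_order[OF below_projections insert_subsetI[OF L insert_subsetI[OF cS empty_subsetI]]])
  have "proj_lub ?S {L, ?c L} P"
    unfolding proj_lub_def
  proof (intro conjI ballI impI support_below)
    show "range y \<subseteq> range P" if "y \<in> {L, ?c L}" for y
      using that L cS by (auto simp: lattice_below_support_def simp del: image_iff)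
    fix z assume z: "z \<in> ?S" "\<forall>y\<in>{L, ?c L}. range y \<subseteq> range z"
    show "range P \<subseteq> range z"
    proof
      fix x assume "x \<in> range P"
      then have x: "P x = x" by (simp only: K_iff)
      have "x - L x \<in> range (?c L)" unfolding c(1) c(3) by (simp add: Lalg Palg PL x)
      then have "L x + (x - L x) \<in> range z"
        using z below_projections by (intro closed_subspaceD(2)[OF closed_subspace_range]) blast+
      then show "x \<in> range z" by simp
    qed
  qed
  then show "L \<squnion>\<^bsub>proj_order ?S\<^esub> ?c L = \<top>\<^bsub>proj_order ?S\<^esub>"
    unfolding join_def[of "proj_order ?S" L "?c L"] top
    by (rule sup_proj_order[OF below_projections insert_subsetI[OF L insert_subsetI[OF cS empty_subsetI]]])
  fix M assume M: "M \<in> ?S" and le: "range L \<subseteq> range M"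
  have Mc: "M \<in> commuting_projections" using M by (simp add: below_iff)
  note absorb = proj_le_absorb[OF Lp commuting_projection[OF Mc] le]
  show "range (?c M) \<subseteq> range (?c L)"
  proof
    fix x assume "x \<in> range (?c M)"
    then have "M x = 0" "P x = x"
      unfolding below_complement(1)[OF M] below_complement(3)[OF M] by simp_all
    then have "L x = 0" using absorb(2)[of x] by (simp add: Lalg)
    then show "x \<in> range (?c L)" unfolding c(1) c(3) using \<open>P x = x\<close> by simp
  qed
qed

end

section \<open>Normalizing spaces\<close>

locale normalizing_space =
  fixes U :: "('a::complex_hilbert \<Rightarrow> 'b::complex_hilbert) set"
  assumes normalizing: "normalizing U"
begin

abbreviation "\<psi> \<equiv> op_Map U"
abbreviation "UstarU \<equiv> {adjoint_op S \<circ> T |S T. S \<in> U \<and> T \<in> U}"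
abbreviation "UUstar \<equiv> {S \<circ> adjoint_op T |S T. S \<in> U \<and> T \<in> U}"

text \<open>The right adjoint of \<open>\<psi>\<close> as a map of ordered sets: the largest subspace mapped by \<open>U\<close> into the
  range of \<open>Q\<close>.\<close>

definition preimage :: "('b \<Rightarrow> 'b) \<Rightarrow> 'a \<Rightarrow> 'a"
  where "preimage Q = proj_onto {x. \<forall>S\<in>U. S x \<in> range Q}"

lemma U_bop: "S \<in> U \<Longrightarrow> S \<in> bop UNIV UNIV"
  using normalizing by (auto simp: normalizing_def operator_subspace_def)

lemma triple: "A \<in> U \<Longrightarrow> B \<in> U \<Longrightarrow> C \<in> U \<Longrightarrow> (\<lambda>x. A (adjoint_op B (C x))) \<in> U"
  using normalizing by (auto simp: normalizing_def comp_def)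

lemma psi:
  shows "\<psi> P \<in> projections UNIV"
    "range (\<psi> P) = closure (complex_vector.span {S x |S x. S \<in> U \<and> x \<in> range P})"
  unfolding op_Map_def by (rule proj_onto[OF closed_subspace_closure_span])+

lemma psi_upper: "S \<in> U \<Longrightarrow> x \<in> range P \<Longrightarrow> S x \<in> range (\<psi> P)"
  unfolding psi(2) by (rule subsetD[OF closure_span_superset]) blast

lemma psi_least:
  "closed_subspace M \<Longrightarrow> (\<And>S x. S \<in> U \<Longrightarrow> x \<in> range P \<Longrightarrow> S x \<in> M) \<Longrightarrow> range (\<psi> P) \<subseteq> M"
  unfolding psi(2) by (rule closure_span_minimal) blast+

lemma ortho_psi: "y \<in> ortho (range (\<psi> P)) \<longleftrightarrow> (\<forall>S\<in>U. \<forall>x\<in>range P. cinner y (S x) = 0)"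
  unfolding psi(2) ortho_closure_span ortho_iff by blast

lemma preimage:
  assumes Q: "Q \<in> projections UNIV"
  shows "preimage Q \<in> projections UNIV" "x \<in> range (preimage Q) \<longleftrightarrow> (\<forall>S\<in>U. S x \<in> range Q)"
proof -
  have "closed_subspace (\<Inter>S\<in>U. {x. S x \<in> range Q})"
    by (intro closed_subspace_INT closed_subspace_vimage U_bop closed_subspace_range Q)
  moreover have "(\<Inter>S\<in>U. {x. S x \<in> range Q}) = {x. \<forall>S\<in>U. S x \<in> range Q}" by blast
  ultimately have c: "closed_subspace {x. \<forall>S\<in>U. S x \<in> range Q}" by simp
  show "preimage Q \<in> projections UNIV" unfolding preimage_def by (rule proj_onto[OF c])
  show "x \<in> range (preimage Q) \<longleftrightarrow> (\<forall>S\<in>U. S x \<in> range Q)"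
    unfolding preimage_def proj_onto(2)[OF c] by (rule mem_Collect_eq)
qed

lemma galois:
  assumes Q: "Q \<in> projections UNIV"
  shows "range (\<psi> P) \<subseteq> range Q \<longleftrightarrow> range P \<subseteq> range (preimage Q)"
proof
  assume le: "range (\<psi> P) \<subseteq> range Q"
  show "range P \<subseteq> range (preimage Q)"
  proof
    fix x assume "x \<in> range P"
    then show "x \<in> range (preimage Q)"
      unfolding preimage(2)[OF Q] using psi_upper le by blast
  qed
next
  assume le: "range P \<subseteq> range (preimage Q)"
  show "range (\<psi> P) \<subseteq> range Q"
  proof (rule psi_least[OF closed_subspace_range[OF Q]])
    fix S x assume "S \<in> U" "x \<in> range P"
    then show "S x \<in> range Q" using le preimage(2)[OF Q] by blast
  qed
qed

lemma psi_mono: "range P \<subseteq> range P' \<Longrightarrow> range (\<psi> P) \<subseteq> range (\<psi> P')"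
  by (rule psi_least[OF closed_subspace_range[OF psi(1)]], rule psi_upper, assumption, erule (1) subsetD)

lemma zero_projection: "(\<lambda>_. 0) \<in> projections UNIV"
  by (simp add: projections_def bop_zero)

lemma sup_below:
  assumes Q: "Q \<in> projections UNIV"
  shows "\<Squnion>\<^bsub>proj_lattice\<^esub> {P \<in> projections UNIV. \<psi> P \<sqsubseteq>\<^bsub>proj_lattice\<^esub> Q} = preimage Q"
proof (rule sup_proj_order[OF subset_refl])
  show "proj_lub (projections UNIV) {P \<in> projections UNIV. \<psi> P \<sqsubseteq>\<^bsub>proj_lattice\<^esub> Q} (preimage Q)"
    unfolding proj_lub_def
  proof (intro conjI ballI impI)
    show "preimage Q \<in> projections UNIV" by (rule preimage(1)[OF Q])
    show "range P \<subseteq> range (preimage Q)"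
      if "P \<in> {P \<in> projections UNIV. \<psi> P \<sqsubseteq>\<^bsub>proj_lattice\<^esub> Q}" for P
      using that unfolding mem_Collect_eq proj_order_simps galois[OF Q] by (rule conjunct2)
    fix R assume R: "\<forall>P\<in>{P \<in> projections UNIV. \<psi> P \<sqsubseteq>\<^bsub>proj_lattice\<^esub> Q}. range P \<subseteq> range R"
    show "range (preimage Q) \<subseteq> range R"
    proof (rule bspec[OF R])
      show "preimage Q \<in> {P \<in> projections UNIV. \<psi> P \<sqsubseteq>\<^bsub>proj_lattice\<^esub> Q}"
        unfolding mem_Collect_eq proj_order_simps galois[OF Q] using preimage(1)[OF Q] by (rule conjI) (rule subset_refl)
    qed
  qed
qed (rule Collect_restrict)

lemma semilattice1_eq: "semilattice1 \<psi> = preimage ` projections UNIV"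
proof (intro equalityI subsetI)
  fix L assume "L \<in> semilattice1 \<psi>"
  then obtain Q where "Q \<in> projections UNIV"
    "L = \<Squnion>\<^bsub>proj_lattice\<^esub> {P \<in> projections UNIV. \<psi> P \<sqsubseteq>\<^bsub>proj_lattice\<^esub> Q}"
    unfolding semilattice1_def mem_Collect_eq by (elim exE conjE)
  then show "L \<in> preimage ` projections UNIV" by (simp only: sup_below imageI)
next
  fix L assume "L \<in> preimage ` projections UNIV"
  then obtain Q where Q: "Q \<in> projections UNIV" "L = preimage Q" by blast
  show "L \<in> semilattice1 \<psi>"
    unfolding semilattice1_def mem_Collect_eq
    by (intro exI conjI) (rule trans[OF Q(2) sup_below[OF Q(1), symmetric]], rule Q(1))
qed

lemma zero_plus_eq: "zero_plus \<psi> = preimage (\<lambda>_. 0)"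
proof -
  have "\<psi> P = (\<lambda>_. 0) \<longleftrightarrow> range (\<psi> P) \<subseteq> range (\<lambda>_::'b. 0::'b)" for P
  proof
    assume le: "range (\<psi> P) \<subseteq> range (\<lambda>_::'b. 0::'b)"
    show "\<psi> P = (\<lambda>_. 0)"
    proof
      show "\<psi> P x = 0" for x using subsetD[OF le rangeI[of "\<psi> P" x]] by blast
    qed
  qed simp
  then have "{P \<in> projections UNIV. \<psi> P = (\<lambda>_. 0)} = {P \<in> projections UNIV. \<psi> P \<sqsubseteq>\<^bsub>proj_lattice\<^esub> (\<lambda>_. 0)}"
    unfolding proj_order_simps by (simp only:)
  then show ?thesis unfolding zero_plus_def by (simp only: sup_below[OF zero_projection])
qed

abbreviation "Z \<equiv> zero_plus \<psi>"
abbreviation "E \<equiv> I_minus \<psi>"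

lemma common_kernel: "Z \<in> projections UNIV" "x \<in> range Z \<longleftrightarrow> (\<forall>S\<in>U. S x = 0)"
proof -
  show "Z \<in> projections UNIV" unfolding zero_plus_eq by (rule preimage(1)[OF zero_projection])
  have "v \<in> range (\<lambda>_::'b. 0) \<longleftrightarrow> v = 0" for v :: 'b by blast
  then show "x \<in> range Z \<longleftrightarrow> (\<forall>S\<in>U. S x = 0)"
    unfolding zero_plus_eq preimage(2)[OF zero_projection] by (simp only:)
qed

lemma support: "E \<in> projections UNIV" "E y = 0 \<longleftrightarrow> (\<forall>S\<in>U. adjoint_op S y = 0)"
proof -
  show E: "E \<in> projections UNIV" unfolding I_minus_def by (rule psi(1))
  have "E y = 0 \<longleftrightarrow> y \<in> ortho (range E)"
    by (simp only: range_perp[OF E, symmetric] in_range_perp[OF E])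
  also have "\<dots> \<longleftrightarrow> (\<forall>S\<in>U. \<forall>x. cinner y (S x) = 0)"
    unfolding I_minus_def ortho_psi by simp
  also have "\<dots> \<longleftrightarrow> (\<forall>S\<in>U. adjoint_op S y = 0)"
  proof (rule ball_cong[OF refl])
    fix S assume "S \<in> U"
    note ad = adjoint_op(3)[OF U_bop[OF this]]
    show "(\<forall>x. cinner y (S x) = 0) \<longleftrightarrow> adjoint_op S y = 0"
    proof
      assume "\<forall>x. cinner y (S x) = 0"
      then have "cinner (adjoint_op S y) (adjoint_op S y) = 0" unfolding ad by (rule spec)
      then show "adjoint_op S y = 0" by (simp only: cinner_eq_zero_iff)
    next
      assume "adjoint_op S y = 0"
      then show "\<forall>x. cinner y (S x) = 0" unfolding ad[symmetric] by simp
    qed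
  qed
  finally show "E y = 0 \<longleftrightarrow> (\<forall>S\<in>U. adjoint_op S y = 0)" .
qed

lemma adjoint_zero:
  assumes S: "S \<in> U" and 0: "S (adjoint_op S y) = 0"
  shows "adjoint_op S y = 0"
proof -
  have "cinner (adjoint_op S y) (adjoint_op S y) = 0"
    unfolding adjoint_op(3)[OF U_bop[OF S]] 0 by (rule cinner_zero_right)
  then show ?thesis by (simp only: cinner_eq_zero_iff)
qed

lemma zero_of_adjoint:
  assumes S: "S \<in> U" and 0: "adjoint_op S (S x) = 0"
  shows "S x = 0"
proof -
  have "cinner (S x) (S x) = 0"
    unfolding adjoint_op(2)[OF U_bop[OF S]] 0 by (rule cinner_zero_right)
  then show ?thesis by (simp only: cinner_eq_zero_iff)
qed

sublocale left: selfadjoint_corner UstarU "perp Z"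
proof
  show "selfadjoint_set UstarU"
    unfolding selfadjoint_set_def
  proof (intro conjI subsetI ballI)
    fix R assume "R \<in> UstarU"
    then obtain S T where R: "R = adjoint_op S \<circ> T" and ST: "S \<in> U" "T \<in> U" by blast
    note b = U_bop[OF ST(1)] U_bop[OF ST(2)]
    have bop: "adjoint_op V \<circ> W \<in> bop UNIV UNIV" if "V \<in> U" "W \<in> U" for V W
      using bop_comp[OF adjoint_op(1)[OF U_bop[OF that(1)]] U_bop[OF that(2)]] by (simp add: comp_def)
    show "R \<in> bop UNIV UNIV" unfolding R by (rule bop[OF ST])
    have "adjoint_op R = adjoint_op T \<circ> S"
      by (rule adj_eqI[OF bop[OF ST(2,1)] _ closed_subspace_UNIV])
        (simp add: R adjoint_op(3)[OF b(1)] adjoint_op(2)[OF b(2)])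
    then show "adjoint_op R \<in> UstarU" using ST by blast
  qed
  show "perp Z \<in> projections UNIV" by (rule perp_projection[OF common_kernel(1)])
  have "perp Z x = 0 \<longleftrightarrow> (\<forall>S\<in>U. S x = 0)" for x
    using in_range_perp[OF perp_projection[OF common_kernel(1)], of x] common_kernel(2)[of x] by simp
  moreover have "(\<forall>S\<in>U. S x = 0) \<longleftrightarrow> (\<forall>R\<in>UstarU. R x = 0)" for x
  proof
    assume 0: "\<forall>S\<in>U. S x = 0"
    show "\<forall>R\<in>UstarU. R x = 0"
    proof
      fix R assume "R \<in> UstarU"
      then obtain S T where R: "R = adjoint_op S \<circ> T" and ST: "S \<in> U" "T \<in> U" by blast
      show "R x = 0"
        unfolding R comp_def bspec[OF 0 ST(2)] by (rule bop_algebra(1)[OF adjoint_op(1)[OF U_bop[OF ST(1)]]])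
    qed
  next
    assume 0: "\<forall>R\<in>UstarU. R x = 0"
    show "\<forall>S\<in>U. S x = 0"
    proof
      fix S assume S: "S \<in> U"
      then have "adjoint_op S \<circ> S \<in> UstarU" by blast
      with 0 have "(adjoint_op S \<circ> S) x = 0" by (rule bspec)
      then show "S x = 0" using zero_of_adjoint[OF S] by simp
    qed
  qed
  ultimately show "perp Z x = 0 \<longleftrightarrow> (\<forall>R\<in>UstarU. R x = 0)" for x by simp
qed

sublocale right: selfadjoint_corner UUstar E
proof
  show "selfadjoint_set UUstar"
    unfolding selfadjoint_set_def
  proof (intro conjI subsetI ballI)
    fix R assume "R \<in> UUstar"
    then obtain S T where R: "R = S \<circ> adjoint_op T" and ST: "S \<in> U" "T \<in> U" by blast
    note b = U_bop[OF ST(1)] U_bop[OF ST(2)]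
    have bop: "V \<circ> adjoint_op W \<in> bop UNIV UNIV" if "V \<in> U" "W \<in> U" for V W
      using bop_comp[OF U_bop[OF that(1)] adjoint_op(1)[OF U_bop[OF that(2)]]] by (simp add: comp_def)
    show "R \<in> bop UNIV UNIV" unfolding R by (rule bop[OF ST])
    have "adjoint_op R = T \<circ> adjoint_op S"
      by (rule adj_eqI[OF bop[OF ST(2,1)] _ closed_subspace_UNIV])
        (simp add: R adjoint_op(2)[OF b(1)] adjoint_op(3)[OF b(2)])
    then show "adjoint_op R \<in> UUstar" using ST by blast
  qed
  show "E \<in> projections UNIV" by (rule support(1))
  have "(\<forall>S\<in>U. adjoint_op S y = 0) \<longleftrightarrow> (\<forall>R\<in>UUstar. R y = 0)" for y
  proof
    assume 0: "\<forall>S\<in>U. adjoint_op S y = 0"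
    show "\<forall>R\<in>UUstar. R y = 0"
    proof
      fix R assume "R \<in> UUstar"
      then obtain S T where R: "R = S \<circ> adjoint_op T" and ST: "S \<in> U" "T \<in> U" by blast
      show "R y = 0"
        unfolding R comp_def bspec[OF 0 ST(2)] by (rule bop_algebra(1)[OF U_bop[OF ST(1)]])
    qed
  next
    assume 0: "\<forall>R\<in>UUstar. R y = 0"
    show "\<forall>S\<in>U. adjoint_op S y = 0"
    proof
      fix S assume S: "S \<in> U"
      then have "S \<circ> adjoint_op S \<in> UUstar" by blast
      with 0 have "(S \<circ> adjoint_op S) y = 0" by (rule bspec)
      then show "adjoint_op S y = 0" using adjoint_zero[OF S] by simp
    qed
  qed
  then show "E y = 0 \<longleftrightarrow> (\<forall>R\<in>UUstar. R y = 0)" for y using support(2) by simp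
qed

subsection \<open>The two semi-lattices\<close>

text \<open>For \<open>V, S, T\<close> in \<open>U\<close> also \<open>V S\<^sup>* T\<close> lies in \<open>U\<close>, so the largest subspace that \<open>U\<close> maps into a given one
  is invariant under \<open>U\<^sup>* U\<close>.\<close>

lemma preimage_above:
  assumes Q: "Q \<in> projections UNIV"
  shows "preimage Q \<in> left.lattice_above_kernel"
proof -
  have "preimage Q \<in> left.commuting_projections"
  proof (rule left.commuting_of_invariant[OF preimage(1)[OF Q]])
    fix R x assume "R \<in> UstarU" and x: "x \<in> range (preimage Q)"
    then obtain S T where R: "R = adjoint_op S \<circ> T" and ST: "S \<in> U" "T \<in> U" by blast
    show "R x \<in> range (preimage Q)"
      unfolding preimage(2)[OF Q]
    proof
      fix V assume "V \<in> U"
      then have "(\<lambda>x. V (adjoint_op S (T x))) \<in> U" using ST by (intro triple)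
      from bspec[OF x[unfolded preimage(2)[OF Q]] this] show "V (R x) \<in> range Q" by (simp only: R comp_def)
    qed
  qed
  moreover have "range Z \<subseteq> range (preimage Q)"
  proof
    fix x assume "x \<in> range Z"
    then have ann: "\<forall>S\<in>U. S x = 0" by (simp only: common_kernel(2))
    show "x \<in> range (preimage Q)"
      unfolding preimage(2)[OF Q]
    proof
      fix S assume "S \<in> U"
      then have "S x = 0" by (rule bspec[OF ann])
      moreover have "0 \<in> range Q" by (rule closed_subspaceD(1)[OF closed_subspace_range[OF Q]])
      ultimately show "S x \<in> range Q" by (simp only:)
    qed
  qed
  ultimately show ?thesis by (simp add: left.lattice_above_kernel_def)
qed

text \<open>If \<open>U\<close> maps \<open>x\<close> into the image of \<open>L\<close>, it maps the component of \<open>x\<close> off \<open>L\<close> there as well.  But \<open>L\<close>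
  commutes with \<open>U\<^sup>* U\<close>, so that component is also mapped orthogonally to the image of \<open>L\<close>, hence to \<open>0\<close>.\<close>

lemma preimage_psi:
  assumes L: "L \<in> left.lattice_above_kernel"
  shows "preimage (\<psi> L) = L"
proof -
  have Lc: "L \<in> left.commuting_projections" and LN: "range Z \<subseteq> range L"
    using L by (simp_all add: left.lattice_above_kernel_def)
  note Lp = left.commuting_projection[OF Lc]
  show ?thesis
  proof (rule proj_cong[OF preimage(1)[OF psi(1)] Lp equalityI])
    show "range L \<subseteq> range (preimage (\<psi> L))" using galois[OF psi(1), of L L] by blast
    show "range (preimage (\<psi> L)) \<subseteq> range L"
    proof
      fix x assume x: "x \<in> range (preimage (\<psi> L))"
      \<comment> \<open>the component of \<open>x\<close> off \<open>L\<close> is annihilated by every operator in \<open>U\<close>\<close>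
      have "S (perp L x) = 0" if S: "S \<in> U" for S
      proof -
        have "S x \<in> range (\<psi> L)" using x S unfolding preimage(2)[OF psi(1)] by blast
        moreover have "S (L x) \<in> range (\<psi> L)" using S by (rule psi_upper) simp
        ultimately have "S x - S (L x) \<in> range (\<psi> L)"
          by (rule closed_subspaceD(4)[OF closed_subspace_range[OF psi(1)]])
        then have in_psi: "S (perp L x) \<in> range (\<psi> L)"
          by (simp only: perp_def bop_algebra(3)[OF U_bop[OF S]])
        have "S (perp L x) \<in> ortho (range (\<psi> L))"
          unfolding ortho_psi
        proof (intro ballI)
          fix T l assume T: "T \<in> U" and l: "l \<in> range L"
          have "adjoint_op S \<circ> T \<in> UstarU" using S T by blast
          from left.commuting_invariant[OF Lc this l] have "adjoint_op S (T l) \<in> range L" by simp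
          with perp_in_ortho[OF Lp, of x] have "cinner (perp L x) (adjoint_op S (T l)) = 0"
            unfolding ortho_iff by blast
          then show "cinner (S (perp L x)) (T l) = 0" by (simp only: adjoint_op(2)[OF U_bop[OF S]])
        qed
        with in_psi have "cinner (S (perp L x)) (S (perp L x)) = 0" unfolding ortho_iff by blast
        then show ?thesis by simp
      qed
      then have "perp L x \<in> range Z" unfolding common_kernel(2) by blast
      then have "perp L x \<in> range L" using LN by blast
      then have "L (perp L x) = perp L x" by (simp only: in_range_proj[OF Lp])
      then have "perp L x = 0" by (simp only: proj_perp_zero[OF Lp])
      then have "L x = x" by (simp add: perp_def)
      then show "x \<in> range L" by (simp only: in_range_proj[OF Lp])
    qed
  qed
qed

lemma semilattice1: "semilattice1 \<psi> = left.lattice_above_kernel"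
  unfolding semilattice1_eq
proof (intro equalityI subsetI)
  show "L \<in> left.lattice_above_kernel" if "L \<in> preimage ` projections UNIV" for L
    using that preimage_above by blast
  show "L \<in> preimage ` projections UNIV" if L: "L \<in> left.lattice_above_kernel" for L
    using imageI[OF psi(1), of preimage L] by (simp only: preimage_psi[OF L])
qed

text \<open>Again by the normalizing property, applying \<open>S T\<^sup>*\<close> to the vectors \<open>V x\<close> gives vectors of the same form.\<close>

lemma psi_below: "\<psi> P \<in> right.lattice_below_support"
proof -
  have "\<psi> P \<in> right.commuting_projections"
  proof (rule right.commuting_of_invariant[OF psi(1)])
    fix R y assume "R \<in> UUstar" and y: "y \<in> range (\<psi> P)"
    then obtain S T where R: "R = S \<circ> adjoint_op T" and ST: "S \<in> U" "T \<in> U" by blast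
    have Rb: "R \<in> bop UNIV UNIV"
      using bop_comp[OF U_bop[OF ST(1)] adjoint_op(1)[OF U_bop[OF ST(2)]]] by (simp add: R comp_def)
    have "range (\<psi> P) \<subseteq> {y. R y \<in> range (\<psi> P)}"
    proof (rule psi_least[OF closed_subspace_vimage[OF Rb closed_subspace_range[OF psi(1)]]])
      fix V x assume V: "V \<in> U" and x: "x \<in> range P"
      have "(\<lambda>x. S (adjoint_op T (V x))) \<in> U" by (rule triple[OF ST V])
      from psi_upper[OF this x] show "V x \<in> {y. R y \<in> range (\<psi> P)}" by (simp add: R)
    qed
    then show "R y \<in> range (\<psi> P)" using y by blast
  qed
  moreover have "range (\<psi> P) \<subseteq> range E"
    unfolding I_minus_def by (rule psi_mono) simp
  ultimately show ?thesis by (simp add: right.lattice_below_support_def)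
qed

text \<open>If \<open>y\<close> lies in \<open>M\<close>, then \<open>U\<close> maps \<open>T\<^sup>* y\<close> into \<open>M\<close>, because \<open>M\<close> is invariant under \<open>U U\<^sup>*\<close>.  So the part
  of \<open>M\<close> orthogonal to the image of its preimage is orthogonal to all vectors \<open>T T\<^sup>* y\<close> with \<open>y\<close> in that
  part, and is annihilated by all adjoints.  Being contained in the range of \<open>E\<close>, it is zero.\<close>

lemma psi_preimage:
  assumes M: "M \<in> right.lattice_below_support"
  shows "\<psi> (preimage M) = M"
proof -
  have Mc: "M \<in> right.commuting_projections" and ME: "range M \<subseteq> range E"
    using M by (simp_all add: right.lattice_below_support_def)
  note Mp = right.commuting_projection[OF Mc]
  let ?M' = "\<psi> (preimage M)"
  show ?thesis
  proof (rule proj_cong[OF psi(1) Mp equalityI])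
    show le: "range ?M' \<subseteq> range M" using galois[OF Mp] by blast
    show "range M \<subseteq> range ?M'"
    proof
      fix y assume y: "y \<in> range M"
      \<comment> \<open>the component of \<open>y\<close> off the image is annihilated by all adjoints\<close>
      have y': "perp ?M' y \<in> range M"
        unfolding perp_def
        by (rule closed_subspaceD(4)[OF closed_subspace_range[OF Mp] y]) (use le in blast)
      have "adjoint_op S (perp ?M' y) = 0" if S: "S \<in> U" for S
      proof -
        have "adjoint_op S (perp ?M' y) \<in> range (preimage M)"
          unfolding preimage(2)[OF Mp]
        proof
          fix V assume "V \<in> U"
          then have "V \<circ> adjoint_op S \<in> UUstar" using S by blast
          from right.commuting_invariant[OF Mc this y']
          show "V (adjoint_op S (perp ?M' y)) \<in> range M" by simp
        qed
        then have "S (adjoint_op S (perp ?M' y)) \<in> range ?M'" by (rule psi_upper[OF S])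
        with perp_in_ortho[OF psi(1), of "preimage M" y]
        have "cinner (perp ?M' y) (S (adjoint_op S (perp ?M' y))) = 0" unfolding ortho_iff by blast
        then have "cinner (adjoint_op S (perp ?M' y)) (adjoint_op S (perp ?M' y)) = 0"
          by (simp only: adjoint_op(3)[OF U_bop[OF S]])
        then show ?thesis by simp
      qed
      then have "E (perp ?M' y) = 0" unfolding support(2) by blast
      moreover have "E (perp ?M' y) = perp ?M' y" using y' ME in_range_proj[OF support(1)] by blast
      ultimately have "?M' y = y" by (simp add: perp_def)
      then show "y \<in> range ?M'" by (simp only: in_range_proj[OF psi(1)])
    qed
  qed
qed

lemma semilattice2: "semilattice2 \<psi> = right.lattice_below_support"
proof (intro equalityI subsetI)
  show "M \<in> right.lattice_below_support" if "M \<in> semilattice2 \<psi>" for M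
    using that psi_below by (auto simp: semilattice2_def)
  show "M \<in> semilattice2 \<psi>" if M: "M \<in> right.lattice_below_support" for M
  proof -
    have "M \<in> projections UNIV" using M right.below_projections by blast
    then have "\<psi> (preimage M) \<in> semilattice2 \<psi>"
      unfolding semilattice2_def by (intro imageI preimage(1))
    then show ?thesis by (simp only: psi_preimage[OF M])
  qed
qed

subsection \<open>The isomorphism\<close>

lemma psi_bij: "bij_betw \<psi> left.lattice_above_kernel right.lattice_below_support"
proof (rule bij_betw_byWitness[of _ preimage])
  show "\<forall>L\<in>left.lattice_above_kernel. preimage (\<psi> L) = L" by (intro ballI preimage_psi)
  show "\<forall>M\<in>right.lattice_below_support. \<psi> (preimage M) = M" by (intro ballI psi_preimage)
  show "\<psi> ` left.lattice_above_kernel \<subseteq> right.lattice_below_support" by (intro image_subsetI psi_below)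
  show "preimage ` right.lattice_below_support \<subseteq> left.lattice_above_kernel"
    by (intro image_subsetI preimage_above subsetD[OF right.below_projections])
qed

lemma psi_order:
  assumes L: "L \<in> left.lattice_above_kernel" "M \<in> left.lattice_above_kernel"
  shows "range (\<psi> L) \<subseteq> range (\<psi> M) \<longleftrightarrow> range L \<subseteq> range M"
  using galois[OF psi(1), of L M] by (simp only: preimage_psi[OF L(2)])

text \<open>For \<open>x\<close> in the relative complement of \<open>L\<close> and \<open>l\<close> in \<open>L\<close>, \<open>S x\<close> is orthogonal to \<open>T l\<close> because
  \<open>S\<^sup>* T l\<close> lies in \<open>L\<close> and is orthogonal to the common kernel.  The two orthogonal images together span the range of \<open>E\<close>,
  so they are complementary there.\<close>

lemma psi_complement:
  assumes L: "L \<in> left.lattice_above_kernel"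
  shows "\<psi> (ocomp1 \<psi> L) = ocomp2 \<psi> (\<psi> L)"
proof -
  have Lc: "L \<in> left.commuting_projections" using L by (simp add: left.lattice_above_kernel_def)
  note Lp = left.commuting_projection[OF Lc]
  note cut = left.commuting_projection[OF left.commuting_cut[OF Lc]]
  let ?c = "perp (\<lambda>x. L (perp Z x))"
  let ?M = "\<psi> L"
  note below = right.below_complement[OF psi_below[of L]]
  have c: "ocomp1 \<psi> L = ?c" using left.above_complement(1)[OF L] by (simp add: ocomp1_def)
  have range_c: "x \<in> range ?c \<longleftrightarrow> L (perp Z x) = 0" for x by (rule in_range_perp[OF cut])
  have d: "ocomp2 \<psi> ?M = (\<lambda>x. perp ?M (E x))" unfolding ocomp2_def by (rule below(1))
  have dp: "(\<lambda>x. perp ?M (E x)) \<in> projections UNIV" using below(2) right.below_projections by blast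
  have le: "range (\<psi> ?c) \<subseteq> range (\<lambda>x. perp ?M (E x))"
  proof (rule psi_least[OF closed_subspace_range[OF dp]])
    fix S x assume S: "S \<in> U" and x: "x \<in> range ?c"
    have "S x \<in> ortho (range ?M)"
      unfolding ortho_psi
    proof (intro ballI)
      fix T l assume T: "T \<in> U" and l: "l \<in> range L"
      have R: "adjoint_op S \<circ> T \<in> UstarU" using S T by blast
      from left.commuting_invariant[OF Lc R l] have "L (adjoint_op S (T l)) = adjoint_op S (T l)"
        unfolding in_range_proj[OF Lp] by simp
      moreover have "perp Z (adjoint_op S (T l)) = adjoint_op S (T l)" using left.P_X[OF R, of l] by simp
      ultimately have "cinner (S x) (T l) = cinner (L (perp Z x)) (adjoint_op S (T l))"
        by (simp add: adjoint_op(2)[OF U_bop[OF S]] projD(3)[OF cut])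
      then show "cinner (S x) (T l) = 0" using x by (simp only: range_c cinner_zero_left)
    qed
    then have "?M (S x) = 0" by (simp only: range_perp[OF psi(1), symmetric] in_range_perp[OF psi(1)])
    moreover have "S x \<in> range E" unfolding I_minus_def by (rule psi_upper[OF S]) simp
    then have "E (S x) = S x" by (simp only: in_range_proj[OF support(1)])
    ultimately show "S x \<in> range (\<lambda>x. perp ?M (E x))" unfolding below(3) by blast
  qed
  have "range (\<lambda>x. perp ?M (E x)) \<subseteq> range (\<psi> ?c)"
  proof
    fix y assume y: "y \<in> range (\<lambda>x. perp ?M (E x))"
    \<comment> \<open>the part of \<open>y\<close> orthogonal to the image of the complement; it will turn out to be \<open>0\<close>\<close>
    define z where "z = perp (\<psi> ?c) y"
    have "z \<in> range (\<lambda>x. perp ?M (E x))"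
      unfolding z_def perp_def[of "\<psi> ?c"]
      by (rule closed_subspaceD(4)[OF closed_subspace_range[OF dp] y]) (use le in blast)
    then have z: "?M z = 0" "E z = z" unfolding below(3) by blast+
    have zM: "z \<in> ortho (range ?M)"
      using z(1) by (simp only: range_perp[OF psi(1), symmetric] in_range_perp[OF psi(1)])
    have zc: "z \<in> ortho (range (\<psi> ?c))" unfolding z_def by (rule perp_in_ortho[OF psi(1)])
    have "cinner z (S x) = 0" if S: "S \<in> U" for S x
    proof -
      have "L (perp Z x) + ?c x = x" by (simp add: perp_def)
      then have "S x = S (L (perp Z x)) + S (?c x)"
        using bop_algebra(2)[OF U_bop[OF S], of "L (perp Z x)" "?c x"] by simp
      moreover have "cinner z (S (L (perp Z x))) = 0" using zM S unfolding ortho_psi by blast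
      moreover have "cinner z (S (?c x)) = 0" using zc S unfolding ortho_psi by blast
      ultimately show ?thesis by (simp add: cinner_add_right)
    qed
    then have "z \<in> ortho (range E)" unfolding I_minus_def ortho_psi by blast
    then have "E z = 0" by (simp only: range_perp[OF support(1), symmetric] in_range_perp[OF support(1)])
    then have "\<psi> ?c y = y" using z(2) by (simp add: z_def perp_def)
    then show "y \<in> range (\<psi> ?c)" by (simp only: in_range_proj[OF psi(1)])
  qed
  then have "range (\<psi> ?c) = range (\<lambda>x. perp ?M (E x))" by (rule equalityI[OF le])
  then show ?thesis unfolding c d by (rule proj_cong[OF psi(1) dp])
qed

theorem psi_iso:
  "complete_ortholattice_iso \<psi> (proj_order left.lattice_above_kernel) (ocomp1 \<psi>)
    (proj_order right.lattice_below_support) (ocomp2 \<psi>)"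
  unfolding complete_ortholattice_iso_def proj_order_simps
proof (intro conjI allI impI ballI psi_bij psi_complement)
  note sup_inf = order_iso_sup_inf[OF left.above_projections right.below_projections
      left.above_complete_lattice psi_bij psi_order]
  fix F assume F: "F \<subseteq> left.lattice_above_kernel"
  show "\<psi> (\<Squnion>\<^bsub>proj_order left.lattice_above_kernel\<^esub> F) = \<Squnion>\<^bsub>proj_order right.lattice_below_support\<^esub> (\<psi> ` F)"
    by (rule sup_inf(1)[OF _ _ F])
  show "\<psi> (\<Sqinter>\<^bsub>proj_order left.lattice_above_kernel\<^esub> F) = \<Sqinter>\<^bsub>proj_order right.lattice_below_support\<^esub> (\<psi> ` F)"
    by (rule sup_inf(2)[OF _ _ F])
qed

text \<open>Both sides say that \<open>S x\<close> and \<open>T y\<close> are orthogonal whenever \<open>x\<close> is orthogonal to \<open>L\<close> and \<open>y\<close> lies in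
  \<open>L\<close>.\<close>

lemma Lat_eq: "Lat UstarU = {L \<in> projections UNIV. \<psi> L \<circ> \<psi> (perp L) = (\<lambda>_. 0)}"
proof -
  have "(\<forall>R\<in>UstarU. perp L \<circ> R \<circ> L = (\<lambda>_. 0)) \<longleftrightarrow> \<psi> L \<circ> \<psi> (perp L) = (\<lambda>_. 0)"
    if L: "L \<in> projections UNIV" for L
  proof -
    have "\<psi> L \<circ> \<psi> (perp L) = (\<lambda>_. 0) \<longleftrightarrow> range (\<psi> (perp L)) \<subseteq> ortho (range (\<psi> L))"
      unfolding range_perp[OF psi(1), symmetric] subset_iff in_range_perp[OF psi(1)]
      by (auto simp: fun_eq_iff)
    also have "\<dots> \<longleftrightarrow> (\<forall>S\<in>U. \<forall>x\<in>range (perp L). S x \<in> ortho (range (\<psi> L)))"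
    proof
      show "\<forall>S\<in>U. \<forall>x\<in>range (perp L). S x \<in> ortho (range (\<psi> L))"
        if "range (\<psi> (perp L)) \<subseteq> ortho (range (\<psi> L))"
        using psi_upper[of _ _ "perp L"] that by blast
      show "range (\<psi> (perp L)) \<subseteq> ortho (range (\<psi> L))"
        if "\<forall>S\<in>U. \<forall>x\<in>range (perp L). S x \<in> ortho (range (\<psi> L))"
        by (rule psi_least[OF closed_subspace_ortho]) (use that in blast)
    qed
    also have "\<dots> \<longleftrightarrow> (\<forall>S\<in>U. \<forall>T\<in>U. \<forall>x y. cinner (perp L x) (adjoint_op S (T (L y))) = 0)"
      unfolding ortho_psi by (auto simp: adjoint_op(2)[OF U_bop])
    also have "\<dots> \<longleftrightarrow> (\<forall>S\<in>U. \<forall>T\<in>U. \<forall>y. perp L (adjoint_op S (T (L y))) = 0)"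
    proof -
      have "(\<forall>x. cinner (perp L x) v = 0) \<longleftrightarrow> perp L v = 0" for v
        unfolding projD(3)[OF perp_projection[OF L]] using cinner_eq_zero_iff by (metis cinner_zero_right)
      then show ?thesis by blast
    qed
    also have "\<dots> \<longleftrightarrow> (\<forall>S\<in>U. \<forall>T\<in>U. perp L \<circ> (adjoint_op S \<circ> T) \<circ> L = (\<lambda>_. 0))"
      by (simp only: fun_eq_iff comp_def)
    also have "\<dots> \<longleftrightarrow> (\<forall>R\<in>UstarU. perp L \<circ> R \<circ> L = (\<lambda>_. 0))"
      by blast
    finally show ?thesis ..
  qed
  then show ?thesis unfolding Lat_def by (intro Collect_cong conj_cong refl)
qed

lemma extrema:
  "F \<subseteq> left.lattice_above_kernel \<Longrightarrow>
    \<Sqinter>\<^bsub>proj_order left.lattice_above_kernel\<^esub> F = \<Sqinter>\<^bsub>proj_lattice\<^esub> F"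
  "F \<subseteq> left.lattice_above_kernel \<Longrightarrow> F \<noteq> {} \<Longrightarrow>
    \<Squnion>\<^bsub>proj_order left.lattice_above_kernel\<^esub> F = \<Squnion>\<^bsub>proj_lattice\<^esub> F"
  "G \<subseteq> right.lattice_below_support \<Longrightarrow>
    \<Squnion>\<^bsub>proj_order right.lattice_below_support\<^esub> G = \<Squnion>\<^bsub>proj_lattice\<^esub> G"
  "G \<subseteq> right.lattice_below_support \<Longrightarrow> G \<noteq> {} \<Longrightarrow>
    \<Sqinter>\<^bsub>proj_order right.lattice_below_support\<^esub> G = \<Sqinter>\<^bsub>proj_lattice\<^esub> G"
proof -
  assume F: "F \<subseteq> left.lattice_above_kernel"
  then have Fp: "F \<subseteq> projections UNIV" using left.above_projections by blast
  show "\<Sqinter>\<^bsub>proj_order left.lattice_above_kernel\<^esub> F = \<Sqinter>\<^bsub>proj_lattice\<^esub> F"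
    unfolding inf_proj_lattice[OF Fp] by (rule inf_proj_order[OF left.above_projections F left.above_glb[OF F]])
  assume "F \<noteq> {}"
  then show "\<Squnion>\<^bsub>proj_order left.lattice_above_kernel\<^esub> F = \<Squnion>\<^bsub>proj_lattice\<^esub> F"
    unfolding sup_proj_lattice[OF Fp]
    by (intro sup_proj_order[OF left.above_projections F] proj_lub_join left.above_projections left.above_join F)
next
  assume G: "G \<subseteq> right.lattice_below_support"
  then have Gp: "G \<subseteq> projections UNIV" using right.below_projections by blast
  show "\<Squnion>\<^bsub>proj_order right.lattice_below_support\<^esub> G = \<Squnion>\<^bsub>proj_lattice\<^esub> G"
    unfolding sup_proj_lattice[OF Gp] by (rule sup_proj_order[OF right.below_projections G right.below_lub[OF G]])
  assume "G \<noteq> {}"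
  then show "\<Sqinter>\<^bsub>proj_order right.lattice_below_support\<^esub> G = \<Sqinter>\<^bsub>proj_lattice\<^esub> G"
    unfolding inf_proj_lattice[OF Gp]
    by (intro inf_proj_order[OF right.below_projections G] proj_glb_meet right.below_meet G Gp)
qed

end

theorem theorem2p10:
  fixes U :: "('a::complex_hilbert \<Rightarrow> 'b::complex_hilbert) set"
    and \<phi> :: "('a \<Rightarrow> 'a) \<Rightarrow> 'b \<Rightarrow> 'b"
    and S1 T1 :: "('a \<Rightarrow> 'a) set" and S2 T2 :: "('b \<Rightarrow> 'b) set"
    and K1 N1 :: "'a set" and K2 N2 :: "'b set"
  assumes "normalizing U"
    and "\<phi> = op_Map U"
    and "S1 = semilattice1 \<phi>" and "S2 = semilattice2 \<phi>"
    and "K1 = range (perp (zero_plus \<phi>))" and "N1 = range (zero_plus \<phi>)"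
    and "K2 = range (I_minus \<phi>)" and "N2 = range (perp (I_minus \<phi>))"
    and "T1 = (\<lambda>L. restrict L K1) ` S1" and "T2 = (\<lambda>M. restrict M K2) ` S2"
  shows
    "complete_ortholattice (proj_order S1) (ocomp1 \<phi>) \<and>
     complete_ortholattice (proj_order S2) (ocomp2 \<phi>) \<and>
     (\<forall>F. F \<subseteq> S1 \<longrightarrow>
        \<Sqinter>\<^bsub>proj_order S1\<^esub> F = \<Sqinter>\<^bsub>proj_lattice\<^esub> F \<and>
        (F \<noteq> {} \<longrightarrow> \<Squnion>\<^bsub>proj_order S1\<^esub> F = \<Squnion>\<^bsub>proj_lattice\<^esub> F)) \<and>
     (\<forall>F. F \<subseteq> S2 \<longrightarrow>
        \<Squnion>\<^bsub>proj_order S2\<^esub> F = \<Squnion>\<^bsub>proj_lattice\<^esub> F \<and>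
        (F \<noteq> {} \<longrightarrow> \<Sqinter>\<^bsub>proj_order S2\<^esub> F = \<Sqinter>\<^bsub>proj_lattice\<^esub> F)) \<and>
     complete_ortholattice_iso \<phi> (proj_order S1) (ocomp1 \<phi>) (proj_order S2) (ocomp2 \<phi>) \<and>
     is_projection_lattice_of_vN K1 T1 \<and>
     is_projection_lattice_of_vN K2 T2 \<and>
     \<comment> \<open>(i)\<close>
     Alg S1 = {block (perp (zero_plus \<phi>)) A (zero_on N1) C D |A C D.
       A \<in> commutant K1 T1 \<and> C \<in> bop K1 N1 \<and> D \<in> bop N1 N1} \<and>
     commutant UNIV (commutant UNIV {adjoint_op S \<circ> T |S T. S \<in> U \<and> T \<in> U}) =
       {block (perp (zero_plus \<phi>)) A (zero_on N1) (zero_on K1) (scalar_on N1 c) |A c.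
         A \<in> commutant K1 T1} \<and>
     \<comment> \<open>(ii)\<close>
     Alg S2 = {block (I_minus \<phi>) B C (zero_on K2) D |B C D.
       B \<in> commutant K2 T2 \<and> C \<in> bop N2 K2 \<and> D \<in> bop N2 N2} \<and>
     commutant UNIV (commutant UNIV {S \<circ> adjoint_op T |S T. S \<in> U \<and> T \<in> U}) =
       {block (I_minus \<phi>) B (zero_on N2) (zero_on K2) (scalar_on N2 c) |B c.
         B \<in> commutant K2 T2} \<and>
     \<comment> \<open>(iii)\<close>
     Lat {adjoint_op S \<circ> T |S T. S \<in> U \<and> T \<in> U} =
       {L \<in> projections UNIV. \<phi> L \<circ> \<phi> (perp L) = (\<lambda>_. 0)} \<and>
     {L \<in> projections UNIV. \<phi> L \<circ> \<phi> (perp L) = (\<lambda>_. 0)} =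
       {block (perp (zero_plus \<phi>)) L1 (zero_on N1) (zero_on K1) L2 |L1 L2.
         L1 \<in> T1 \<and> L2 \<in> projections N1}"
proof -
  interpret normalizing_space U by unfold_locales (rule assms(1))
  have \<phi>: "\<phi> = \<psi>" by (rule assms(2))
  have S1: "S1 = left.lattice_above_kernel" unfolding assms(3) \<phi> by (rule semilattice1)
  have S2: "S2 = right.lattice_below_support" unfolding assms(4) \<phi> by (rule semilattice2)
  have K1: "K1 = range (perp Z)" and N1: "N1 = range (perp (perp Z))"
    and K2: "K2 = range E" and N2: "N2 = range (perp E)"
    unfolding assms(5-8) \<phi> by simp_all
  have T1: "T1 = left.corner_projections"
    unfolding assms(9) S1 K1 by (rule left.corner_projections_above)
  have T2: "T2 = right.corner_projections"
    unfolding assms(10) S2 K2 by (rule right.corner_projections_below)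
  have c1: "ocomp1 \<psi> = (\<lambda>L. perp L \<squnion>\<^bsub>proj_lattice\<^esub> perp (perp Z))"
    by (simp add: fun_eq_iff ocomp1_def)
  have c2: "ocomp2 \<psi> = (\<lambda>M. perp M \<sqinter>\<^bsub>proj_lattice\<^esub> E)"
    by (simp add: fun_eq_iff ocomp2_def)
  show ?thesis
    unfolding S1 S2 T1 T2 K1 N1 K2 N2 \<phi>
  proof (intro conjI)
    show "complete_ortholattice (proj_order left.lattice_above_kernel) (ocomp1 \<psi>)"
      unfolding c1 by (rule left.above_ortholattice)
    show "complete_ortholattice (proj_order right.lattice_below_support) (ocomp2 \<psi>)"
      unfolding c2 by (rule right.below_ortholattice)
    show "{L \<in> projections UNIV. \<psi> L \<circ> \<psi> (perp L) = (\<lambda>_. 0)} =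
       {block (perp Z) L1 (zero_on (range (perp (perp Z)))) (zero_on (range (perp Z))) L2 |L1 L2.
         L1 \<in> left.corner_projections \<and> L2 \<in> projections (range (perp (perp Z)))}"
      unfolding Lat_eq[symmetric] left.Lat_eq_commuting by (rule left.commuting_projections_blocks)
    show "\<forall>F. F \<subseteq> left.lattice_above_kernel \<longrightarrow>
        \<Sqinter>\<^bsub>proj_order left.lattice_above_kernel\<^esub> F = \<Sqinter>\<^bsub>proj_lattice\<^esub> F \<and>
        (F \<noteq> {} \<longrightarrow> \<Squnion>\<^bsub>proj_order left.lattice_above_kernel\<^esub> F = \<Squnion>\<^bsub>proj_lattice\<^esub> F)"
      by (intro allI impI conjI extrema(1,2))
    show "\<forall>F. F \<subseteq> right.lattice_below_support \<longrightarrow>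
        \<Squnion>\<^bsub>proj_order right.lattice_below_support\<^esub> F = \<Squnion>\<^bsub>proj_lattice\<^esub> F \<and>
        (F \<noteq> {} \<longrightarrow> \<Sqinter>\<^bsub>proj_order right.lattice_below_support\<^esub> F = \<Sqinter>\<^bsub>proj_lattice\<^esub> F)"
      by (intro allI impI conjI extrema(3,4))
  qed (rule psi_iso, rule left.corner_projections_vN, rule right.corner_projections_vN,
      rule left.Alg_above, rule left.bicommutant_eq, rule right.Alg_below, rule right.bicommutant_eq,
      rule Lat_eq)
qed

end
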